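(* Assume $b_3=-1$. For every integer $n$ and every integer $k\ge 1$, the following identity holds in the cubic skein module for framed links $D_n,D_{n-k},D_{n-k-1},D_{n-k-2},D_\infty$ identical outside a $3$-ball and equal to the corresponding tangles inside it: $$D_n=P_kD_{n-k}+(b_1P_{k-1}+b_0P_{k-2})D_{n-k-1}+b_0P_{k-1}D_{n-k-2}+\Big(\sum_{i=0}^{k-1}a^{3-n+i}P_i\Big)b_\infty D_\infty .$$
   Context: Ring: $R=\mathbb{Z}[b_0^{\pm1},b_1,b_2,b_\infty^{\pm1},a^{\pm1}]$ with $b_3=-1$. The polynomials $P_k$ are defined by $P_{-2}=P_{-1}=0$, $P_0=1$ and $P_k=b_2P_{k-1}+b_1P_{k-2}+b_0P_{k-3}$ for $k\ge1$ (so $P_1=b_2$, $P_2=b_2^2+b_1$, $P_3=b_2^3+2b_1b_2+b_0$). $2$-tangles: $D_0$ is two horizontal arcs (NW to NE, SW to SE), $D_\infty$ is two vertical arcs (NW to SW, NE to SE), and $D_n$ ($n\in\mathbb{Z}$) is two horizontal strands twisted by $n$ right-handed half-twists ($|n|$ left-handed ones if $n<0$), all with blackboard framing; the convention is that joining NW to NE and SW to SE in $D_1$ gives the unknot with framing $+1$. The cubic skein module of an oriented $3$-manifold $M$ is the quotient of the free $R$-module on ambient isotopy classes of unoriented framed links in $M$ by the submodule generated by $b_0D_0+b_1D_1+b_2D_2+b_3D_3+b_\infty D_\infty$ (framed links identical outside a $3$-ball and equal to the indicated tangles inside it) and $D^{(1)}-aD$, where $D^{(1)}$ is $D$ with its framing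 twisted by one positive full twist. *)

theory Defs
  imports "HOL-Analysis.Analysis" "HOL-Homology.Homology" "HOL-Library.Poly_Mapping"
begin

section \<open>The coefficient ring\<close>

text \<open>
  \<open>\<int>[b\<^sub>0\<^sup>\<plusminus>\<^sup>1, b\<^sub>1, b\<^sub>2, b\<^sub>\<infinity>\<^sup>\<plusminus>\<^sup>1, a\<^sup>\<plusminus>\<^sup>1]\<close> as the monoid ring over \<open>\<int>\<close> of the monoid of monomials:
  \<open>(i, j, k, l, m)\<close> is the exponent vector of \<open>b\<^sub>0\<^sup>i b\<^sub>1\<^sup>j b\<^sub>2\<^sup>k b\<^sub>\<infinity>\<^sup>l a\<^sup>m\<close>.
\<close>

type_synonym skein_ring = "(int \<times> nat \<times> nat \<times> int \<times> int) \<Rightarrow>\<^sub>0 int"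

definition b0 :: skein_ring where "b0 = Poly_Mapping.single (1, 0, 0, 0, 0) 1"
definition b1 :: skein_ring where "b1 = Poly_Mapping.single (0, 1, 0, 0, 0) 1"
definition b2 :: skein_ring where "b2 = Poly_Mapping.single (0, 0, 1, 0, 0) 1"
definition b3 :: skein_ring where "b3 = -1"
definition b_inf :: skein_ring where "b_inf = Poly_Mapping.single (0, 0, 0, 1, 0) 1"

definition a_pow :: "int \<Rightarrow> skein_ring"
  where "a_pow e = Poly_Mapping.single (0, 0, 0, 0, e) 1"

lemma a_pow_0: "a_pow 0 = 1"
  by (simp add: a_pow_def zero_prod_def flip: single_one)

lemma a_pow_add: "a_pow (d + e) = a_pow d * a_pow e"
  by (simp add: a_pow_def mult_single)

function Pk :: "int \<Rightarrow> skein_ring" where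
  "Pk k = (if k < 0 then 0 else if k = 0 then 1
          else b2 * Pk (k - 1) + b1 * Pk (k - 2) + b0 * Pk (k - 3))"
  by auto
termination by (relation "Wellfounded.measure (\<lambda>k. nat (k + 1))") auto

declare Pk.simps [simp del]


section \<open>Oriented 3-manifolds\<close>

definition open_embedding :: "(real^3 \<Rightarrow> 'a) \<Rightarrow> 'a topology \<Rightarrow> bool" where
  "open_embedding h M \<longleftrightarrow> embedding_map euclidean M h \<and> openin M (range h)"

text \<open>Manifolds are topological and may have boundary.\<close>

definition manifold_3 :: "'a topology \<Rightarrow> bool" where
  "manifold_3 M \<longleftrightarrow> Hausdorff_space M \<and> second_countable M \<and>
     (\<forall>x \<in> topspace M. \<exists>U V. openin M U \<and> x \<in> U \<and>
        openin (top_of_set {p :: real^3. p $ 1 \<ge> 0}) V \<and>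
        subtopology M U homeomorphic_space top_of_set V)"

definition manifold_interior :: "'a topology \<Rightarrow> 'a set" where
  "manifold_interior M = \<Union> {range h | h. open_embedding h M}"

text \<open>
  An orientation is a locally consistent choice of generators \<open>\<omega> x\<close> of the local homology
  groups \<open>H\<^sub>3(M, M - x)\<close> at the interior points \<open>x\<close>.
\<close>

definition orientation :: "'a topology \<Rightarrow> ('a \<Rightarrow> 'a chain set) \<Rightarrow> bool" where
  "orientation M \<omega> \<longleftrightarrow> (\<forall>x \<in> manifold_interior M.
     \<omega> x \<in> carrier (relative_homology_group 3 M (topspace M - {x})) \<and>
     generate (relative_homology_group 3 M (topspace M - {x})) {\<omega> x} =
       carrier (relative_homology_group 3 M (topspace M - {x})) \<and>
     (\<exists>U. openin M U \<and> x \<in> U \<and> U \<subseteq> manifold_interior M \<and>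
        (\<exists>\<mu> \<in> carrier (relative_homology_group 3 M (topspace M - U)). \<forall>y \<in> U.
           hom_induced 3 M (topspace M - U) M (topspace M - {y}) id \<mu> = \<omega> y)))"

definition oriented_3_manifold :: "'a topology \<Rightarrow> ('a \<Rightarrow> 'a chain set) \<Rightarrow> bool" where
  "oriented_3_manifold M \<omega> \<longleftrightarrow> manifold_3 M \<and> orientation M \<omega>"

definition affine_simplex :: "(nat \<Rightarrow> real^3) \<Rightarrow> (nat \<Rightarrow> real) \<Rightarrow> real^3" where
  "affine_simplex v = (\<lambda>t \<in> standard_simplex 3. \<Sum>j\<le>3. t j *\<^sub>R v j)"

text \<open>
  The standard orientation of \<open>\<real>\<^sup>3\<close> at \<open>x\<close> is the class of any affine simplex around \<open>x\<close> whose
  edge vectors at the first vertex form a positive (right-handed) basis. A chart preserves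
  orientation if it takes these classes to \<open>\<omega>\<close>.
\<close>

definition oriented_chart :: "'a topology \<Rightarrow> ('a \<Rightarrow> 'a chain set) \<Rightarrow> (real^3 \<Rightarrow> 'a) \<Rightarrow> bool" where
  "oriented_chart M \<omega> h \<longleftrightarrow> open_embedding h M \<and>
     (\<forall>v x. det (vector [v 1 - v 0, v 2 - v 0, v 3 - v 0] :: real^3^3) > 0 \<and>
            x \<in> interior (convex hull (v ` {..3})) \<longrightarrow>
        homologous_rel_set 3 M (topspace M - {h x})
          (frag_of (simplex_map 3 h (affine_simplex v))) = \<omega> (h x))"


section \<open>Framed links and ambient isotopy\<close>

text \<open>
  An unoriented framed link is given by its bands: a finite disjoint union of annuli, tamely
  (i.e. locally flatly) embedded in \<open>M\<close>. The empty link is allowed. The two alternatives below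
  are for points inside a band and on the boundary of a band.
\<close>

definition locally_flat :: "'a topology \<Rightarrow> 'a set \<Rightarrow> bool" where
  "locally_flat M L \<longleftrightarrow> (\<forall>x \<in> L. \<exists>c. open_embedding c M \<and> c 0 = x \<and>
     (c -` L = {p. p $ 3 = 0} \<or> c -` L = {p. p $ 3 = 0 \<and> p $ 2 \<ge> 0}))"

definition annulus :: "complex set" where
  "annulus = {z. 1 \<le> norm z \<and> norm z \<le> 2}"

definition framed_link :: "'a topology \<Rightarrow> 'a set \<Rightarrow> bool" where
  "framed_link M L \<longleftrightarrow> L \<subseteq> topspace M \<and> locally_flat M L \<and>
     (\<exists>\<A>. finite \<A> \<and> disjoint \<A> \<and> \<Union>\<A> = L \<and>
        (\<forall>A \<in> \<A>. subtopology M A homeomorphic_space top_of_set annulus))"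

definition ambient_isotopic :: "'a topology \<Rightarrow> 'a set \<Rightarrow> 'a set \<Rightarrow> bool" where
  "ambient_isotopic M L L' \<longleftrightarrow> (\<exists>H :: real \<times> 'a \<Rightarrow> 'a.
     continuous_map (prod_topology (top_of_set {0..1}) M) M H \<and>
     (\<forall>t \<in> {0..1}. homeomorphic_map M M (\<lambda>x. H (t, x))) \<and>
     (\<forall>x \<in> topspace M. H (0, x) = x) \<and>
     (\<lambda>x. H (1, x)) ` L = L')"

definition isotopy_class :: "'a topology \<Rightarrow> 'a set \<Rightarrow> 'a set set" where
  "isotopy_class M L = {L'. framed_link M L' \<and> ambient_isotopic M L L'}"


section \<open>Tangles\<close>

text \<open>
  The ball is the cube \<open>[-2, 2]\<^sup>3\<close>; the tangles are drawn in the plane \<open>z = 0\<close> with \<open>x\<close> pointing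
  east, \<open>y\<close> pointing north and \<open>z\<close> towards the viewer. All strands are bands of width \<open>1/2\<close>. The
  four ends are at \<open>(\<plusminus>2, \<plusminus>1, 0)\<close>, and near the ends the bands are flat and straight.
\<close>

definition ball3 :: "(real^3) set" where
  "ball3 = {p. \<forall>i. \<bar>p $ i\<bar> \<le> 2}"

definition ramp :: "real \<Rightarrow> real" where
  "ramp x = max 0 (min 1 ((x + 1) / 2))"

text \<open>
  The cores of \<open>D\<^sub>n\<close> are \<open>(x, \<plusminus>cos \<theta>, \<plusminus>sin \<theta>)\<close> where \<open>\<theta>\<close> grows from \<open>0\<close> to \<open>n\<pi>\<close> with \<open>x\<close>. The
  bands extend in direction \<open>y\<close>: this is the blackboard framing. For \<open>n = 1\<close> the strand from NW
  to SE is the overcrossing one, so that joining NW to NE and SW to SE gives a positive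
  crossing, i.e. the unknot with framing \<open>+1\<close>.
\<close>

definition tangle :: "int \<Rightarrow> (real^3) set" where
  "tangle n = {p. \<bar>p $ 1\<bar> \<le> 2 \<and> (\<exists>s \<in> {1, -1}.
      \<bar>p $ 2 - s * cos (of_int n * pi * ramp (p $ 1))\<bar> \<le> 1/4 \<and>
      p $ 3 = s * sin (of_int n * pi * ramp (p $ 1)))}"

text \<open>
  Two U-shaped planar bands with corners, one in \<open>x < 0\<close> joining NW to SW and one in \<open>x > 0\<close>
  joining NE to SE (the condition fails for \<open>\<bar>x\<bar> < 1/4\<close>).
\<close>

definition tangle_inf :: "(real^3) set" where
  "tangle_inf = {p. \<bar>p $ 1\<bar> \<le> 2 \<and> p $ 3 = 0 \<and>
      3/4 \<le> max (3/2 - \<bar>p $ 1\<bar>) \<bar>p $ 2\<bar> \<and> max (3/2 - \<bar>p $ 1\<bar>) \<bar>p $ 2\<bar> \<le> 5/4}"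

text \<open>
  One strand along the \<open>x\<close>-axis, its band making \<open>n\<close> full right-handed turns around the core; a
  right-handed turn is a positive twist of the framing.
\<close>

definition strand :: "int \<Rightarrow> (real^3) set" where
  "strand n = {p. \<bar>p $ 1\<bar> \<le> 2 \<and> (\<exists>t. \<bar>t\<bar> \<le> 1/4 \<and>
      p $ 2 = t * cos (2 * pi * of_int n * ramp (p $ 1)) \<and>
      p $ 3 = t * sin (2 * pi * of_int n * ramp (p $ 1)))}"

text \<open>\<open>L\<close> is a framed link that looks like \<open>T\<close> in the ball \<open>h ` ball3\<close> and is \<open>X\<close> outside of it.\<close>

definition link_with_tangle ::
  "'a topology \<Rightarrow> (real^3 \<Rightarrow> 'a) \<Rightarrow> 'a set \<Rightarrow> (real^3) set \<Rightarrow> 'a set \<Rightarrow> bool" where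
  "link_with_tangle M h X T L \<longleftrightarrow>
     framed_link M L \<and> L \<inter> h ` ball3 = h ` T \<and> L - h ` ball3 = X"


section \<open>The cubic skein module\<close>

type_synonym 'a link_comb = "'a set set \<Rightarrow>\<^sub>0 skein_ring"

definition scale_comb :: "skein_ring \<Rightarrow> 'a link_comb \<Rightarrow> 'a link_comb"  (infixr "\<cdot>" 75)
  where "r \<cdot> f = Poly_Mapping.map ((*) r) f"

lemma lookup_scale_comb: "Poly_Mapping.lookup (r \<cdot> f) c = r * Poly_Mapping.lookup f c"
  by (simp add: scale_comb_def Poly_Mapping.map.rep_eq when_def)

interpretation comb: Modules.module scale_comb
  by standard (auto intro!: poly_mapping_eqI simp: lookup_scale_comb lookup_add algebra_simps)

definition link :: "'a topology \<Rightarrow> 'a set \<Rightarrow> 'a link_comb" where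
  "link M L = Poly_Mapping.single (isotopy_class M L) 1"

text \<open>The free module on the isotopy classes of framed links.\<close>

definition link_combs :: "'a topology \<Rightarrow> 'a link_comb set" where
  "link_combs M = {f. Poly_Mapping.keys f \<subseteq> isotopy_class M ` {L. framed_link M L}}"

definition cubic_relators :: "'a topology \<Rightarrow> ('a \<Rightarrow> 'a chain set) \<Rightarrow> 'a link_comb set" where
  "cubic_relators M \<omega> =
     {b0 \<cdot> link M L0 + b1 \<cdot> link M L1 + b2 \<cdot> link M L2 + b3 \<cdot> link M L3 + b_inf \<cdot> link M Linf
      | h X L0 L1 L2 L3 Linf. oriented_chart M \<omega> h \<and>
        link_with_tangle M h X (tangle 0) L0 \<and> link_with_tangle M h X (tangle 1) L1 \<and>
        link_with_tangle M h X (tangle 2) L2 \<and> link_with_tangle M h X (tangle 3) L3 \<and>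
        link_with_tangle M h X tangle_inf Linf}"

definition framing_relators :: "'a topology \<Rightarrow> ('a \<Rightarrow> 'a chain set) \<Rightarrow> 'a link_comb set" where
  "framing_relators M \<omega> =
     {link M L1 - a_pow 1 \<cdot> link M L
      | h X L L1. oriented_chart M \<omega> h \<and>
        link_with_tangle M h X (strand 0) L \<and> link_with_tangle M h X (strand 1) L1}"

definition skein_submodule :: "'a topology \<Rightarrow> ('a \<Rightarrow> 'a chain set) \<Rightarrow> 'a link_comb set" where
  "skein_submodule M \<omega> = comb.span (cubic_relators M \<omega> \<union> framing_relators M \<omega>)"

definition skein_rel ::
  "'a topology \<Rightarrow> ('a \<Rightarrow> 'a chain set) \<Rightarrow> ('a link_comb \<times> 'a link_comb) set" where
  "skein_rel M \<omega> =
     {(f, g). f \<in> link_combs M \<and> g \<in> link_combs M \<and> f - g \<in> skein_submodule M \<omega>}"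

definition cubic_skein_module ::
  "'a topology \<Rightarrow> ('a \<Rightarrow> 'a chain set) \<Rightarrow> 'a link_comb set set" where
  "cubic_skein_module M \<omega> = link_combs M // skein_rel M \<omega>"

text \<open>
  The class of a combination of links in the skein module. The module structure of the quotient
  is the one for which this map is linear.
\<close>

definition skein_class ::
  "'a topology \<Rightarrow> ('a \<Rightarrow> 'a chain set) \<Rightarrow> 'a link_comb \<Rightarrow> 'a link_comb set" where
  "skein_class M \<omega> f = skein_rel M \<omega> `` {f}"

lemma equiv_skein_rel: "equiv (link_combs M) (skein_rel M \<omega>)"
proof (rule equivI)
  show "skein_rel M \<omega> \<subseteq> link_combs M \<times> link_combs M"
    by (auto simp: skein_rel_def)
  show "refl_on (link_combs M) (skein_rel M \<omega>)"
    by (auto simp: refl_on_def skein_rel_def skein_submodule_def comb.span_zero)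
  show "sym (skein_rel M \<omega>)"
    unfolding sym_def skein_rel_def skein_submodule_def
    using comb.span_neg by fastforce
  show "trans (skein_rel M \<omega>)"
    unfolding trans_def skein_rel_def skein_submodule_def
    using comb.span_add by fastforce
qed

lemma link_in_link_combs: "framed_link M L \<Longrightarrow> link M L \<in> link_combs M"
  by (auto simp: link_def link_combs_def)

lemma skein_class_eq_iff:
  assumes "f \<in> link_combs M" "g \<in> link_combs M"
  shows "skein_class M \<omega> f = skein_class M \<omega> g \<longleftrightarrow> f - g \<in> skein_submodule M \<omega>"
  using eq_equiv_class_iff [OF equiv_skein_rel assms] assms
  by (auto simp: skein_class_def skein_rel_def)

end

theory Submission
  imports Defs
begin

text \<open>
  The tangle \<open>D\<^bsub>m+j\<^esub>\<close> is isotopic to one in which \<open>m\<close> half-twists are followed by \<open>D\<^sub>j\<close> in a small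
  cube. The cubic relator of this cube expresses \<open>D\<^bsub>m+3\<^esub>\<close> by \<open>D\<^sub>m\<close>, \<open>D\<^bsub>m+1\<^esub>\<close>, \<open>D\<^bsub>m+2\<^esub>\<close> and \<open>D\<^sub>\<infinity>\<close>
  preceded by \<open>m\<close> half-twists. Turning the tip of the arc of \<open>D\<^sub>\<infinity>\<close> through the angle \<open>-m\<pi>\<close> undoes
  the crossings and leaves \<open>-m\<close> half-twists in each of the two strands of the band, so this link is
  \<open>a\<^bsup>-m\<^esup> D\<^sub>\<infinity>\<close>. The claim follows from \<open>D\<^bsub>m+3\<^esub> = b\<^sub>2 D\<^bsub>m+2\<^esub> + b\<^sub>1 D\<^bsub>m+1\<^esub> + b\<^sub>0 D\<^sub>m + a\<^bsup>-m\<^esup> b\<^sub>\<infinity> D\<^sub>\<infinity>\<close> by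
  induction on \<open>k\<close>. That all \<open>D\<^sub>m\<close> are framed links follows from this property of \<open>D\<^bsub>n-k\<^esub>\<close> and
  \<open>D\<^bsub>n-k-1\<^esub>\<close>, since adding full twists does not change the homeomorphism type.

  All isotopies but two reparametrizations of the \<open>x\<close>-axis are rotations in tubular coordinates.
\<close>

section \<open>Changing framed links\<close>

text \<open>Relators are formed from framed links only, so every auxiliary link must be shown to be
  one, and the hypotheses provide this for \<open>D_inf\<close> and a few \<open>D m\<close>.
  Isotopies transport it, but changing the number of full twists is in general no isotopy. Hence
  rotations through an angle \<open>\<phi>\<close> appear in two versions: if \<open>\<phi>\<close>
  vanishes at the ends of the tube, damping it radially gives an ambient isotopy; if only
  \<open>cis \<phi>\<close> is 1 there, the links are still homeomorphic with matching local charts,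
  which is enough for \<open>framed_link\<close>.

  Rotating two strands about their common axis turns their bands as well and so destroys the
  blackboard framing. For D_n each band is turned back about its own core. For the finger the turned
  bands are kept: the two arms carry twists of the same handedness, so they add up instead of
  cancelling when slid to the tip, and this sum is the exponent of \<open>a\<close>.

  A half-turn maps a slice of two flat strands, and any slice of the planar arc, to itself. This is
  why a relator cube fits after any integer number of half-twists and why the tip of the finger can
  be turned.\<close>

lemma open_embedding_alt:
  "open_embedding e M \<longleftrightarrow> continuous_map euclidean M e \<and> open_map euclidean M e \<and> inj e"
proof
  assume e: "open_embedding e M"
  then have hm: "homeomorphic_map euclidean (subtopology M (range e)) e"
    and o: "openin M (range e)"
    by (auto simp: open_embedding_def embedding_map_def)
  show "continuous_map euclidean M e \<and> open_map euclidean M e \<and> inj e"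
    using homeomorphic_imp_continuous_map[OF hm] homeomorphic_imp_open_map[OF hm]
      homeomorphic_imp_injective_map[OF hm] o
    by (auto simp: continuous_map_in_subtopology open_map_def openin_open_subtopology)
next
  assume "continuous_map euclidean M e \<and> open_map euclidean M e \<and> inj e"
  then show "open_embedding e M"
    by (auto simp: open_embedding_def open_map_def intro!: injective_open_imp_embedding_map)
qed

text \<open>Openness of \<open>b\<close> is invariance of domain, so a change of coordinates only
  has to be continuous and injective.\<close>

lemma open_embedding_comp:
  fixes b :: "real^3 \<Rightarrow> real^3"
  assumes "open_embedding e M" "continuous_on UNIV b" "inj b"
  shows "open_embedding (e \<circ> b) M"
proof -
  have "open (b ` S)" if "open S" for S
    using that assms(2,3)
    by (intro invariance_of_domain_gen) (auto intro: continuous_on_subset inj_on_subset)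
  then have "open_map euclidean euclidean b"
    by (auto simp: open_map_def)
  moreover have "continuous_map euclidean euclidean b"
    using assms(2) by simp
  ultimately show ?thesis
    using assms(1,3) unfolding open_embedding_alt
    by (blast intro: continuous_map_compose open_map_compose inj_compose)
qed

lemma open_embedding_homeomorphic_comp:
  assumes "open_embedding e M" "homeomorphic_map M N f"
  shows "open_embedding (f \<circ> e) N"
  unfolding open_embedding_alt
proof (intro conjI)
  have e: "continuous_map euclidean M e" "open_map euclidean M e" "inj e"
    using assms(1) by (auto simp: open_embedding_alt)
  show "continuous_map euclidean N (f \<circ> e)" "open_map euclidean N (f \<circ> e)"
    using e assms(2) homeomorphic_imp_continuous_map homeomorphic_imp_open_map
    by (blast intro: continuous_map_compose open_map_compose)+
  have "range e \<subseteq> topspace M"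
    using continuous_map_image_subset_topspace[OF e(1)] by simp
  then show "inj (f \<circ> e)"
    using e(3) homeomorphic_imp_injective_map[OF assms(2)] by (meson comp_inj_on inj_on_subset)
qed

lemma continuous_map_inv_open_embedding:
  assumes "open_embedding e M"
  shows "continuous_map (subtopology M (range e)) euclidean (inv_into UNIV e)"
proof -
  have e: "continuous_map euclidean M e" "open_map euclidean M e" "inj e"
    using assms by (auto simp: open_embedding_alt)
  have "open_map euclidean (subtopology M (range e)) e"
    using e by (auto simp: open_map_into_subtopology)
  moreover have "range e \<subseteq> topspace M"
    using continuous_map_image_subset_topspace[OF e(1)] by simp
  ultimately show ?thesis
    using e(3) by (subst open_eq_continuous_inverse_map[symmetric]) (auto simp: inv_f_f)
qed

text \<open>Squeezing each coordinate separately by an odd increasing function respects the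
  conditions \<open>p $ 3 = 0\<close> and \<open>p $ 2 \<ge> 0\<close>, that is, both local models
  in \<open>locally_flat\<close>.\<close>

lemma small_open_embedding:
  fixes \<epsilon> :: real
  assumes "\<epsilon> > 0"
  obtains b :: "real^3 \<Rightarrow> real^3" where
    "continuous_on UNIV b" "inj b" "b 0 = 0" "\<And>p. norm (b p) < \<epsilon>"
    "\<And>p i. b p $ i = 0 \<longleftrightarrow> p $ i = 0" "\<And>p i. 0 \<le> b p $ i \<longleftrightarrow> 0 \<le> p $ i"
proof
  \<comment> \<open>The factor 1/3 is there because the norm is estimated by the sum of the three
    coordinates.\<close>
  define g where "g x = \<epsilon>/3 * (x / (1 + \<bar>x\<bar>))" for x :: real
  define b :: "real^3 \<Rightarrow> real^3" where "b p = (\<chi> i. g (p $ i))" for p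
  have g_less: "\<bar>g x\<bar> < \<epsilon>/3" for x
    using assms by (auto simp: g_def abs_mult divide_simps)
  have inj_g: "x = y" if "g x = g y" for x y
  proof -
    have inv: "z = z / (1 + \<bar>z\<bar>) / (1 - \<bar>z / (1 + \<bar>z\<bar>)\<bar>)" for z :: real
    proof -
      have "1 - \<bar>z / (1 + \<bar>z\<bar>)\<bar> = 1 / (1 + \<bar>z\<bar>)"
        by (simp add: abs_divide divide_simps)
      then show ?thesis by simp
    qed
    have "x / (1 + \<bar>x\<bar>) = y / (1 + \<bar>y\<bar>)"
      using that assms unfolding g_def mult_cancel_left by simp
    then show ?thesis
      by (subst inv[of x], subst inv[of y]) (simp only:)
  qed
  show "continuous_on UNIV b"
    unfolding b_def g_def
    by (intro continuous_intros) (auto simp: add_nonneg_eq_0_iff)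
  show "inj b"
    using inj_g by (auto simp: inj_def b_def vec_eq_iff)
  show "b 0 = 0"
    by (simp add: b_def g_def vec_eq_iff)
  show "norm (b p) < \<epsilon>" for p
    using norm_le_l1_cart[of "b p"] g_less[of "p $ 1"] g_less[of "p $ 2"] g_less[of "p $ 3"]
    by (simp add: b_def sum_3)
  show "b p $ i = 0 \<longleftrightarrow> p $ i = 0" for p i
    using assms by (auto simp: b_def g_def)
  show "0 \<le> b p $ i \<longleftrightarrow> 0 \<le> p $ i" for p i
    using assms by (auto simp: b_def g_def zero_le_mult_iff zero_le_divide_iff)
qed

lemma open_embedding_neighbourhood:
  assumes "open_embedding c M" "openin M U" "c q \<in> U"
  obtains b :: "real^3 \<Rightarrow> real^3" where "continuous_on UNIV b" "inj b" "b 0 = q" "range (c \<circ> b) \<subseteq> U"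
    "\<forall>p i. b p $ i = q $ i \<longleftrightarrow> p $ i = 0" "\<forall>p i. q $ i \<le> b p $ i \<longleftrightarrow> 0 \<le> p $ i"
proof -
  have "continuous_map euclidean M c"
    using assms(1) by (simp add: open_embedding_alt)
  then have "open {p. c p \<in> U}"
    using openin_continuous_map_preimage[OF _ assms(2), of euclidean c] by simp
  then obtain \<epsilon> where \<epsilon>: "\<epsilon> > 0" "ball q \<epsilon> \<subseteq> {p. c p \<in> U}"
    using assms(3) unfolding open_contains_ball by blast
  obtain b :: "real^3 \<Rightarrow> real^3" where b: "continuous_on UNIV b" "inj b" "b 0 = 0" "\<And>p. norm (b p) < \<epsilon>"
    "\<And>p i. b p $ i = 0 \<longleftrightarrow> p $ i = 0" "\<And>p i. 0 \<le> b p $ i \<longleftrightarrow> 0 \<le> p $ i"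
    using small_open_embedding[OF \<epsilon>(1)] by metis
  show thesis
  proof (rule that[of "\<lambda>p. q + b p"])
    show "continuous_on UNIV (\<lambda>p. q + b p)"
      using b(1) by (intro continuous_intros)
    show "inj (\<lambda>p. q + b p)"
      using b(2) by (simp add: inj_def)
    have "q + b p \<in> ball q \<epsilon>" for p
      using b(4)[of p] by (simp add: dist_norm)
    then show "range (c \<circ> (\<lambda>p. q + b p)) \<subseteq> U"
      using \<epsilon>(2) by (auto simp: subset_iff)
  qed (simp_all add: b)
qed

text \<open>\<open>f\<close> is a map between the links only. On each relatively open piece
  \<open>L \<inter> range e1\<close> it coincides with \<open>e2\<close> after the inverse of
  \<open>e1\<close>, and these pieces are pasted.\<close>

lemma continuous_map_locally_open_embeddings:
  assumes L: "L \<subseteq> topspace M" and fL: "f ` L \<subseteq> L'"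
    and loc: "\<And>x. x \<in> L \<Longrightarrow> \<exists>e1 e2. open_embedding e1 M \<and> open_embedding e2 N \<and> x \<in> range e1 \<and>
         (\<forall>p. e1 p \<in> L \<longrightarrow> f (e1 p) = e2 p)"
  shows "continuous_map (subtopology M L) (subtopology N L') f"
proof -
  obtain e1 e2 where e: "\<And>x. x \<in> L \<Longrightarrow> open_embedding (e1 x) M \<and> open_embedding (e2 x) N \<and>
      x \<in> range (e1 x) \<and> (\<forall>p. e1 x p \<in> L \<longrightarrow> f (e1 x p) = e2 x p)"
    using loc by metis
  have "continuous_map (subtopology M L) N f"
  proof (rule pasting_lemma[where I = L and T = "\<lambda>x. L \<inter> range (e1 x)" and f = "\<lambda>_. f"])
    fix x assume x: "x \<in> L"
    have "openin M (range (e1 x))"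
      using e[OF x] by (auto simp: open_embedding_def)
    then show "openin (subtopology M L) (L \<inter> range (e1 x))"
      by (rule openin_subtopology_Int2)
    have "continuous_map (subtopology M (range (e1 x))) N (e2 x \<circ> inv_into UNIV (e1 x))"
      using e[OF x] by (intro continuous_map_compose[OF continuous_map_inv_open_embedding])
         (auto simp: open_embedding_alt)
    then have "continuous_map (subtopology M (L \<inter> range (e1 x))) N (e2 x \<circ> inv_into UNIV (e1 x))"
      by (rule continuous_map_from_subtopology_mono) auto
    moreover have "(e2 x \<circ> inv_into UNIV (e1 x)) y = f y" if "y \<in> L \<inter> range (e1 x)" for y
      using that e[OF x] by (auto simp: open_embedding_alt inv_f_f)
    ultimately have "continuous_map (subtopology M (L \<inter> range (e1 x))) N f"
      by (rule continuous_map_eq) simp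
    then show "continuous_map (subtopology (subtopology M L) (L \<inter> range (e1 x))) N f"
      by (simp add: subtopology_subtopology)
  next
    show "\<exists>j. j \<in> L \<and> x \<in> L \<inter> range (e1 j) \<and> f x = f x" if "x \<in> topspace (subtopology M L)" for x
      using that e[of x] by (intro exI[of _ x]) simp
  qed simp
  with fL show ?thesis
    by (auto simp: continuous_map_in_subtopology)
qed

text \<open>This covers changes such as a full twist of a band, which extend to homeomorphisms of the
  ambient manifold only locally.\<close>

lemma framed_link_transfer:
  assumes L: "framed_link M L" and f: "bij_betw f L L'"
    and loc: "\<And>x. x \<in> L \<Longrightarrow> \<exists>e1 e2. open_embedding e1 M \<and> open_embedding e2 M \<and> x \<in> range e1 \<and>
         (\<forall>p. (e1 p \<in> L \<longleftrightarrow> e2 p \<in> L') \<and> (e1 p \<in> L \<longrightarrow> f (e1 p) = e2 p))"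
  shows "framed_link M L'"
proof -
  have LM: "L \<subseteq> topspace M" and flat: "locally_flat M L"
    using L by (auto simp: framed_link_def)
  have fL: "f ` L = L'" and inj: "inj_on f L"
    using f by (auto simp: bij_betw_def)
  define g where "g = inv_into L f"
  have gf: "g (f x) = x" if "x \<in> L" for x
    using that inj by (simp add: g_def)
  have loc2: "\<exists>e2 e1. open_embedding e2 M \<and> open_embedding e1 M \<and> y \<in> range e2 \<and>
        (\<forall>p. e2 p \<in> L' \<longrightarrow> g (e2 p) = e1 p)" if y: "y \<in> L'" for y
  proof -
    obtain x where x: "x \<in> L" "y = f x" using y fL by auto
    obtain e1 e2 where e: "open_embedding e1 M" "open_embedding e2 M" "x \<in> range e1"
      "\<And>p. e1 p \<in> L \<longleftrightarrow> e2 p \<in> L'" "\<And>p. e1 p \<in> L \<Longrightarrow> f (e1 p) = e2 p"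
      using loc[OF x(1)] by blast
    have "y \<in> range e2"
      using e(3,5) x by fastforce
    moreover have "\<forall>p. e2 p \<in> L' \<longrightarrow> g (e2 p) = e1 p"
      using e(4,5) gf by metis
    ultimately show ?thesis
      using e(1,2) by blast
  qed
  have L'M: "L' \<subseteq> topspace M"
  proof
    fix y assume "y \<in> L'"
    then obtain e2 where "open_embedding e2 M" "y \<in> range e2"
      using loc2 by blast
    then show "y \<in> topspace M"
      by (auto simp: open_embedding_def dest: openin_subset)
  qed
  have cont_f: "continuous_map (subtopology M L) (subtopology M L') f"
  proof (rule continuous_map_locally_open_embeddings[OF LM])
    fix x assume "x \<in> L"
    from loc[OF this] obtain e1 e2 where "open_embedding e1 M" "open_embedding e2 M" "x \<in> range e1"
      "\<forall>p. (e1 p \<in> L \<longleftrightarrow> e2 p \<in> L') \<and> (e1 p \<in> L \<longrightarrow> f (e1 p) = e2 p)"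
      by blast
    then show "\<exists>e1 e2. open_embedding e1 M \<and> open_embedding e2 M \<and> x \<in> range e1 \<and>
        (\<forall>p. e1 p \<in> L \<longrightarrow> f (e1 p) = e2 p)"
      by (intro exI[of _ e1] exI[of _ e2]) simp
  qed (simp add: fL)
  have gL: "g ` L' = L"
    using fL gf by force
  have cont_g: "continuous_map (subtopology M L') (subtopology M L) g"
    by (rule continuous_map_locally_open_embeddings[OF L'M _ loc2]) (simp_all add: gL)
  have hom: "homeomorphic_maps (subtopology M L) (subtopology M L') f g"
    using cont_f cont_g LM L'M gf fL by (auto simp: homeomorphic_maps_def)
  have "locally_flat M L'"
    unfolding locally_flat_def
  proof
    fix y assume "y \<in> L'"
    then obtain x where x: "x \<in> L" "y = f x" using fL by auto
    obtain e1 e2 where e: "open_embedding e1 M" "open_embedding e2 M" "x \<in> range e1"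
      "\<And>p. e1 p \<in> L \<longleftrightarrow> e2 p \<in> L'" "\<And>p. e1 p \<in> L \<Longrightarrow> f (e1 p) = e2 p"
      using loc[OF x(1)] by blast
    obtain c where c: "open_embedding c M" "c 0 = x"
      "c -` L = {p. p $ 3 = 0} \<or> c -` L = {p. p $ 3 = 0 \<and> p $ 2 \<ge> 0}"
      using flat x(1) unfolding locally_flat_def by blast
    have "openin M (range e1)"
      using e(1) by (simp add: open_embedding_def)
    moreover have "c 0 \<in> range e1"
      using e(3) c(2) by simp
    ultimately
    obtain b :: "real^3 \<Rightarrow> real^3" where b: "continuous_on UNIV b" "inj b" "b 0 = 0" "range (c \<circ> b) \<subseteq> range e1"
      and "\<forall>p i. b p $ i = 0 $ i \<longleftrightarrow> p $ i = 0" "\<forall>p i. 0 $ i \<le> b p $ i \<longleftrightarrow> 0 \<le> p $ i"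
      by (rule open_embedding_neighbourhood[OF c(1)]) (erule that; assumption)
    then have sgn: "b p $ i = 0 \<longleftrightarrow> p $ i = 0" "0 \<le> b p $ i \<longleftrightarrow> 0 \<le> p $ i" for p i
      by simp_all
    have cb: "open_embedding (c \<circ> b) M"
      using open_embedding_comp[OF c(1) b(1,2)] .
    \<comment> \<open>The flat chart of \<open>L\<close> at \<open>x\<close>, read in the
      coordinates of \<open>e1\<close>. Following it by \<open>e2\<close> gives a flat chart of
      \<open>L'\<close> at \<open>y\<close>, since \<open>L\<close> seen through \<open>e1\<close>
      and \<open>L'\<close> seen through \<open>e2\<close> are the same set.\<close>
    define d where "d = inv_into UNIV e1 \<circ> (c \<circ> b)"
    have e1d: "e1 (d p) = c (b p)" for p
      using b(4) by (auto simp: d_def f_inv_into_f image_subset_iff)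
    have "continuous_map euclidean (subtopology M (range e1)) (c \<circ> b)"
      using cb b(4) by (auto simp: open_embedding_alt continuous_map_in_subtopology)
    then have "continuous_map euclidean euclidean d"
      unfolding d_def by (rule continuous_map_compose[OF _ continuous_map_inv_open_embedding[OF e(1)]])
    then have contd: "continuous_on UNIV d" by simp
    have injd: "inj d"
    proof (rule injI)
      fix p q assume "d p = d q"
      then have "(c \<circ> b) p = (c \<circ> b) q" using e1d by (metis comp_apply)
      then show "p = q" using cb by (auto simp: open_embedding_alt inj_def)
    qed
    have "open_embedding (e2 \<circ> d) M"
      using open_embedding_comp[OF e(2) contd injd] .
    moreover have "(e2 \<circ> d) 0 = y"
      using e(5)[of "d 0"] e1d[of 0] b(3) c(2) x by simp
    moreover have eq: "(e2 \<circ> d) -` L' = b -` (c -` L)"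
      by (auto simp: e(4)[symmetric] e1d)
    have "(e2 \<circ> d) -` L' = {p. p $ 3 = 0} \<or> (e2 \<circ> d) -` L' = {p. p $ 3 = 0 \<and> p $ 2 \<ge> 0}"
      using c(3) unfolding eq by (elim disjE) (simp_all add: sgn)
    ultimately show "\<exists>c. open_embedding c M \<and> c 0 = y \<and>
       (c -` L' = {p. p $ 3 = 0} \<or> c -` L' = {p. p $ 3 = 0 \<and> p $ 2 \<ge> 0})"
      by blast
  qed
  obtain \<A> where \<A>: "finite \<A>" "disjoint \<A>" "\<Union>\<A> = L"
    "\<And>A. A \<in> \<A> \<Longrightarrow> subtopology M A homeomorphic_space top_of_set annulus"
    using L by (auto simp: framed_link_def)
  have dis: "disjoint ((`) f ` \<A>)"
  proof (rule disjointI)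
    fix B C assume "B \<in> (`) f ` \<A>" "C \<in> (`) f ` \<A>" "B \<noteq> C"
    then obtain A A' where A: "A \<in> \<A>" "A' \<in> \<A>" "B = f ` A" "C = f ` A'" "A \<noteq> A'"
      by auto
    then have "A \<inter> A' = {}" using \<A>(2) by (auto dest: disjointD)
    moreover have "A \<subseteq> L" "A' \<subseteq> L" using A \<A>(3) by auto
    ultimately show "B \<inter> C = {}"
      using inj_on_image_Int[OF inj, of A A'] A by simp
  qed
  have ann: "subtopology M (f ` A) homeomorphic_space top_of_set annulus" if A: "A \<in> \<A>" for A
  proof -
    have AL: "A \<subseteq> L" using A \<A>(3) by auto
    have "homeomorphic_map (subtopology M L) (subtopology M L') f"
      using hom homeomorphic_maps_map by blast
    then have "homeomorphic_map (subtopology (subtopology M L) A) (subtopology (subtopology M L') (f ` A)) f"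
      by (rule homeomorphic_map_subtopologies) (use AL LM L'M fL in auto)
    moreover have "subtopology (subtopology M L) A = subtopology M A"
      "subtopology (subtopology M L') (f ` A) = subtopology M (f ` A)"
      using AL fL by (auto simp: subtopology_subtopology Int_absorb1 image_mono)
    ultimately have "subtopology M A homeomorphic_space subtopology M (f ` A)"
      using homeomorphic_map_imp_homeomorphic_space by metis
    then show ?thesis
      using \<A>(4)[OF A] homeomorphic_space_sym homeomorphic_space_trans by blast
  qed
  have "\<Union> ((`) f ` \<A>) = L'"
    using \<A>(3) fL by blast
  with \<A>(1) dis ann have "\<exists>\<A>. finite \<A> \<and> disjoint \<A> \<and> \<Union>\<A> = L' \<and>
        (\<forall>A \<in> \<A>. subtopology M A homeomorphic_space top_of_set annulus)"
    by (intro exI[of _ "(`) f ` \<A>"] conjI ballI) auto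
  with L'M \<open>locally_flat M L'\<close> show ?thesis
    by (simp add: framed_link_def)
qed

lemma framed_link_homeomorphic_image:
  assumes L: "framed_link M L" and f: "homeomorphic_map M M f"
  shows "framed_link M (f ` L)"
proof (rule framed_link_transfer[OF L])
  have LM: "L \<subseteq> topspace M" and flat: "locally_flat M L"
    using L by (auto simp: framed_link_def)
  have inj: "inj_on f (topspace M)"
    using homeomorphic_imp_injective_map[OF f] .
  show "bij_betw f L (f ` L)"
    using inj LM by (auto simp: bij_betw_def intro: inj_on_subset)
  fix x assume "x \<in> L"
  then obtain c where c: "open_embedding c M" "c 0 = x"
    using flat unfolding locally_flat_def by blast
  have "range c \<subseteq> topspace M"
    using c(1) by (auto simp: open_embedding_def dest: openin_subset)
  then have "f (c p) \<in> f ` L \<longleftrightarrow> c p \<in> L" for p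
    using inj_on_image_mem_iff[OF inj _ LM] by blast
  then have "\<forall>p. (c p \<in> L \<longleftrightarrow> (f \<circ> c) p \<in> f ` L) \<and> (c p \<in> L \<longrightarrow> f (c p) = (f \<circ> c) p)"
    by simp
  moreover have "open_embedding (f \<circ> c) M"
    using open_embedding_homeomorphic_comp[OF c(1) f] .
  moreover have "x \<in> range c"
    using c(2) by auto
  ultimately show "\<exists>e1 e2. open_embedding e1 M \<and> open_embedding e2 M \<and> x \<in> range e1 \<and>
         (\<forall>p. (e1 p \<in> L \<longleftrightarrow> e2 p \<in> f ` L) \<and> (e1 p \<in> L \<longrightarrow> f (e1 p) = e2 p))"
    using c(1) by (intro exI[of _ c] exI[of _ "f \<circ> c"] conjI) simp_all
qed


section \<open>Ambient isotopies\<close>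

lemma ambient_isotopic_trans:
  assumes "ambient_isotopic M L1 L2" "ambient_isotopic M L2 L3"
  shows "ambient_isotopic M L1 L3"
proof -
  let ?I = "top_of_set {0..1::real}"
  obtain H1 where H1: "continuous_map (prod_topology ?I M) M H1"
    "\<And>t. t \<in> {0..1} \<Longrightarrow> homeomorphic_map M M (\<lambda>x. H1 (t, x))"
    "\<And>x. x \<in> topspace M \<Longrightarrow> H1 (0, x) = x" "(\<lambda>x. H1 (1, x)) ` L1 = L2"
    using assms(1) unfolding ambient_isotopic_def by blast
  obtain H2 where H2: "continuous_map (prod_topology ?I M) M H2"
    "\<And>t. t \<in> {0..1} \<Longrightarrow> homeomorphic_map M M (\<lambda>x. H2 (t, x))"
    "\<And>x. x \<in> topspace M \<Longrightarrow> H2 (0, x) = x" "(\<lambda>x. H2 (1, x)) ` L2 = L3"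
    using assms(2) unfolding ambient_isotopic_def by blast
  \<comment> \<open>Both isotopies run at the same time, which avoids pasting two time intervals; at
    time 1 the result is the composite of the two end maps.\<close>
  define H where "H = H2 \<circ> (\<lambda>p. (fst p, H1 p))"
  have "continuous_map (prod_topology ?I M) (prod_topology ?I M) (\<lambda>p. (fst p, H1 p))"
    using H1(1) by (intro continuous_map_pairedI continuous_map_fst)
  then have "continuous_map (prod_topology ?I M) M H"
    unfolding H_def using H2(1) by (rule continuous_map_compose)
  moreover have "homeomorphic_map M M (\<lambda>x. H (t, x))" if "t \<in> {0..1}" for t
    using homeomorphic_map_compose[OF H1(2)[OF that] H2(2)[OF that]] by (simp add: H_def o_def)
  moreover have "H (0, x) = x" if "x \<in> topspace M" for x
    using that H1(3) H2(3) by (simp add: H_def)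
  moreover have "(\<lambda>x. H (1, x)) ` L1 = L3"
    unfolding H1(4)[symmetric] H2(4)[symmetric] H_def image_image by simp
  ultimately show ?thesis
    unfolding ambient_isotopic_def by blast
qed

lemma ambient_isotopic_sym:
  assumes "ambient_isotopic M L1 L2" "L1 \<subseteq> topspace M"
  shows "ambient_isotopic M L2 L1"
proof -
  let ?I = "top_of_set {0..1::real}"
  obtain H where H: "continuous_map (prod_topology ?I M) M H"
    "\<And>t. t \<in> {0..1} \<Longrightarrow> homeomorphic_map M M (\<lambda>x. H (t, x))"
    "\<And>x. x \<in> topspace M \<Longrightarrow> H (0, x) = x" "(\<lambda>x. H (1, x)) ` L1 = L2"
    using assms(1) unfolding ambient_isotopic_def by blast
  have "homeomorphic_map M M (\<lambda>x. H (1, x))"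
    using H(2) by simp
  then obtain g where "homeomorphic_maps M M (\<lambda>x. H (1, x)) g"
    using homeomorphic_map_maps by blast
  then have g: "homeomorphic_map M M g" "\<And>x. x \<in> topspace M \<Longrightarrow> g (H (1, x)) = x"
    "\<And>x. x \<in> topspace M \<Longrightarrow> H (1, g x) = x" 
    by (auto simp: homeomorphic_maps_map)
  have gM: "g x \<in> topspace M" if "x \<in> topspace M" for x
    using homeomorphic_imp_surjective_map[OF g(1)] that by blast
  have contg: "continuous_map M M g"
    using g(1) homeomorphic_imp_continuous_map by blast
  \<comment> \<open>Time is reversed, and the inverse \<open>g\<close> of the end map is applied
    first so that the isotopy starts at the identity.\<close>
  define H' where "H' = H \<circ> (\<lambda>p. (1 - fst p, g (snd p)))"
  have "continuous_map ?I ?I (\<lambda>t. 1 - t)"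
    by (auto intro!: continuous_intros)
  from continuous_map_compose[OF continuous_map_fst this]
  have "continuous_map (prod_topology ?I M) (prod_topology ?I M) (\<lambda>p. (1 - fst p, g (snd p)))"
    using continuous_map_compose[OF continuous_map_snd contg]
    by (intro continuous_map_pairedI) (simp_all add: o_def)
  then have "continuous_map (prod_topology ?I M) M H'"
    unfolding H'_def using H(1) by (rule continuous_map_compose)
  moreover have "homeomorphic_map M M (\<lambda>x. H' (t, x))" if "t \<in> {0..1}" for t
    using homeomorphic_map_compose[OF g(1) H(2)[of "1 - t"]] that by (simp add: H'_def o_def)
  moreover have "H' (0, x) = x" if "x \<in> topspace M" for x
    using that g(3) by (simp add: H'_def)
  moreover have "H' (1, H (1, x)) = x" if "x \<in> L1" for x
    using that assms(2) g(2) H(3) gM by (auto simp: H'_def subset_iff)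
  then have "(\<lambda>x. H' (1, x)) ` L2 = L1"
    unfolding H(4)[symmetric] image_image by simp
  ultimately show ?thesis
    unfolding ambient_isotopic_def by blast
qed

lemma framed_link_ambient_isotopic:
  assumes "ambient_isotopic M L L'" "framed_link M L"
  shows "framed_link M L'"
proof -
  obtain H :: "real \<times> 'a \<Rightarrow> 'a" where "homeomorphic_map M M (\<lambda>x. H (1, x))" "(\<lambda>x. H (1, x)) ` L = L'"
    using assms(1) unfolding ambient_isotopic_def by fastforce
  then show ?thesis
    using framed_link_homeomorphic_image[OF assms(2)] by metis
qed

lemma link_ambient_isotopic:
  assumes "ambient_isotopic M L L'" "framed_link M L"
  shows "link M L = link M L'"
proof -
  have "L \<subseteq> topspace M"
    using assms(2) by (simp add: framed_link_def)
  then have "isotopy_class M L = isotopy_class M L'"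
    using assms(1) ambient_isotopic_trans ambient_isotopic_sym unfolding isotopy_class_def by blast
  then show ?thesis by (simp add: link_def)
qed

definition chart_extension :: "(real^3 \<Rightarrow> 'a) \<Rightarrow> (real^3 \<Rightarrow> real^3) \<Rightarrow> 'a \<Rightarrow> 'a" where
  "chart_extension e g x = (if x \<in> range e then e (g (inv_into UNIV e x)) else x)"

lemma chart_extension_chart: "inj e \<Longrightarrow> chart_extension e g (e p) = e (g p)"
  by (simp add: chart_extension_def inv_f_f)

lemma chart_extension_outside: "x \<notin> range e \<Longrightarrow> chart_extension e g x = x"
  by (simp add: chart_extension_def)

lemma continuous_map_chart_extension:
  fixes \<Psi> :: "real \<Rightarrow> real^3 \<Rightarrow> real^3"
  assumes e: "open_embedding e M" and M: "Hausdorff_space M" and K: "compact K"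
    and cont: "continuous_on ({0..1} \<times> UNIV) (\<lambda>(t, p). \<Psi> t p)"
    and supp: "\<And>t p. p \<notin> K \<Longrightarrow> \<Psi> t p = p"
  shows "continuous_map (prod_topology (top_of_set {0..1}) M) M (\<lambda>(t, x). chart_extension e (\<Psi> t) x)"
proof -
  let ?I = "top_of_set {0..1::real}"
  have conte: "continuous_map euclidean M e" and inj: "inj e"
    using e by (simp_all add: open_embedding_alt)
  have oe: "openin M (range e)"
    using e by (simp add: open_embedding_def)
  have supp': "e (\<Psi> t p) = e p" if "e p \<notin> e ` K" for t p
  proof -
    have "p \<notin> K" using that by blast
    then show ?thesis by (simp add: supp)
  qed
  have "compactin M (e ` K)"
    using K by (intro image_compactin[OF _ conte]) simp
  then have "closedin M (e ` K)"
    using M compactin_imp_closedin by blast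
  then have oK: "openin M (topspace M - e ` K)"
    by blast
  show ?thesis
  proof (rule pasting_lemma[where I = UNIV
      and T = "\<lambda>b. {0..1} \<times> (if b then range e else topspace M - e ` K)"
      and f = "\<lambda>b. if b then (\<lambda>(t, x). e (\<Psi> t (inv_into UNIV e x))) else snd"])
    fix b :: bool
    show "openin (prod_topology ?I M) ({0..1} \<times> (if b then range e else topspace M - e ` K))"
      using oe oK by (simp add: openin_prod_Times_iff)
    have "continuous_map (prod_topology ?I (subtopology M (range e))) (prod_topology ?I euclidean)
       (\<lambda>p. (fst p, inv_into UNIV e (snd p)))"
      using continuous_map_compose[OF continuous_map_snd continuous_map_inv_open_embedding[OF e]]
      by (intro continuous_map_pairedI continuous_map_fst) (simp add: o_def)
    moreover have "prod_topology ?I (euclidean :: (real^3) topology) = top_of_set ({0..1} \<times> UNIV)"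
      by (metis prod_topology_subtopology_eu subtopology_UNIV)
    ultimately have "continuous_map (prod_topology ?I (subtopology M (range e))) M
        (e \<circ> (\<lambda>(t, p). \<Psi> t p) \<circ> (\<lambda>p. (fst p, inv_into UNIV e (snd p))))"
      using cont conte by (auto intro!: continuous_map_compose)
    then have *: "continuous_map (prod_topology ?I (subtopology M (range e))) M
        (\<lambda>(t, x). e (\<Psi> t (inv_into UNIV e x)))"
      by (simp add: o_def case_prod_unfold)
    show "continuous_map (subtopology (prod_topology ?I M) ({0..1} \<times> (if b then range e else topspace M - e ` K))) M
       (if b then (\<lambda>(t, x). e (\<Psi> t (inv_into UNIV e x))) else snd)"
    proof (cases b)
      case True
      have "subtopology ?I {0..1} = ?I" by (simp add: subtopology_subtopology)
      with True * show ?thesis by (simp add: subtopology_Times)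
    next
      case False
      then show ?thesis by (simp add: continuous_map_subtopology_snd)
    qed
  next
    fix i j x assume "x \<in> topspace (prod_topology ?I M) \<inter>
       ({0..1} \<times> (if i then range e else topspace M - e ` K)) \<inter>
       ({0..1} \<times> (if j then range e else topspace M - e ` K))"
    then show "(if i then \<lambda>(t, x). e (\<Psi> t (inv_into UNIV e x)) else snd) x =
       (if j then \<lambda>(t, x). e (\<Psi> t (inv_into UNIV e x)) else snd) x"
      using inj by (auto simp: inv_f_f supp')
  next
    fix x assume x: "x \<in> topspace (prod_topology ?I M)"
    show "\<exists>j. j \<in> UNIV \<and> x \<in> {0..1} \<times> (if j then range e else topspace M - e ` K) \<and>
          (case x of (t, x) \<Rightarrow> chart_extension e (\<Psi> t) x) =
          (if j then \<lambda>(t, x). e (\<Psi> t (inv_into UNIV e x)) else snd) x"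
      using x by (intro exI[of _ "snd x \<in> range e"]) (auto simp: chart_extension_def)
  qed
qed

text \<open>Transplants a compactly supported isotopy of the coordinate space into \<open>M\<close>.
  Bijectivity of each \<open>\<Psi> t\<close> suffices: invariance of domain makes the inverse
  continuous, and the inverse has the same support.\<close>

lemma ambient_isotopic_chart:
  fixes \<Psi> :: "real \<Rightarrow> real^3 \<Rightarrow> real^3"
  assumes e: "open_embedding e M" and M: "Hausdorff_space M" and K: "compact K"
    and cont: "continuous_on ({0..1} \<times> UNIV) (\<lambda>(t, p). \<Psi> t p)"
    and supp: "\<And>t p. p \<notin> K \<Longrightarrow> \<Psi> t p = p"
    and bij: "\<And>t. t \<in> {0..1} \<Longrightarrow> bij (\<Psi> t)"
    and start: "\<And>p. \<Psi> 0 p = p"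
    and L: "L \<subseteq> topspace M" "L' \<subseteq> topspace M"
    and inside: "\<And>p. e p \<in> L \<longleftrightarrow> e (\<Psi> 1 p) \<in> L'"
    and outside: "\<And>x. x \<notin> range e \<Longrightarrow> x \<in> L \<longleftrightarrow> x \<in> L'"
  shows "ambient_isotopic M L L'"
proof -
  let ?I = "top_of_set {0..1::real}"
  have inj: "inj e"
    using e by (simp add: open_embedding_alt)
  have cH: "continuous_map (prod_topology ?I M) M (\<lambda>(t, x). chart_extension e (\<Psi> t) x)"
    by (rule continuous_map_chart_extension[OF e M K cont supp])
  \<comment> \<open>A single map is treated as a homotopy constant in time, so that the previous
    lemma also serves for \<open>\<Psi> t\<close> and its inverse.\<close>
  have cfix: "continuous_map M M (chart_extension e g)"
    if g: "continuous_on UNIV g" "\<And>p. p \<notin> K \<Longrightarrow> g p = p" for g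
  proof -
    have "continuous_on ({0..1} \<times> UNIV) (\<lambda>(t :: real, p). g p)"
      using continuous_on_compose2[OF g(1), of "{0..1} \<times> UNIV" snd]
      by (simp add: case_prod_unfold continuous_on_snd)
    then have "continuous_map (prod_topology ?I M) M (\<lambda>(t, x). chart_extension e g x)"
      by (rule continuous_map_chart_extension[OF e M K]) (rule g(2))
    moreover have "continuous_map M (prod_topology ?I M) (\<lambda>x. (0, x))"
      by (intro continuous_map_pairedI) simp_all
    ultimately have "continuous_map M M ((\<lambda>(t, x). chart_extension e g x) \<circ> (\<lambda>x. (0 :: real, x)))"
      by (rule continuous_map_compose[rotated])
    then show ?thesis by (simp add: o_def)
  qed
  have hom: "homeomorphic_map M M (chart_extension e (\<Psi> t))" if t: "t \<in> {0..1}" for t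
  proof -
    have contt: "continuous_on UNIV (\<Psi> t)"
      using continuous_on_compose2[OF cont, of UNIV "\<lambda>p. (t, p)"] t
      by (simp add: continuous_on_Pair image_subset_iff)
    have injt: "inj (\<Psi> t)" and surjt: "range (\<Psi> t) = UNIV"
      using bij[OF t] by (auto simp: bij_def)
    obtain g where g: "homeomorphism UNIV (range (\<Psi> t)) (\<Psi> t) g"
      using invariance_of_domain_homeomorphism[OF open_UNIV contt order_refl injt] .
    then have gc: "continuous_on UNIV g" and g1: "g (\<Psi> t p) = p" and g2: "\<Psi> t (g p) = p" for p
      using surjt by (auto simp: homeomorphism_def)
    have gs: "g p = p" if "p \<notin> K" for p
      using g1[of p] supp[OF that, of t] by simp
    have "homeomorphic_maps M M (chart_extension e (\<Psi> t)) (chart_extension e g)"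
      unfolding homeomorphic_maps_def
    proof (intro conjI ballI)
      show "continuous_map M M (chart_extension e (\<Psi> t))" 
        using cfix[OF contt supp] .
      show "continuous_map M M (chart_extension e g)"
        using cfix[OF gc gs] .
      fix x
      show "chart_extension e g (chart_extension e (\<Psi> t) x) = x"
        by (cases "x \<in> range e") (auto simp: chart_extension_chart[OF inj] chart_extension_outside g1)
      show "chart_extension e (\<Psi> t) (chart_extension e g x) = x"
        by (cases "x \<in> range e") (auto simp: chart_extension_chart[OF inj] chart_extension_outside g2)
    qed
    then show ?thesis
      using homeomorphic_maps_map by blast
  qed
  have "chart_extension e (\<Psi> 0) x = x" for x
    by (cases "x \<in> range e") (auto simp: chart_extension_chart[OF inj] chart_extension_outside start)
  moreover have "chart_extension e (\<Psi> 1) ` L = L'"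
  proof (intro equalityI subsetI)
    fix y assume "y \<in> chart_extension e (\<Psi> 1) ` L"
    then obtain x where "x \<in> L" "y = chart_extension e (\<Psi> 1) x" by blast
    then show "y \<in> L'"
      using inside outside
      by (cases "x \<in> range e") (auto simp: chart_extension_chart[OF inj] chart_extension_outside)
  next
    fix y assume y: "y \<in> L'"
    show "y \<in> chart_extension e (\<Psi> 1) ` L"
    proof (cases "y \<in> range e")
      case True
      then obtain q where q: "y = e q" by blast
      obtain p where p: "q = \<Psi> 1 p"
        using bij[of 1] by (auto simp: bij_def surj_def)
      then have "e p \<in> L"
        using inside y q by simp
      moreover have "y = chart_extension e (\<Psi> 1) (e p)"
        using p q by (simp add: chart_extension_chart[OF inj])
      ultimately show ?thesis by blast
    next
      case False
      then have "y \<in> L" "chart_extension e (\<Psi> 1) y = y"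
        using y outside by (auto simp: chart_extension_outside)
      then show ?thesis by force
    qed
  qed
  ultimately show ?thesis
    unfolding ambient_isotopic_def using cH hom
    by (intro exI[of _ "\<lambda>(t, x). chart_extension e (\<Psi> t) x"]) simp
qed


section \<open>Affine changes of charts\<close>

text \<open>The new chart on the simplex \<open>v\<close> is the old chart on the image simplex. The
  edge vectors are the rows of the matrix in \<open>oriented_chart\<close>, hence the image
  multiplies it by the transpose of \<open>A\<close>, and positivity of the determinant is
  kept.\<close>

lemma oriented_chart_affine:
  fixes A :: "real^3^3"
  assumes h: "oriented_chart M \<omega> h" and A: "det A > 0"
  shows "oriented_chart M \<omega> (\<lambda>p. h (c + A *v p))"
proof -
  define g where "g p = c + A *v p" for p :: "real^3"
  have injA: "inj ((*v) A)"
  proof (rule inj_matrix_vector_mult)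
    show "invertible A" using A unfolding invertible_det_nz by linarith
  qed
  then have injg: "inj g"
    by (simp add: inj_def g_def)
  have "continuous_on UNIV g"
    unfolding g_def
    by (intro continuous_on_add continuous_on_const linear_continuous_on matrix_vector_mul_bounded_linear)
  then have emb: "open_embedding (\<lambda>p. h (g p)) M"
    using open_embedding_comp[of h M g] h injg by (simp add: oriented_chart_def o_def)
  have "homologous_rel_set 3 M (topspace M - {h (g x)})
          (frag_of (simplex_map 3 (\<lambda>p. h (g p)) (affine_simplex v))) = \<omega> (h (g x))"
    if v: "det (vector [v 1 - v 0, v 2 - v 0, v 3 - v 0] :: real^3^3) > 0"
      and x: "x \<in> interior (convex hull (v ` {..3}))" for v x
  proof -
    have "(vector [g (v 1) - g (v 0), g (v 2) - g (v 0), g (v 3) - g (v 0)] :: real^3^3)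
        = vector [v 1 - v 0, v 2 - v 0, v 3 - v 0] ** transpose A"
      by (simp add: vec_eq_iff forall_3 matrix_matrix_mult_def matrix_vector_mult_def g_def
          transpose_def sum_3 algebra_simps)
    then have "det (vector [g (v 1) - g (v 0), g (v 2) - g (v 0), g (v 3) - g (v 0)] :: real^3^3) > 0"
      using v A by (simp add: det_mul)
    moreover have "g x \<in> interior (convex hull ((\<lambda>j. g (v j)) ` {..3}))"
    proof -
      have "convex hull ((\<lambda>j. g (v j)) ` {..3}) = g ` (convex hull (v ` {..3}))"
      proof -
        have "(\<lambda>j. g (v j)) ` {..3} = (+) c ` ((*v) A ` (v ` {..3}))"
          by (auto simp: g_def image_image)
        also have "convex hull \<dots> = (+) c ` ((*v) A ` (convex hull (v ` {..3})))"
          by (simp only: convex_hull_translation convex_hull_linear_image[OF matrix_vector_mul_linear])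
        finally show ?thesis
          by (simp add: g_def image_image)
      qed
      moreover have "g ` interior S \<subseteq> interior (g ` S)" for S
      proof (rule interior_maximal)
        show "g ` interior S \<subseteq> g ` S"
          by (simp add: image_mono interior_subset)
        show "open (g ` interior S)"
          using \<open>continuous_on UNIV g\<close> injg
          by (intro invariance_of_domain_gen) (auto intro: continuous_on_subset inj_on_subset)
      qed
      ultimately show ?thesis
        using x by (metis imageI subsetD)
    qed
    moreover have "simplex_map 3 h (affine_simplex (\<lambda>j. g (v j))) = simplex_map 3 (\<lambda>p. h (g p)) (affine_simplex v)"
    proof -
      have "(\<Sum>j\<le>3. t j *\<^sub>R g (v j)) = g (\<Sum>j\<le>3. t j *\<^sub>R v j)" if "t \<in> standard_simplex 3" for t :: "nat \<Rightarrow> real"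
      proof -
        have "(\<Sum>j\<le>3. t j) = 1"
          using that by (simp add: standard_simplex_def)
        then show ?thesis
          by (simp add: g_def scaleR_add_right sum.distrib scaleR_sum_left[symmetric]
              linear_sum[OF matrix_vector_mul_linear] matrix_vector_mult_scaleR)
      qed
      then show ?thesis
        by (auto simp: simplex_map_def affine_simplex_def restrict_def fun_eq_iff)
    qed
    ultimately show ?thesis
      using h unfolding oriented_chart_def by metis
  qed
  with emb show ?thesis
    unfolding oriented_chart_def g_def by blast
qed

text \<open>The yz-plane is identified with the complex numbers, which turns rotation about the
  x-axis into multiplication by \<open>cis\<close>.\<close>

definition pt :: "real \<Rightarrow> complex \<Rightarrow> real^3" where
  "pt x w = vector [x, Re w, Im w]"

definition cross :: "real^3 \<Rightarrow> complex" where
  "cross p = Complex (p $ 2) (p $ 3)"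

lemma pt_nth [simp]: "pt x w $ 1 = x" "pt x w $ 2 = Re w" "pt x w $ 3 = Im w"
  by (simp_all add: pt_def)

lemma cross_pt [simp]: "cross (pt x w) = w"
  by (simp add: cross_def complex_eq_iff)

lemma pt_cross [simp]: "pt (p $ 1) (cross p) = p"
  by (simp add: vec_eq_iff forall_3 cross_def)

lemma Re_cross [simp]: "Re (cross p) = p $ 2" and Im_cross [simp]: "Im (cross p) = p $ 3"
  by (simp_all add: cross_def)

lemma pt_eq_iff [simp]: "pt x w = pt x' w' \<longleftrightarrow> x = x' \<and> w = w'"
  by (metis cross_pt pt_nth(1))

lemma pt_in_ball3: "pt x w \<in> ball3 \<longleftrightarrow> \<bar>x\<bar> \<le> 2 \<and> \<bar>Re w\<bar> \<le> 2 \<and> \<bar>Im w\<bar> \<le> 2"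
  by (simp add: ball3_def forall_3)

lemma continuous_on_pt [continuous_intros]:
  assumes "continuous_on S f" "continuous_on S g"
  shows "continuous_on S (\<lambda>x. pt (f x) (g x))"
proof -
  have "pt x w = x *\<^sub>R axis 1 1 + Re w *\<^sub>R axis 2 1 + Im w *\<^sub>R axis 3 1" for x w
    by (simp add: vec_eq_iff forall_3 axis_def)
  then show ?thesis
    using assms by (auto intro!: continuous_intros)
qed

lemma continuous_on_cross [continuous_intros]:
  assumes "continuous_on S f"
  shows "continuous_on S (\<lambda>x. cross (f x))"
  using assms unfolding cross_def Complex_eq by (auto intro!: continuous_intros)

lemma compact_tube: "compact {p. \<bar>p $ 1\<bar> \<le> c \<and> norm (cross p) \<le> d}"
proof -
  have "{p. \<bar>p $ 1\<bar> \<le> c \<and> norm (cross p) \<le> d} = (\<lambda>(x, w). pt x w) ` ({-c..c} \<times> cball 0 d)"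
  proof (intro equalityI subsetI)
    fix p :: "real^3" assume "p \<in> {p. \<bar>p $ 1\<bar> \<le> c \<and> norm (cross p) \<le> d}"
    then have "(p $ 1, cross p) \<in> {-c..c} \<times> cball 0 d" "p = (\<lambda>(x, w). pt x w) (p $ 1, cross p)"
      by auto
    then show "p \<in> (\<lambda>(x, w). pt x w) ` ({-c..c} \<times> cball 0 d)"
      by (rule image_eqI[rotated])
  qed auto
  moreover have "compact \<dots>"
    by (intro compact_continuous_image compact_Times) (auto intro!: continuous_intros simp: case_prod_unfold)
  ultimately show ?thesis by simp
qed

lemma compact_ball3: "compact ball3"
proof -
  have "ball3 = cbox (\<chi> i. -2) (\<chi> i. 2)"
    by (auto simp: ball3_def mem_box_cart abs_le_iff) (smt (verit))+
  show ?thesis unfolding \<open>ball3 = _\<close> by (rule compact_cbox)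
qed


section \<open>Twisting and pushing inside a ball\<close>

text \<open>Injectivity on the whole space, not only near the core, makes the composite with a chart
  of \<open>M\<close> a chart again.\<close>

definition tube :: "(real \<Rightarrow> complex \<Rightarrow> real^3) \<Rightarrow> bool" where
  "tube b \<longleftrightarrow> continuous_on UNIV (\<lambda>p. b (p $ 1) (cross p)) \<and> inj (\<lambda>p. b (p $ 1) (cross p))"

lemma tube_eq_iff: "tube b \<Longrightarrow> b x w = b x' w' \<longleftrightarrow> x = x' \<and> w = w'"
  unfolding tube_def inj_def by (metis cross_pt pt_nth(1))

text \<open>Both sets avoid the shell \<open>d1 < norm w \<le> d\<close>, so that the rotation through \<open>\<phi> x\<close> can be damped
  there.\<close>

definition twist_related ::
  "(real \<Rightarrow> complex \<Rightarrow> real^3) \<Rightarrow> real \<Rightarrow> real \<Rightarrow> real \<Rightarrow> (real \<Rightarrow> real) \<Rightarrow> (real^3) set \<Rightarrow> (real^3) set \<Rightarrow> bool"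
  where "twist_related b c d1 d \<phi> T T' \<longleftrightarrow>
    tube b \<and> continuous_on UNIV \<phi> \<and> d1 < d \<and>
    (\<forall>x w. \<bar>x\<bar> \<le> c \<longrightarrow> norm w \<le> d \<longrightarrow> b x w \<in> ball3) \<and>
    (\<forall>x w. \<bar>x\<bar> \<le> c \<longrightarrow> norm w \<le> d1 \<longrightarrow> b x w \<in> T \<longleftrightarrow> b x (cis (\<phi> x) * w) \<in> T') \<and>
    (\<forall>x w. \<bar>x\<bar> \<le> c \<longrightarrow> d1 < norm w \<longrightarrow> norm w \<le> d \<longrightarrow> b x w \<notin> T \<and> b x w \<notin> T') \<and>
    (\<forall>q. (\<forall>x w. \<bar>x\<bar> \<le> c \<longrightarrow> norm w \<le> d \<longrightarrow> q \<noteq> b x w) \<longrightarrow> q \<in> T \<longleftrightarrow> q \<in> T')"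

lemma twist_relatedD:
  assumes "twist_related b c d1 d \<phi> T T'"
  shows "tube b" "continuous_on UNIV \<phi>" "d1 < d"
    "\<And>x w. \<bar>x\<bar> \<le> c \<Longrightarrow> norm w \<le> d \<Longrightarrow> b x w \<in> ball3"
    "\<And>x w. \<bar>x\<bar> \<le> c \<Longrightarrow> norm w \<le> d1 \<Longrightarrow> b x w \<in> T \<longleftrightarrow> b x (cis (\<phi> x) * w) \<in> T'"
    "\<And>x w. \<bar>x\<bar> \<le> c \<Longrightarrow> d1 < norm w \<Longrightarrow> norm w \<le> d \<Longrightarrow> b x w \<notin> T"
    "\<And>x w. \<bar>x\<bar> \<le> c \<Longrightarrow> d1 < norm w \<Longrightarrow> norm w \<le> d \<Longrightarrow> b x w \<notin> T'"
    "\<And>q. (\<And>x w. \<bar>x\<bar> \<le> c \<Longrightarrow> norm w \<le> d \<Longrightarrow> q \<noteq> b x w) \<Longrightarrow> q \<in> T \<longleftrightarrow> q \<in> T'"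
  using assms unfolding twist_related_def by blast+

section \<open>Isotopies of links with a fixed exterior\<close>

locale link_exterior =
  fixes M :: "'a topology" and h :: "real^3 \<Rightarrow> 'a" and X :: "'a set"
  assumes Hausdorff: "Hausdorff_space M" and chart: "open_embedding h M"
    and exterior: "X \<subseteq> topspace M" "X \<inter> h ` ball3 = {}"
begin

definition lk :: "(real^3) set \<Rightarrow> 'a set" where
  "lk T = X \<union> h ` T"

lemma chart_in_lk: "h q \<in> lk T \<longleftrightarrow> h q \<in> X \<or> q \<in> T"
  using chart by (auto simp: lk_def open_embedding_alt inj_def)

lemma chart_in_lk_ball3: "q \<in> ball3 \<Longrightarrow> h q \<in> lk T \<longleftrightarrow> q \<in> T"
  using exterior(2) by (auto simp: chart_in_lk)

lemma outside_lk: "x \<notin> range h \<Longrightarrow> x \<in> lk T \<longleftrightarrow> x \<in> X"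
  by (auto simp: lk_def)

lemma lk_subset: "lk T \<subseteq> topspace M"
proof -
  have "range h \<subseteq> topspace M"
    using chart openin_subset[of M "range h"] by (simp add: open_embedding_def)
  then show ?thesis
    using exterior(1) by (auto simp: lk_def)
qed

lemma open_embedding_tube:
  assumes "tube b" shows "open_embedding (\<lambda>p. h (b (p $ 1) (cross p))) M"
  using open_embedding_comp[OF chart] assms by (simp add: tube_def o_def)

text \<open>The rotation is through the full angle where the tangles are, and fades out in the empty
  shell. Since \<open>\<phi>\<close> vanishes for \<open>\<bar>x\<bar> \<ge> c\<close>, its support
  is compact.\<close>

lemma isotopic_twist:
  assumes tw: "twist_related b c d1 d \<phi> T T'" and \<phi>0: "\<And>x. c \<le> \<bar>x\<bar> \<Longrightarrow> \<phi> x = 0"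
  shows "ambient_isotopic M (lk T) (lk T')"
proof -
  note tw = twist_relatedD[OF tw]
  \<comment> \<open>\<open>\<delta>\<close> is 1 up to radius \<open>d1\<close> and 0 from radius
    \<open>d\<close> on. As a rotation preserves the radius, the maps \<open>\<Psi> t\<close> form a
    one-parameter group, and \<open>\<Psi> (- t)\<close> is the inverse.\<close>
  define \<delta> where "\<delta> r = max 0 (min 1 ((d - r) / (d - d1)))" for r
  define \<Psi> where "\<Psi> t p = pt (p $ 1) (cis (t * \<phi> (p $ 1) * \<delta> (norm (cross p))) * cross p)" for t p
  define e where "e p = h (b (p $ 1) (cross p))" for p
  define K where "K = {p. \<bar>p $ 1\<bar> \<le> c \<and> norm (cross p) \<le> d}"
  have e_pt: "e (pt x w) = h (b x w)" for x w
    by (simp add: e_def)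
  have supp: "\<Psi> t p = p" if "p \<notin> K" for t p
  proof -
    have "\<phi> (p $ 1) = 0 \<or> \<delta> (norm (cross p)) = 0"
    proof (cases "c \<le> \<bar>p $ 1\<bar>")
      case False
      then have "d < norm (cross p)" using that by (simp add: K_def)
      then show ?thesis using tw(3) by (simp add: \<delta>_def divide_nonpos_pos)
    qed (simp add: \<phi>0)
    then show ?thesis by (elim disjE) (simp_all add: \<Psi>_def)
  qed
  have cont: "continuous_on ({0..1} \<times> UNIV) (\<lambda>(t, p). \<Psi> t p)"
    unfolding case_prod_unfold \<Psi>_def \<delta>_def using tw(3)
    by (intro continuous_intros continuous_on_compose2[OF tw(2)]) auto
  have \<Psi>_add: "\<Psi> s (\<Psi> t p) = \<Psi> (s + t) p" for s t p
    by (simp add: \<Psi>_def norm_mult cis_mult[symmetric] distrib_right mult.assoc)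
  have \<Psi>0: "\<Psi> 0 p = p" for p
    by (simp add: \<Psi>_def)
  have "bij (\<Psi> t)" for t
    by (rule o_bij[of "\<Psi> (- t)"]) (auto simp: fun_eq_iff \<Psi>_add \<Psi>0)
  moreover have "e p \<in> lk T \<longleftrightarrow> e (\<Psi> 1 p) \<in> lk T'" for p
  proof -
    define x w where "x = p $ 1" and "w = cross p"
    have p: "p = pt x w" by (simp add: x_def w_def)
    show ?thesis
    proof (cases "p \<in> K")
      case True
      then have xw: "\<bar>x\<bar> \<le> c" "norm w \<le> d" by (auto simp: K_def p)
      define w' where "w' = cis (\<phi> x * \<delta> (norm w)) * w"
      have w': "norm w' = norm w" "\<Psi> 1 p = pt x w'"
        by (simp_all add: w'_def norm_mult \<Psi>_def p)
      have "b x w \<in> ball3" "b x w' \<in> ball3"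
        using tw(4) xw w' by auto
      then have "e p \<in> lk T \<longleftrightarrow> b x w \<in> T" "e (\<Psi> 1 p) \<in> lk T' \<longleftrightarrow> b x w' \<in> T'"
        by (simp_all add: p e_pt w'(2) chart_in_lk_ball3 flip: p)
           (simp_all add: e_pt chart_in_lk_ball3 p)
      moreover have "b x w \<in> T \<longleftrightarrow> b x w' \<in> T'"
      proof (cases "norm w \<le> d1")
        case True
        then have "\<delta> (norm w) = 1" using tw(3) by (simp add: \<delta>_def field_simps)
        then show ?thesis using tw(5)[OF xw(1) True] by (simp add: w'_def)
      next
        case False
        then show ?thesis using tw(6)[of x w] tw(7)[of x w'] xw w' by simp
      qed
      ultimately show ?thesis by simp
    next
      case False
      then have "b x w \<in> T \<longleftrightarrow> b x w \<in> T'"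
        by (intro tw(8)) (auto simp: tube_eq_iff[OF tw(1)] K_def p)
      then show ?thesis
        unfolding supp[OF False] by (simp add: p e_pt chart_in_lk)
    qed
  qed
  moreover have "x \<in> lk T \<longleftrightarrow> x \<in> lk T'" if "x \<notin> range e" for x
  proof (cases "x \<in> range h")
    case True
    then obtain q where q: "x = h q" by blast
    have "q \<in> T \<longleftrightarrow> q \<in> T'"
    proof (rule tw(8))
      show "q \<noteq> b y w" for y w
        using that e_pt[of y w] q by (metis rangeI)
    qed
    then show ?thesis by (simp add: q chart_in_lk)
  qed (simp add: outside_lk)
  moreover have "open_embedding e M"
    using open_embedding_tube[OF tw(1)] by (simp add: e_def[abs_def])
  moreover have "compact K"
    by (simp add: K_def compact_tube)
  ultimately show ?thesis
    using cont supp \<Psi>0 lk_subset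
    by (intro ambient_isotopic_chart[OF _ Hausdorff, where \<Psi> = \<Psi> and K = K and e = e])
qed

text \<open>With only \<open>cis (\<phi> x) = 1\<close> at the ends, no damping is attempted: the
  rotation is cut off abruptly at radius \<open>d\<close>. The jump lies outside the links because
  the shell is empty, so locally the links still correspond under charts.\<close>

lemma framed_twist:
  assumes tw: "twist_related b c d1 d \<phi> T T'" and \<phi>0: "\<And>x. c \<le> \<bar>x\<bar> \<Longrightarrow> cis (\<phi> x) = 1"
    and T: "framed_link M (lk T)"
  shows "framed_link M (lk T')"
proof -
  note tw = twist_relatedD[OF tw]
  define rot where "rot p = pt (p $ 1) (cis (\<phi> (p $ 1)) * cross p)" for p
  define rot' where "rot' p = pt (p $ 1) (cis (- \<phi> (p $ 1)) * cross p)" for p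
  define e where "e p = h (b (p $ 1) (cross p))" for p
  define K where "K r = {p. \<bar>p $ 1\<bar> \<le> c \<and> norm (cross p) \<le> r}" for r
  have e: "open_embedding e M"
    using open_embedding_tube[OF tw(1)] by (simp add: e_def[abs_def])
  have inj: "inj e" and contE: "continuous_map euclidean M e"
    using e by (simp_all add: open_embedding_alt)
  have rot_rot': "rot (rot' p) = p" "rot' (rot p) = p" for p
    by (simp_all add: rot_def rot'_def mult.assoc[symmetric] cis_mult)
  have rot_K: "rot p \<in> K r \<longleftrightarrow> p \<in> K r" "rot' p \<in> K r \<longleftrightarrow> p \<in> K r" for p r
    by (simp_all add: rot_def rot'_def K_def norm_mult)
  have in_lk: "e p \<in> lk S \<longleftrightarrow> b (p $ 1) (cross p) \<in> S" if "p \<in> K d" for p S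
    using that tw(4) by (simp add: e_def K_def chart_in_lk_ball3)
  have inside: "e p \<in> lk T \<longleftrightarrow> e (rot p) \<in> lk T'" if p: "p \<in> K d" for p
  proof -
    have "e (rot p) \<in> lk T' \<longleftrightarrow> b (p $ 1) (cis (\<phi> (p $ 1)) * cross p) \<in> T'"
      using in_lk[of "rot p" T'] p by (simp add: rot_K) (simp add: rot_def)
    moreover have "b (p $ 1) (cross p) \<in> T \<longleftrightarrow> b (p $ 1) (cis (\<phi> (p $ 1)) * cross p) \<in> T'"
      using p tw(5)[of "p $ 1" "cross p"] tw(6)[of "p $ 1" "cross p"]
        tw(7)[of "p $ 1" "cis (\<phi> (p $ 1)) * cross p"]
      by (cases "norm (cross p) \<le> d1") (simp_all add: K_def norm_mult)
    ultimately show ?thesis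
      by (simp add: in_lk p)
  qed
  have thin: "e p \<notin> lk T" "e p \<notin> lk T'" if p: "p \<in> K d" "p \<notin> K d1" for p
    using p tw(6)[of "p $ 1" "cross p"] tw(7)[of "p $ 1" "cross p"]
    by (auto simp: in_lk) (auto simp: K_def)
  have outside: "x \<in> lk T \<longleftrightarrow> x \<in> lk T'" if "x \<notin> e ` K d" for x
  proof (cases "x \<in> range h")
    case True
    then obtain q where q: "x = h q" by blast
    have "q \<in> T \<longleftrightarrow> q \<in> T'"
    proof (rule tw(8))
      fix y and w :: complex assume "\<bar>y\<bar> \<le> c" "norm w \<le> d"
      then have "pt y w \<in> K d" "h (b y w) = e (pt y w)" by (simp_all add: K_def e_def)
      then show "q \<noteq> b y w"
        using that by (auto simp: q)
    qed
    then show ?thesis by (simp add: q chart_in_lk)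
  qed (simp add: outside_lk)
  define f where "f = chart_extension e (\<lambda>p. if p \<in> K d then rot p else p)"
  define f' where "f' = chart_extension e (\<lambda>p. if p \<in> K d then rot' p else p)"
  have f_in: "f (e p) = (if p \<in> K d then e (rot p) else e p)" for p
    by (simp add: f_def chart_extension_chart[OF inj])
  have f'_in: "f' (e p) = (if p \<in> K d then e (rot' p) else e p)" for p
    by (simp add: f'_def chart_extension_chart[OF inj])
  have f_out: "f x = x" "f' x = x" if "x \<notin> e ` K d" for x
    using that by (cases "x \<in> range e"; auto simp: f_in f'_in; auto simp: f_def f'_def chart_extension_outside)+
  have bij: "bij_betw f (lk T) (lk T')"
  proof (rule bij_betw_byWitness[where f' = f'])
    show "\<forall>x\<in>lk T. f' (f x) = x"
    proof
      fix x show "f' (f x) = x"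
        by (cases "x \<in> e ` K d") (auto simp: f_out f_in f'_in rot_K rot_rot')
    qed
    show "\<forall>x\<in>lk T'. f (f' x) = x"
    proof
      fix x show "f (f' x) = x"
        by (cases "x \<in> e ` K d") (auto simp: f_out f_in f'_in rot_K rot_rot')
    qed
    show "f ` lk T \<subseteq> lk T'"
    proof
      fix y assume "y \<in> f ` lk T"
      then obtain x where x: "x \<in> lk T" "y = f x" by blast
      show "y \<in> lk T'"
      proof (cases "x \<in> e ` K d")
        case True
        then show ?thesis using x inside by (auto simp: f_in)
      next
        case False
        then show ?thesis using x outside by (simp add: f_out)
      qed
    qed
    show "f' ` lk T' \<subseteq> lk T"
    proof
      fix y assume "y \<in> f' ` lk T'"
      then obtain x where x: "x \<in> lk T'" "y = f' x" by blast
      show "y \<in> lk T"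
      proof (cases "x \<in> e ` K d")
        case True
        then obtain p where p: "p \<in> K d" "x = e p" by blast
        then show ?thesis using x inside[of "rot' p"] by (simp add: f'_in rot_K rot_rot')
      next
        case False
        then show ?thesis using x outside by (simp add: f_out)
      qed
    qed
  qed
  have contK: "compactin M (e ` K d1)"
    unfolding K_def using compact_tube by (intro image_compactin[OF _ contE]) simp
  have rot_id: "rot p = p" if "c < \<bar>p $ 1\<bar>" for p
    using \<phi>0[of "p $ 1"] that by (simp add: rot_def)
  show ?thesis
  proof (rule framed_link_transfer[OF T bij])
    fix x assume x: "x \<in> lk T"
    show "\<exists>e1 e2. open_embedding e1 M \<and> open_embedding e2 M \<and> x \<in> range e1 \<and>
         (\<forall>p. (e1 p \<in> lk T \<longleftrightarrow> e2 p \<in> lk T') \<and> (e1 p \<in> lk T \<longrightarrow> f (e1 p) = e2 p))"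
    proof (cases "x \<in> e ` K d1")
      \<comment> \<open>Away from the inner tube both links coincide and \<open>f\<close> is the
        identity on them, so one chart serves for both sides.\<close>
      case False
      obtain c0 where c0: "open_embedding c0 M" "c0 0 = x"
        using T x unfolding framed_link_def locally_flat_def by blast
      have "openin M (topspace M - e ` K d1)"
        using compactin_imp_closedin[OF Hausdorff contK] by blast
      moreover have "c0 0 \<in> topspace M - e ` K d1"
        using False c0(2) x lk_subset by blast
      ultimately obtain a :: "real^3 \<Rightarrow> real^3" where a: "continuous_on UNIV a" "inj a" "a 0 = 0"
        "range (c0 \<circ> a) \<subseteq> topspace M - e ` K d1"
        and "\<forall>p i. a p $ i = 0 $ i \<longleftrightarrow> p $ i = 0" "\<forall>p i. 0 $ i \<le> a p $ i \<longleftrightarrow> 0 \<le> p $ i"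
        by (rule open_embedding_neighbourhood[OF c0(1)]) (erule that; assumption)
      have eq: "y \<in> lk T \<longleftrightarrow> y \<in> lk T'" if "y \<notin> e ` K d1" for y
      proof (cases "y \<in> e ` K d")
        case True
        then obtain p where p: "p \<in> K d" "y = e p" by (elim imageE)
        then have "p \<notin> K d1" using that by (metis imageI)
        then show ?thesis using thin[OF p(1)] p(2) by simp
      qed (rule outside)
      have id: "f y = y" if "y \<notin> e ` K d1" "y \<in> lk T" for y
      proof -
        have "y \<notin> e ` K d"
        proof
          assume "y \<in> e ` K d"
          then obtain p where p: "p \<in> K d" "y = e p" by (elim imageE)
          then have "p \<notin> K d1" using that(1) by (metis imageI)
          then show False using thin(1)[OF p(1)] p(2) that(2) by simp
        qed
        then show ?thesis by (rule f_out)
      qed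
      have range: "(c0 \<circ> a) p \<notin> e ` K d1" for p
        using subsetD[OF a(4), of "(c0 \<circ> a) p"] by simp
      have "open_embedding (c0 \<circ> a) M"
        by (rule open_embedding_comp[OF c0(1) a(1,2)])
      moreover have "x = (c0 \<circ> a) 0"
        using c0(2) a(3) by simp
      then have "x \<in> range (c0 \<circ> a)"
        by (rule range_eqI)
      ultimately show ?thesis
        using eq[OF range] id[OF range]
        by (intro exI[of _ "c0 \<circ> a"] conjI allI impI)
    next
      \<comment> \<open>Near the inner tube a chart is taken inside the open tube \<open>U\<close>,
        where the undamped rotation \<open>rot\<close> is continuous. Past the ends of the tube
        \<open>rot\<close> is the identity, in agreement with \<open>f\<close>.\<close>
      case True
      then obtain q where q: "q \<in> K d1" "x = e q" by blast
      define U where "U = {p. norm (cross p) < d}"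
      have "open U"
        unfolding U_def by (intro open_Collect_less continuous_intros)
      then have oU: "openin M (e ` U)"
        using e by (auto simp: open_embedding_alt open_map_def)
      have "e q \<in> e ` U"
        using q tw(3) by (auto simp: U_def K_def)
      with oU obtain a :: "real^3 \<Rightarrow> real^3" where a: "continuous_on UNIV a" "inj a" "a 0 = q"
        "range (e \<circ> a) \<subseteq> e ` U"
        and "\<forall>p i. a p $ i = q $ i \<longleftrightarrow> p $ i = 0" "\<forall>p i. q $ i \<le> a p $ i \<longleftrightarrow> 0 \<le> p $ i"
        by (rule open_embedding_neighbourhood[OF e]) (erule that; assumption)
      have aU: "a p \<in> U" for p
        using subsetD[OF a(4), of "(e \<circ> a) p"] inj by (simp add: inj_image_mem_iff)
      have "continuous_on UNIV rot"
        unfolding rot_def by (intro continuous_intros continuous_on_compose2[OF tw(2)]) auto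
      then have "continuous_on UNIV (rot \<circ> a)"
        using a(1) by (metis continuous_on_compose continuous_on_subset subset_UNIV)
      moreover have "inj (rot \<circ> a)"
        using a(2) by (metis inj_compose inj_on_inverseI rot_rot'(2))
      ultimately have "open_embedding (e \<circ> (rot \<circ> a)) M"
        by (rule open_embedding_comp[OF e])
      moreover have "open_embedding (e \<circ> a) M"
        by (rule open_embedding_comp[OF e a(1,2)])
      moreover have "x = (e \<circ> a) 0"
        using q a(3) by simp
      then have "x \<in> range (e \<circ> a)"
        by (rule range_eqI)
      moreover have local_eq: "(e p \<in> lk T \<longleftrightarrow> e (rot p) \<in> lk T') \<and> (e p \<in> lk T \<longrightarrow> f (e p) = e (rot p))" if p: "p \<in> U" for p
      proof (cases "p \<in> K d")
        case True
        then show ?thesis using inside by (simp add: f_in)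
      next
        case False
        then have "c < \<bar>p $ 1\<bar>" using p by (auto simp: U_def K_def)
        moreover have "e p \<notin> e ` K d" using False inj by (simp add: inj_image_mem_iff)
        ultimately show ?thesis using outside by (simp add: rot_id f_out)
      qed
      ultimately show ?thesis
        using local_eq[OF aU] by (intro exI[of _ "e \<circ> a"] exI[of _ "e \<circ> (rot \<circ> a)"] conjI) simp_all
    qed
  qed
qed

text \<open>Slides the slices of a tangle along the x-axis. The slide is a convex combination of
  \<open>p\<close> and the identity, hence strictly increasing on every line parallel to the axis;
  surjectivity is the intermediate value theorem.\<close>

lemma isotopic_push:
  assumes p: "strict_mono p" "continuous_on UNIV p" "\<And>x. 2 \<le> \<bar>x\<bar> \<Longrightarrow> p x = x"
    and T: "\<And>q. q \<in> T \<Longrightarrow> \<bar>q $ 2\<bar> \<le> 5/4 \<and> \<bar>q $ 3\<bar> \<le> 5/4"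
    and T': "\<And>q. q \<in> T' \<Longrightarrow> \<bar>q $ 2\<bar> \<le> 5/4 \<and> \<bar>q $ 3\<bar> \<le> 5/4"
    and iff: "\<And>x w. \<bar>Re w\<bar> \<le> 5/4 \<Longrightarrow> \<bar>Im w\<bar> \<le> 5/4 \<Longrightarrow> pt x w \<in> T \<longleftrightarrow> pt (p x) w \<in> T'"
  shows "ambient_isotopic M (lk T) (lk T')"
proof -
  define m where "m q = max \<bar>q $ 2\<bar> \<bar>q $ 3\<bar>" for q :: "real^3"
  \<comment> \<open>\<open>\<kappa>\<close> is 1 where the tangles may lie
    (\<open>m q \<le> 5/4\<close>) and 0 from the faces of the cube on (\<open>m q \<ge> 2\<close>);
    the difference of these bounds is 3/4.\<close>
  define \<kappa> where "\<kappa> q = max 0 (min 1 ((2 - m q) / (3/4)))" for q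
  define \<Psi> where "\<Psi> t q = pt (q $ 1 + t * \<kappa> q * (p (q $ 1) - q $ 1)) (cross q)" for t q
  have supp: "\<Psi> t q = q" if "q \<notin> ball3" for t q
  proof -
    have "2 < \<bar>q $ 1\<bar> \<or> 2 < m q"
      using that by (auto simp: ball3_def forall_3 m_def)
    then have "\<kappa> q = 0 \<or> p (q $ 1) = q $ 1"
      using p(3)[of "q $ 1"] by (auto simp: \<kappa>_def divide_nonpos_pos)
    then show ?thesis by (auto simp: \<Psi>_def)
  qed
  have \<kappa>_cong: "\<kappa> (pt x w) = \<kappa> (pt y w)" for x y w
    by (simp add: \<kappa>_def m_def)
  have \<kappa>: "0 \<le> \<kappa> q" "\<kappa> q \<le> 1" for q
    by (simp_all add: \<kappa>_def)
  have contm: "continuous_on S m" for S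
    unfolding m_def by (intro continuous_intros)
  have cont: "continuous_on S (\<lambda>(t, p). \<Psi> t p)" for S
    unfolding case_prod_unfold \<Psi>_def \<kappa>_def
    by (intro continuous_intros continuous_on_compose2[OF p(2)] continuous_on_compose2[OF contm]) auto
  have mono: "x + s * (p x - x) < y + s * (p y - y)" if "x < y" "0 \<le> s" "s \<le> 1" for x y s
  proof (cases "s = 1")
    case False
    have "(1 - s) * x < (1 - s) * y" "s * p x \<le> s * p y"
      using that False p(1) by (auto intro!: mult_left_mono simp: strict_mono_def less_imp_le)
    then show ?thesis by (simp add: algebra_simps)
  qed (use that p(1) in \<open>simp add: strict_mono_def\<close>)
  have bij: "bij (\<Psi> t)" if t: "t \<in> {0..1}" for t
  proof (rule bijI)
    have \<Psi>_pt: "\<Psi> t (pt x w) = pt (x + t * \<kappa> (pt 0 w) * (p x - x)) w" for x w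
      using \<kappa>_cong[of x w 0] by (simp add: \<Psi>_def)
    have s: "0 \<le> t * \<kappa> (pt 0 w)" "t * \<kappa> (pt 0 w) \<le> 1" for w
      using t \<kappa>[of "pt 0 w"] by (auto intro: mult_le_one)
    show "inj (\<Psi> t)"
    proof (rule injI)
      fix q q' assume eq: "\<Psi> t q = \<Psi> t q'"
      obtain x w y v where q: "q = pt x w" "q' = pt y v" by (metis pt_cross)
      then show "q = q'"
        using eq mono[OF _ s, of x y w] mono[OF _ s, of y x w] by (fastforce simp: \<Psi>_pt)
    qed
    show "surj (\<Psi> t)"
      unfolding surj_def
    proof
      fix q
      show "\<exists>q'. q = \<Psi> t q'"
      proof (cases "2 \<le> \<bar>q $ 1\<bar>")
        case True
        then have "\<Psi> t q = q" using p(3) by (simp add: \<Psi>_def)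
        then show ?thesis by metis
      next
        case False
        define s where "s = t * \<kappa> (pt 0 (cross q))"
        have "\<exists>x\<ge>-2. x \<le> 2 \<and> x + s * (p x - x) = q $ 1"
          using False p(3)[of 2] p(3)[of "-2"]
          by (intro IVT' continuous_intros continuous_on_subset[OF p(2)]) auto
        then obtain x where "x + s * (p x - x) = q $ 1" by blast
        then have "\<Psi> t (pt x (cross q)) = q" by (simp add: \<Psi>_pt s_def)
        then show ?thesis by metis
      qed
    qed
  qed
  have inside: "h q \<in> lk T \<longleftrightarrow> h (\<Psi> 1 q) \<in> lk T'" for q
  proof (cases "q \<in> ball3")
    case True
    have "\<Psi> 1 q \<in> ball3"
    proof (rule ccontr)
      assume *: "\<Psi> 1 q \<notin> ball3"
      then have "\<Psi> 1 (\<Psi> 1 q) = \<Psi> 1 q" by (rule supp)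
      then have "\<Psi> 1 q = q" using bij[of 1] by (simp add: bij_def inj_eq)
      with * True show False by simp
    qed
    moreover have "q \<in> T \<longleftrightarrow> \<Psi> 1 q \<in> T'"
    proof (cases "m q \<le> 5/4")
      case le: True
      then have "\<kappa> q = 1" by (simp add: \<kappa>_def)
      then have "\<Psi> 1 q = pt (p (q $ 1)) (cross q)" by (simp add: \<Psi>_def)
      then show ?thesis
        using le iff[of "cross q" "q $ 1"] by (simp add: m_def)
    next
      case False
      then have "q \<notin> T" "\<Psi> 1 q \<notin> T'"
        using T[of q] T'[of "\<Psi> 1 q"] by (auto simp: m_def \<Psi>_def)
      then show ?thesis by simp
    qed
    ultimately show ?thesis using True by (simp add: chart_in_lk_ball3)
  next
    case False
    have "q \<in> T \<longleftrightarrow> q \<in> T'"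
    proof (cases "m q \<le> 5/4")
      case True
      then have "2 \<le> \<bar>q $ 1\<bar>"
        using False by (auto simp: ball3_def forall_3 m_def)
      then show ?thesis
        using True iff[of "cross q" "q $ 1"] p(3) by (simp add: m_def)
    next
      case False
      then have "q \<notin> T" "q \<notin> T'"
        using T[of q] T'[of q] by (auto simp: m_def)
      then show ?thesis by simp
    qed
    then show ?thesis by (simp add: supp[OF False] chart_in_lk)
  qed
  show ?thesis
    by (rule ambient_isotopic_chart[OF chart Hausdorff compact_ball3, where \<Psi> = \<Psi>])
       (use cont supp bij inside lk_subset outside_lk in \<open>auto simp: \<Psi>_def\<close>)
qed

end


section \<open>Twisted pairs of strands\<close>

lemma tube_pt: "tube pt"
  by (simp add: tube_def)

lemma tube_translate:
  assumes "continuous_on UNIV g"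
  shows "tube (\<lambda>x w. pt x (w + g x))"
  unfolding tube_def
proof
  show "continuous_on UNIV (\<lambda>p. pt (p $ 1) (cross p + g (p $ 1)))"
    by (intro continuous_intros continuous_on_compose2[OF assms]) auto
  show "inj (\<lambda>p. pt (p $ 1) (cross p + g (p $ 1)))"
    by (rule injI) (metis add_right_cancel pt_cross pt_eq_iff)
qed

text \<open>Two strands at the angles \<open>\<theta>\<close> and \<open>\<theta> + \<pi>\<close> around the \<open>x\<close>-axis, their bands extending in the
  directions \<open>\<beta> 1\<close> and \<open>\<beta> (-1)\<close>.\<close>

definition bands :: "(real \<Rightarrow> real) \<Rightarrow> (real \<Rightarrow> real \<Rightarrow> real) \<Rightarrow> (real^3) set" where
  "bands \<theta> \<beta> = {p. \<bar>p $ 1\<bar> \<le> 2 \<and> (\<exists>s \<in> {1, -1}. \<exists>t. \<bar>t\<bar> \<le> 1/4 \<and>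
      cross p = of_real s * cis (\<theta> (p $ 1)) + of_real t * cis (\<beta> s (p $ 1)))}"

lemma tangle_eq_bands: "tangle n = bands (\<lambda>x. of_int n * pi * ramp x) (\<lambda>_ _. 0)"
proof -
  have "(\<exists>t. \<bar>t\<bar> \<le> 1/4 \<and> cross p = of_real s * cis a + of_real t * cis 0) \<longleftrightarrow>
      \<bar>p $ 2 - s * cos a\<bar> \<le> 1/4 \<and> p $ 3 = s * sin a" for p s a
    by (auto simp: complex_eq_iff intro!: exI[of _ "p $ 2 - s * cos a"])
  then show ?thesis
    unfolding tangle_def bands_def by presburger
qed

lemma bands_cong:
  assumes "\<And>x. \<bar>x\<bar> \<le> 2 \<Longrightarrow> cis (\<theta> x) = cis (\<theta>' x)"
    and "\<And>x s. \<bar>x\<bar> \<le> 2 \<Longrightarrow> s \<in> {1, -1} \<Longrightarrow> cis (\<beta> s x) = cis (\<beta>' s x)"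
  shows "bands \<theta> \<beta> = bands \<theta>' \<beta>'"
  unfolding bands_def using assms by (intro Collect_cong conj_cong refl bex_cong) auto

lemma pt_in_bands_iff:
  "pt x w \<in> bands \<theta> \<beta> \<longleftrightarrow> \<bar>x\<bar> \<le> 2 \<and> (\<exists>s \<in> {1, -1}. \<exists>t. \<bar>t\<bar> \<le> 1/4 \<and>
      w = of_real s * cis (\<theta> x) + of_real t * cis (\<beta> s x))"
  by (simp add: bands_def)

lemma norm_bands:
  assumes "pt x w \<in> bands \<theta> \<beta>"
  shows "norm w \<le> 5/4"
proof -
  obtain s t where st: "s \<in> {1, -1}" "\<bar>t\<bar> \<le> 1/4" "w = of_real s * cis (\<theta> x) + of_real t * cis (\<beta> s x)"
    using assms unfolding pt_in_bands_iff by blast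
  have "norm w \<le> norm (of_real s * cis (\<theta> x)) + norm (of_real t * cis (\<beta> s x))"
    unfolding st(3) by (rule norm_triangle_ineq)
  then show ?thesis using st(1,2) by (auto simp: norm_mult)
qed

lemma bands_subset_ball3: "bands \<theta> \<beta> \<subseteq> ball3"
proof
  fix p assume "p \<in> bands \<theta> \<beta>"
  then have p: "pt (p $ 1) (cross p) \<in> bands \<theta> \<beta>" by simp
  have "pt (p $ 1) (cross p) \<in> ball3"
    using norm_bands[OF p] p abs_Re_le_cmod[of "cross p"] abs_Im_le_cmod[of "cross p"]
    unfolding pt_in_ball3 pt_in_bands_iff by linarith
  then show "p \<in> ball3" by simp
qed

lemma cis_add_1: "cis a = 1 \<Longrightarrow> cis (b + a) = cis b"
  by (simp add: cis_mult[symmetric])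

text \<open>Strands and band directions turn by the same angle. Bands stay within radius 1 + 1/4, so
  the shell between 3/2 and 2 is empty.\<close>

lemma twist_related_axis:
  assumes "continuous_on UNIV \<phi>" "\<And>x. 1 \<le> \<bar>x\<bar> \<Longrightarrow> cis (\<phi> x) = 1"
  shows "twist_related pt 1 (3/2) 2 \<phi> (bands \<theta> \<beta>) (bands (\<lambda>x. \<theta> x + \<phi> x) (\<lambda>s x. \<beta> s x + \<phi> x))"
    (is "twist_related _ _ _ _ _ ?T ?T'")
  unfolding twist_related_def
proof (intro conjI allI impI)
  show "pt x w \<in> ball3" if "\<bar>x\<bar> \<le> 1" "norm w \<le> 2" for x w
    using that abs_Re_le_cmod[of w] abs_Im_le_cmod[of w] by (simp add: pt_in_ball3)
  show "pt x w \<in> ?T \<longleftrightarrow> pt x (cis (\<phi> x) * w) \<in> ?T'" for x w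
  proof -
    have "cis (\<phi> x) * w = of_real s * cis (\<theta> x + \<phi> x) + of_real t * cis (\<beta> s x + \<phi> x) \<longleftrightarrow>
      w = of_real s * cis (\<theta> x) + of_real t * cis (\<beta> s x)" for s t
    proof -
      have "of_real s * cis (\<theta> x + \<phi> x) + of_real t * cis (\<beta> s x + \<phi> x)
        = cis (\<phi> x) * (of_real s * cis (\<theta> x) + of_real t * cis (\<beta> s x))"
        by (simp add: cis_mult[symmetric] algebra_simps)
      then show ?thesis by simp
    qed
    then show ?thesis by (simp add: pt_in_bands_iff)
  qed
  show "pt x w \<notin> ?T" "pt x w \<notin> ?T'" if "3/2 < norm w" for x w
    using that norm_bands by fastforce+
  show "q \<in> ?T \<longleftrightarrow> q \<in> ?T'" if q: "\<forall>x w. \<bar>x\<bar> \<le> 1 \<longrightarrow> norm w \<le> 2 \<longrightarrow> q \<noteq> pt x w" for q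
  proof (cases "\<bar>q $ 1\<bar> \<le> 1")
    case True
    then have "2 < norm (cross q)" using q by (metis linorder_not_le pt_cross)
    then have "pt (q $ 1) (cross q) \<notin> ?T" "pt (q $ 1) (cross q) \<notin> ?T'"
      using norm_bands by fastforce+
    then show ?thesis by simp
  next
    case False
    then show ?thesis using assms(2)[of "q $ 1"] by (simp add: bands_def cis_add_1)
  qed
qed (use assms tube_pt in auto)

text \<open>The two cores are at distance 2, whereas a point of the other band within 1/2 of this
  core would force a distance of at most 1/2 + 1/4.\<close>

lemma pt_in_bands_near_strand:
  assumes "s \<in> {1, -1}" "norm w \<le> 1/2"
  shows "pt x (w + of_real s * cis (\<theta> x)) \<in> bands \<theta> \<beta> \<longleftrightarrow>
    \<bar>x\<bar> \<le> 2 \<and> (\<exists>t. \<bar>t\<bar> \<le> 1/4 \<and> w = of_real t * cis (\<beta> s x))"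
proof -
  have False if "\<bar>t\<bar> \<le> 1/4" "s' \<in> {1, -1}" "s' \<noteq> s"
    "w + of_real s * cis (\<theta> x) = of_real s' * cis (\<theta> x) + of_real t * cis (\<beta> s' x)" for s' t
  proof -
    have "s' = - s" using that assms(1) by auto
    then have "2 * of_real s * cis (\<theta> x) = of_real t * cis (\<beta> s' x) - w"
      using that(4) by (simp add: algebra_simps)
    then have "norm (2 * of_real s * cis (\<theta> x)) \<le> norm (of_real t * cis (\<beta> s' x)) + norm w"
      using norm_triangle_ineq4 by metis
    then show False using that(1) assms by (auto simp: norm_mult)
  qed
  moreover have "w + of_real s * cis (\<theta> x) = of_real s * cis (\<theta> x) + of_real t * cis (\<beta> s x) \<longleftrightarrow>
      w = of_real t * cis (\<beta> s x)" for t
    by (simp add: add.commute)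
  ultimately show ?thesis
    unfolding pt_in_bands_iff using assms(1) by metis
qed

text \<open>Rotation about the core of one strand turns only the band of this strand; its tube of
  radius 1/2 does not meet the other band.\<close>

lemma twist_related_strand:
  assumes s: "s \<in> {1, -1}" and \<theta>: "continuous_on UNIV \<theta>"
    and \<phi>: "continuous_on UNIV \<phi>" "\<And>x. 1 \<le> \<bar>x\<bar> \<Longrightarrow> cis (\<phi> x) = 1"
  shows "twist_related (\<lambda>x w. pt x (w + of_real s * cis (\<theta> x))) 1 (1/4) (1/2) \<phi>
    (bands \<theta> \<beta>) (bands \<theta> (\<beta>(s := \<lambda>x. \<beta> s x + \<phi> x)))"
    (is "twist_related ?b _ _ _ _ ?T ?T'")
  unfolding twist_related_def
proof (intro conjI allI impI)
  show "tube ?b"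
    by (intro tube_translate continuous_intros \<theta>)
  show "?b x w \<in> ball3" if "\<bar>x\<bar> \<le> 1" "norm w \<le> 1/2" for x w
  proof -
    have "norm (w + of_real s * cis (\<theta> x)) \<le> norm w + norm (of_real s * cis (\<theta> x))"
      by (rule norm_triangle_ineq)
    also have "\<dots> \<le> 3/2" using that s by (auto simp: norm_mult)
    finally show ?thesis
      using that abs_Re_le_cmod[of "w + of_real s * cis (\<theta> x)"]
        abs_Im_le_cmod[of "w + of_real s * cis (\<theta> x)"]
      unfolding pt_in_ball3 by linarith
  qed
  show "?b x w \<in> ?T \<longleftrightarrow> ?b x (cis (\<phi> x) * w) \<in> ?T'" if "norm w \<le> 1/4" for x w
  proof -
    have "cis (\<phi> x) * w = of_real t * cis (\<beta> s x + \<phi> x) \<longleftrightarrow> w = of_real t * cis (\<beta> s x)" for t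
    proof -
      have eq: "of_real t * cis (\<beta> s x + \<phi> x) = cis (\<phi> x) * (of_real t * cis (\<beta> s x))"
        by (simp add: cis_mult[symmetric])
      show ?thesis unfolding eq by simp
    qed
    then show ?thesis
      using that by (simp add: pt_in_bands_near_strand[OF s] norm_mult)
  qed
  show "?b x w \<notin> ?T" "?b x w \<notin> ?T'" if "1/4 < norm w" "norm w \<le> 1/2" for x w
    using that by (auto simp: pt_in_bands_near_strand[OF s] norm_mult)
  show "q \<in> ?T \<longleftrightarrow> q \<in> ?T'" if q: "\<forall>x w. \<bar>x\<bar> \<le> 1 \<longrightarrow> norm w \<le> 1/2 \<longrightarrow> q \<noteq> ?b x w" for q
  proof (cases "\<bar>q $ 1\<bar> \<le> 1")
    case True
    have far: "cross q \<noteq> of_real s * cis (\<theta> (q $ 1)) + of_real t * cis a" if "\<bar>t\<bar> \<le> 1/4" for t a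
    proof
      assume eq: "cross q = of_real s * cis (\<theta> (q $ 1)) + of_real t * cis a"
      have "q = ?b (q $ 1) (of_real t * cis a)"
        by (subst pt_cross[of q, symmetric], subst eq) (simp add: add.commute)
      moreover have "norm (of_real t * cis a) \<le> 1/2" using that by (simp add: norm_mult)
      ultimately show False using q True by blast
    qed
    have "(\<exists>t. \<bar>t\<bar> \<le> 1/4 \<and> cross q = of_real s' * cis (\<theta> (q $ 1)) + of_real t * cis (\<beta> s' (q $ 1))) \<longleftrightarrow>
      (\<exists>t. \<bar>t\<bar> \<le> 1/4 \<and> cross q = of_real s' * cis (\<theta> (q $ 1)) +
        of_real t * cis ((\<beta>(s := \<lambda>x. \<beta> s x + \<phi> x)) s' (q $ 1)))" for s'
      using far by (cases "s' = s") auto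
    then show ?thesis
      by (simp only: bands_def mem_Collect_eq)
  next
    case False
    then have "cis (\<beta> s (q $ 1) + \<phi> (q $ 1)) = cis (\<beta> s (q $ 1))"
      by (simp add: cis_add_1 \<phi>(2))
    then have "cis ((\<beta>(s := \<lambda>x. \<beta> s x + \<phi> x)) s' (q $ 1)) = cis (\<beta> s' (q $ 1))" for s'
      by (cases "s' = s") simp_all
    then show ?thesis
      by (simp only: bands_def mem_Collect_eq)
  qed
qed (use \<phi> in auto)

section \<open>Changing the winding of two strands while keeping the blackboard framing\<close>

context link_exterior
begin

text \<open>Three rotations: the pair is turned about the axis by the difference
  \<open>\<phi>\<close>, which tilts both bands by \<open>\<phi>\<close>, and then each band is
  turned back about its own core.\<close>

lemma isotopic_bands:
  assumes \<theta>: "continuous_on UNIV \<theta>" "continuous_on UNIV \<theta>'" and eq: "\<And>x. 1 \<le> \<bar>x\<bar> \<Longrightarrow> \<theta> x = \<theta>' x"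
  shows "ambient_isotopic M (lk (bands \<theta> (\<lambda>_ _. 0))) (lk (bands \<theta>' (\<lambda>_ _. 0)))"
proof -
  define \<phi> where "\<phi> x = \<theta>' x - \<theta> x" for x
  have \<phi>: "continuous_on UNIV \<phi>" "continuous_on UNIV (\<lambda>x. - \<phi> x)"
    unfolding \<phi>_def by (intro continuous_intros \<theta>)+
  have z: "\<phi> x = 0" "- \<phi> x = 0" "cis (\<phi> x) = 1" "cis (- \<phi> x) = 1" if "1 \<le> \<bar>x\<bar>" for x
    using eq[OF that] by (simp_all add: \<phi>_def)
  define \<beta> :: "real \<Rightarrow> real \<Rightarrow> real" where "\<beta> s x = 0 + \<phi> x" for s x
  have "ambient_isotopic M (lk (bands \<theta> (\<lambda>_ _. 0))) (lk (bands (\<lambda>x. \<theta> x + \<phi> x) (\<lambda>s x. 0 + \<phi> x)))"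
    by (rule isotopic_twist[OF twist_related_axis[OF \<phi>(1) z(3)] z(1)])
  moreover have "(\<lambda>x. \<theta> x + \<phi> x) = \<theta>'" by (simp add: \<phi>_def)
  ultimately have 1: "ambient_isotopic M (lk (bands \<theta> (\<lambda>_ _. 0))) (lk (bands \<theta>' \<beta>))"
    by (simp add: \<beta>_def[abs_def])
  define \<beta>' where "\<beta>' = \<beta>(1 := \<lambda>x. \<beta> 1 x + - \<phi> x)"
  have 2: "ambient_isotopic M (lk (bands \<theta>' \<beta>)) (lk (bands \<theta>' \<beta>'))"
    unfolding \<beta>'_def
    by (rule isotopic_twist[OF twist_related_strand[OF _ \<theta>(2) \<phi>(2) z(4)] z(2)]) simp_all
  have 3: "ambient_isotopic M (lk (bands \<theta>' \<beta>')) (lk (bands \<theta>' (\<beta>'(-1 := \<lambda>x. \<beta>' (-1) x + - \<phi> x))))"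
    by (rule isotopic_twist[OF twist_related_strand[OF _ \<theta>(2) \<phi>(2) z(4)] z(2)]) simp_all
  have "bands \<theta>' (\<beta>'(-1 := \<lambda>x. \<beta>' (-1) x + - \<phi> x)) = bands \<theta>' (\<lambda>_ _. 0)"
    by (rule bands_cong) (auto simp: \<beta>_def \<beta>'_def)
  with ambient_isotopic_trans[OF ambient_isotopic_trans[OF 1 2] 3] show ?thesis by simp
qed

text \<open>The same three rotations, but as homeomorphisms of links: the end angles need to agree
  only modulo full turns.\<close>

lemma framed_bands:
  assumes \<theta>: "continuous_on UNIV \<theta>" "continuous_on UNIV \<theta>'" and eq: "\<And>x. 1 \<le> \<bar>x\<bar> \<Longrightarrow> cis (\<theta> x) = cis (\<theta>' x)"
    and framed: "framed_link M (lk (bands \<theta> (\<lambda>_ _. 0)))"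
  shows "framed_link M (lk (bands \<theta>' (\<lambda>_ _. 0)))"
proof -
  define \<phi> where "\<phi> x = \<theta>' x - \<theta> x" for x
  have \<phi>: "continuous_on UNIV \<phi>" "continuous_on UNIV (\<lambda>x. - \<phi> x)"
    unfolding \<phi>_def by (intro continuous_intros \<theta>)+
  have z: "cis (\<phi> x) = 1" "cis (- \<phi> x) = 1" if "1 \<le> \<bar>x\<bar>" for x
    using eq[OF that] by (simp_all add: \<phi>_def cis_divide[symmetric])
  define \<beta> :: "real \<Rightarrow> real \<Rightarrow> real" where "\<beta> s x = 0 + \<phi> x" for s x
  have "framed_link M (lk (bands (\<lambda>x. \<theta> x + \<phi> x) (\<lambda>s x. 0 + \<phi> x)))"
    by (rule framed_twist[OF twist_related_axis[OF \<phi>(1) z(1)] z(1) framed])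
  moreover have "(\<lambda>x. \<theta> x + \<phi> x) = \<theta>'" by (simp add: \<phi>_def)
  ultimately have 1: "framed_link M (lk (bands \<theta>' \<beta>))"
    by (simp add: \<beta>_def[abs_def])
  define \<beta>' where "\<beta>' = \<beta>(1 := \<lambda>x. \<beta> 1 x + - \<phi> x)"
  have 2: "framed_link M (lk (bands \<theta>' \<beta>'))"
    unfolding \<beta>'_def
    by (rule framed_twist[OF twist_related_strand[OF _ \<theta>(2) \<phi>(2) z(2)] z(2) 1]) simp_all
  have "framed_link M (lk (bands \<theta>' (\<beta>'(-1 := \<lambda>x. \<beta>' (-1) x + - \<phi> x))))"
    by (rule framed_twist[OF twist_related_strand[OF _ \<theta>(2) \<phi>(2) z(2)] z(2) 2]) simp_all
  also have "bands \<theta>' (\<beta>'(-1 := \<lambda>x. \<beta>' (-1) x + - \<phi> x)) = bands \<theta>' (\<lambda>_ _. 0)"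
    by (rule bands_cong) (auto simp: \<beta>_def \<beta>'_def)
  finally show ?thesis .
qed

end


section \<open>Tangles with a twisted part\<close>

definition slices :: "(real \<Rightarrow> complex set) \<Rightarrow> (real^3) set" where
  "slices S = {p. \<bar>p $ 1\<bar> \<le> 2 \<and> cross p \<in> S (p $ 1)}"

lemma pt_in_slices [simp]: "pt x w \<in> slices S \<longleftrightarrow> \<bar>x\<bar> \<le> 2 \<and> w \<in> S x"
  by (simp add: slices_def)

lemma set_eq_pt: "S = T \<longleftrightarrow> (\<forall>x w. pt x w \<in> S \<longleftrightarrow> pt x w \<in> T)"
proof
  assume *: "\<forall>x w. pt x w \<in> S \<longleftrightarrow> pt x w \<in> T"
  show "S = T"
  proof (rule Set.set_eqI)
    fix p show "p \<in> S \<longleftrightarrow> p \<in> T"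
      using *[rule_format, of "p $ 1" "cross p"] by simp
  qed
qed simp

definition strands :: "real \<Rightarrow> real \<Rightarrow> complex set" where
  "strands a b = {w. \<exists>s \<in> {1, -1}. \<exists>t. \<bar>t\<bar> \<le> 1/4 \<and> w = of_real s * cis a + of_real t * cis b}"

lemma bands_eq_slices: "bands \<theta> (\<lambda>_. \<beta>) = slices (\<lambda>x. strands (\<theta> x) (\<beta> x))"
  by (simp add: bands_def slices_def strands_def)

lemma cis_int_pi: "cis (of_int m * pi) = of_real (if even m then 1 else -1)"
  using cos_npi_int[of m] sin_npi_int[of m] by (simp add: complex_eq_iff mult.commute)

text \<open>A half-turn of the cores at most exchanges the two signs \<open>s\<close>, and a
  half-turn of the band direction reverses the parameter \<open>t\<close>.\<close>

lemma strands_add_pi: "strands (a + of_int m * pi) (b + of_int n * pi) = strands a b"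
proof -
  have *: "strands a b \<subseteq> strands (a + of_int m * pi) (b + of_int n * pi)" for a b m n
  proof
    fix w assume "w \<in> strands a b"
    then obtain s t where st: "s \<in> {1, -1}" "\<bar>t\<bar> \<le> 1/4" "w = of_real s * cis a + of_real t * cis b"
      by (auto simp only: strands_def)
    define \<sigma> \<tau> :: real where "\<sigma> = (if even m then 1 else -1)" and "\<tau> = (if even n then 1 else -1)"
    have "cis (a + of_int m * pi) = of_real \<sigma> * cis a" "cis (b + of_int n * pi) = of_real \<tau> * cis b"
      by (simp_all add: cis_mult[symmetric] cis_int_pi \<sigma>_def \<tau>_def)
    moreover have "\<sigma> = 1 \<or> \<sigma> = -1" "\<tau> = 1 \<or> \<tau> = -1" by (simp_all add: \<sigma>_def \<tau>_def)
    ultimately have "w = of_real (s * \<sigma>) * cis (a + of_int m * pi) + of_real (t * \<tau>) * cis (b + of_int n * pi)"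
      using st(3) by (elim disjE) simp_all
    moreover have "s * \<sigma> \<in> {1, -1}" "\<bar>t * \<tau>\<bar> \<le> 1/4"
      using st(1,2) by (auto simp: \<sigma>_def \<tau>_def)
    ultimately show "w \<in> strands (a + of_int m * pi) (b + of_int n * pi)"
      unfolding strands_def by blast
  qed
  from *[of a b m n] *[of "a + of_int m * pi" "b + of_int n * pi" "- m" "- n"] show ?thesis
    by (simp add: algebra_simps)
qed

lemma strands_int_pi: "strands (of_int m * pi) 0 = strands 0 0"
  using strands_add_pi[of 0 m 0 0] by simp

text \<open>The slice of a planar U-shaped band with the core \<open>max v \<bar>y\<bar> = 1\<close>.\<close>

definition cap :: "real \<Rightarrow> complex set" where
  "cap v = {w. Im w = 0 \<and> 3/4 \<le> max v \<bar>Re w\<bar> \<and> max v \<bar>Re w\<bar> \<le> 5/4}"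

text \<open>Below the inner edge 3/4 of the tip, the slice meets only the two straight arms and no
  longer depends on \<open>v\<close>; above the outer edge 5/4 it is empty.\<close>

lemma cap_low: "v < 3/4 \<Longrightarrow> v' < 3/4 \<Longrightarrow> cap v = cap v'"
  by (auto simp: cap_def max_def)

lemma cap_high: "v > 5/4 \<Longrightarrow> cap v = {}"
  by (auto simp: cap_def)

lemma strands_0: "strands 0 0 = cap 0"
proof -
  have "(\<exists>t. \<bar>t\<bar> \<le> 1/4 \<and> w = of_real s * cis 0 + of_real t * cis 0) \<longleftrightarrow> Im w = 0 \<and> \<bar>Re w - s\<bar> \<le> 1/4" for s w
    by (auto simp: complex_eq_iff intro!: exI[of _ "Re w - s"])
  then show ?thesis
    by (auto simp: strands_def cap_def max_def abs_if split: if_splits)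
qed

lemma strands_bounds: "w \<in> strands a b \<Longrightarrow> norm w \<le> 5/4"
  using norm_bands[of 0 w "\<lambda>_. a" "\<lambda>_ _. b"] by (simp add: bands_eq_slices)

lemma cap_bounds: "w \<in> cap v \<Longrightarrow> norm w \<le> 5/4"
  by (auto simp: cap_def cmod_def)

lemma tangle_inf_eq_slices: "tangle_inf = slices (\<lambda>x. cap (3/2 - \<bar>x\<bar>))"
  by (auto simp: tangle_inf_def slices_def cap_def)

definition lead :: "real \<Rightarrow> real" where
  "lead x = max 0 (min 1 (2 * x + 2))"

text \<open>A tangle with \<open>m\<close> half-twists for \<open>-1 \<le> x \<le> -1/2\<close> followed by \<open>j\<close> half-twists in the small
  cube \<open>shrink ` ball3\<close>, in which \<open>-1/2 \<le> x \<le> 0\<close>.\<close>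

definition split_tangle :: "int \<Rightarrow> int \<Rightarrow> (real^3) set" where
  "split_tangle m j = bands (\<lambda>x. of_int m * pi * lead x + of_int j * pi * ramp (8 * x + 2)) (\<lambda>_ _. 0)"

definition split_inf :: "int \<Rightarrow> (real^3) set" where
  "split_inf m = slices (\<lambda>x. if x < -1/2 then strands (of_int m * pi * lead x) 0
     else if x \<le> 0 then cap (3/2 - \<bar>8 * x + 2\<bar>) else cap 0)"

text \<open>Only the x-direction is compressed, so slices are unchanged; the inverse
  \<open>8 * x + 2\<close> takes the interval from -1/2 to 0 to that from -2 to 2.\<close>

definition shrink :: "real^3 \<Rightarrow> real^3" where
  "shrink p = pt (p $ 1 / 8 - 1/4) (cross p)"

lemma pt_in_shrink_image: "pt x w \<in> shrink ` S \<longleftrightarrow> pt (8 * x + 2) w \<in> S"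
proof
  assume "pt (8 * x + 2) w \<in> S"
  moreover have "pt x w = shrink (pt (8 * x + 2) w)"
    by (simp add: shrink_def field_simps)
  ultimately show "pt x w \<in> shrink ` S" by blast
next
  assume "pt x w \<in> shrink ` S"
  then obtain p where "p \<in> S" "pt x w = shrink p" by blast
  then show "pt (8 * x + 2) w \<in> S" by (simp add: shrink_def) 
qed

lemma shrink_ball3: "pt x w \<in> shrink ` ball3 \<longleftrightarrow> -1/2 \<le> x \<and> x \<le> 0 \<and> \<bar>Re w\<bar> \<le> 2 \<and> \<bar>Im w\<bar> \<le> 2"
  by (auto simp: pt_in_shrink_image pt_in_ball3)

lemma shrink_affine:
  "shrink p = pt (-1/4) 0 + vector [vector [1/8, 0, 0], vector [0, 1, 0], vector [0, 0, 1]] *v p"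
  by (simp add: vec_eq_iff forall_3 shrink_def matrix_vector_mult_def sum_3)

lemma norm_bounds: "norm w \<le> 5/4 \<Longrightarrow> \<bar>Re w\<bar> \<le> 2 \<and> \<bar>Im w\<bar> \<le> 2"
  using abs_Re_le_cmod[of w] abs_Im_le_cmod[of w] by linarith

lemma tangle_eq_slices: "tangle j = slices (\<lambda>x. strands (of_int j * pi * ramp x) 0)"
  by (simp add: tangle_eq_bands bands_eq_slices)

lemma split_tangle_eq_slices:
  "split_tangle m j = slices (\<lambda>x. strands (of_int m * pi * lead x + of_int j * pi * ramp (8 * x + 2)) 0)"
  by (simp add: split_tangle_def bands_eq_slices)

text \<open>Inside the small cube the leading twists contribute the constant angle
  \<open>of_int m * pi\<close>, which does not change the slices.\<close>

lemma split_tangle_inside: "split_tangle m j \<inter> shrink ` ball3 = shrink ` tangle j"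
  unfolding set_eq_pt
proof (intro allI)
  fix x w
  show "pt x w \<in> split_tangle m j \<inter> shrink ` ball3 \<longleftrightarrow> pt x w \<in> shrink ` tangle j"
  proof (cases "-1/2 \<le> x \<and> x \<le> 0")
    case True
    then have "lead x = 1" by (simp add: lead_def)
    then have "strands (of_int m * pi * lead x + of_int j * pi * ramp (8 * x + 2)) 0
       = strands (of_int j * pi * ramp (8 * x + 2)) 0"
      using strands_add_pi[of "of_int j * pi * ramp (8 * x + 2)" m 0 0] by (simp add: add.commute)
    then show ?thesis
      using True strands_bounds norm_bounds
      by (auto simp: split_tangle_eq_slices tangle_eq_slices pt_in_shrink_image pt_in_ball3; blast)
  next
    case False
    then show ?thesis
      by (auto simp: tangle_eq_slices pt_in_shrink_image pt_in_ball3)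
  qed
qed

lemma split_inf_inside: "split_inf m \<inter> shrink ` ball3 = shrink ` tangle_inf"
  unfolding set_eq_pt
proof (intro allI)
  fix x w
  show "pt x w \<in> split_inf m \<inter> shrink ` ball3 \<longleftrightarrow> pt x w \<in> shrink ` tangle_inf"
  proof (cases "-1/2 \<le> x \<and> x \<le> 0")
    case True
    then show ?thesis
      using cap_bounds norm_bounds
      by (auto simp: split_inf_def tangle_inf_eq_slices pt_in_shrink_image pt_in_ball3; blast)
  next
    case False
    then show ?thesis
      by (auto simp: tangle_inf_eq_slices pt_in_shrink_image pt_in_ball3)
  qed
qed

text \<open>To the left the small tangle has not begun to turn. To the right the total angle is a
  multiple of \<open>pi\<close>, so the slice is that of two flat strands whatever \<open>j\<close>
  is.\<close>

lemma split_outside: "split_tangle m j - shrink ` ball3 = split_inf m - shrink ` ball3"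
  unfolding set_eq_pt
proof (intro allI)
  fix x w
  show "pt x w \<in> split_tangle m j - shrink ` ball3 \<longleftrightarrow> pt x w \<in> split_inf m - shrink ` ball3"
  proof (cases "-1/2 \<le> x \<and> x \<le> 0")
    case True
    then show ?thesis
      using cap_bounds strands_bounds norm_bounds
      by (auto simp: split_inf_def split_tangle_eq_slices shrink_ball3; blast)
  next
    case False
    have "(if x < -1/2 then strands (of_int m * pi * lead x) 0
       else if x \<le> 0 then cap (3/2 - \<bar>8 * x + 2\<bar>) else cap 0)
       = strands (of_int m * pi * lead x + of_int j * pi * ramp (8 * x + 2)) 0"
    proof (cases "x < -1/2")
      case True
      then have "ramp (8 * x + 2) = 0" by (simp add: ramp_def)
      then show ?thesis using True by simp
    next
      case f: False
      then have "ramp (8 * x + 2) = 1" "lead x = 1" using False by (auto simp: ramp_def lead_def)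
      then show ?thesis
        using f False strands_int_pi[of "m + j"] strands_0 by (simp add: algebra_simps)
    qed
    then show ?thesis
      by (simp add: split_inf_def split_tangle_eq_slices)
  qed
qed

text \<open>The arc of \<open>D\<^sub>\<infinity>\<close> on the left, made narrow and placed in the small cube, with \<open>m\<close> half-twists
  to the left of it; the arc on the right is the one of \<open>D\<^sub>\<infinity>\<close>.\<close>

definition finger :: "int \<Rightarrow> (real^3) set" where
  "finger m = slices (\<lambda>x. if x < -1/2 then strands (of_int m * pi * lead x) 0
     else if x \<le> 0 then cap (8 * x + 7/2) else cap (3/2 - x))"

section \<open>Reparametrizing the x-axis and passing to the small cube\<close>

context link_exterior
begin

lemma isotopic_push_slices:
  assumes p: "strict_mono p" "continuous_on UNIV p" "\<And>x. 2 \<le> \<bar>x\<bar> \<Longrightarrow> p x = x"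
    and bounds: "\<And>x w. w \<in> S x \<Longrightarrow> norm w \<le> 5/4" "\<And>x w. w \<in> S' x \<Longrightarrow> norm w \<le> 5/4"
    and eq: "\<And>x. \<bar>x\<bar> \<le> 2 \<Longrightarrow> S x = S' (p x)"
  shows "ambient_isotopic M (lk (slices S)) (lk (slices S'))"
proof (rule isotopic_push[OF p])
  have n: "\<bar>q $ 2\<bar> \<le> 5/4 \<and> \<bar>q $ 3\<bar> \<le> 5/4" if "norm (cross q) \<le> 5/4" for q
    using that abs_Re_le_cmod[of "cross q"] abs_Im_le_cmod[of "cross q"] by simp
  show "\<bar>q $ 2\<bar> \<le> 5/4 \<and> \<bar>q $ 3\<bar> \<le> 5/4" if "q \<in> slices S" for q
    using that bounds(1) by (intro n) (auto simp: slices_def)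
  show "\<bar>q $ 2\<bar> \<le> 5/4 \<and> \<bar>q $ 3\<bar> \<le> 5/4" if "q \<in> slices S'" for q
    using that bounds(2) by (intro n) (auto simp: slices_def)
  have "p x \<le> 2 \<longleftrightarrow> x \<le> 2" "-2 \<le> p x \<longleftrightarrow> -2 \<le> x" for x
    using p(3)[of 2] p(3)[of "-2"] strict_mono_less_eq[OF p(1), of x 2]
      strict_mono_less_eq[OF p(1), of "-2" x] by simp_all
  then show "pt x w \<in> slices S \<longleftrightarrow> pt (p x) w \<in> slices S'" for x w
    using eq[of x] by (auto simp: abs_le_iff minus_le_iff)
qed

lemma isotopic_split_inf: "ambient_isotopic M (lk (split_inf m)) (lk (finger m))"
  unfolding split_inf_def finger_def
proof (rule isotopic_push_slices)
  \<comment> \<open>Piecewise linear with slopes 1, 16, 8, 40/69 and 1. The left arc stays fixed;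
    slope 8 carries the right arc of the small tangle to full size by \<open>8 * x + 2\<close>.
    Slope 16 lies in the gap between the arcs, where all slices are empty, and 40/69 connects
    (-5/32, 3/4) to (2, 2) along flat strands.\<close>
  define p :: "real \<Rightarrow> real" where "p x = x + 15 * max 0 (x + 1/4) - 8 * max 0 (x + 7/32)
    - 512/69 * max 0 (x + 5/32) + 29/69 * max 0 (x - 2)" for x
  show "strict_mono p"
    by (rule strict_monoI) (auto simp: p_def max_def field_simps split: if_splits)
  show "continuous_on UNIV p"
    unfolding p_def by (intro continuous_intros)
  show "p x = x" if "2 \<le> \<bar>x\<bar>" for x
    using that by (auto simp: p_def max_def abs_if field_simps split: if_splits)
  fix x :: real assume x: "\<bar>x\<bar> \<le> 2"
  consider "x \<le> -1/4" | "-1/4 < x" "x < -7/32" | "-7/32 \<le> x" "x \<le> -5/32" | "-5/32 < x" "x \<le> 2"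
    using x by linarith
  then show "(if x < -1/2 then strands (of_int m * pi * lead x) 0
     else if x \<le> 0 then cap (3/2 - \<bar>8 * x + 2\<bar>) else cap 0) =
     (if p x < -1/2 then strands (of_int m * pi * lead (p x)) 0
     else if p x \<le> 0 then cap (8 * p x + 7/2) else cap (3/2 - p x))"
  proof cases
    case 1
    then have "p x = x" "3/2 - \<bar>8 * x + 2\<bar> = 8 * x + 7/2" by (simp_all add: p_def)
    with 1 show ?thesis by (simp only:) simp
  next
    case 2
    then have "p x = 16 * x + 15/4" by (simp add: p_def)
    with 2 show ?thesis by (simp add: cap_high)
  next
    case 3
    then have "p x = 8 * x + 2" by (simp add: p_def)
    with 3 show ?thesis by simp
  next
    case 4
    then have "3/4 < p x" by (auto simp: p_def max_def field_simps)
    with 4 have "cap (3/2 - \<bar>8 * x + 2\<bar>) = cap 0" "cap (3/2 - p x) = cap 0"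
      by (intro cap_low; simp)+
    moreover from 4 \<open>3/4 < p x\<close> have "\<not> p x \<le> 0" "\<not> p x < -1/2" "\<not> x < -1/2"
      by simp_all
    ultimately show ?thesis by (simp only: if_False if_cancel)
  qed
qed (auto split: if_splits dest: strands_bounds cap_bounds)

lemma isotopic_tangle_inf: "ambient_isotopic M (lk tangle_inf) (lk (finger 0))"
  unfolding tangle_inf_eq_slices finger_def
proof (rule isotopic_push_slices)
  \<comment> \<open>Slope 1/8 between -3/4 and -1/4 compresses the tip of the left arc by
    \<open>x / 8 - 1/4\<close>. The slopes 53/40 and 9/8 on its two sides restore the fixed points
    -2 and 0; there the slices are flat strands or empty. The right arc is not moved.\<close>
  define p :: "real \<Rightarrow> real" where "p x = x + 13/40 * max 0 (x + 2) - 6/5 * max 0 (x + 3/4)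
    + max 0 (x + 1/4) - 1/8 * max 0 x" for x
  show "strict_mono p"
    by (rule strict_monoI) (auto simp: p_def max_def field_simps split: if_splits)
  show "continuous_on UNIV p"
    unfolding p_def by (intro continuous_intros)
  show "p x = x" if "2 \<le> \<bar>x\<bar>" for x
    using that by (auto simp: p_def max_def abs_if field_simps split: if_splits)
  fix x :: real assume x: "\<bar>x\<bar> \<le> 2"
  consider "-2 \<le> x" "x < -3/4" | "-3/4 \<le> x" "x \<le> -1/4" | "-1/4 < x" "x < 0" | "0 \<le> x"
    using x by linarith
  then show "cap (3/2 - \<bar>x\<bar>) =
     (if p x < -1/2 then strands (of_int 0 * pi * lead (p x)) 0
     else if p x \<le> 0 then cap (8 * p x + 7/2) else cap (3/2 - p x))"
  proof cases
    case 1
    then have "p x < -11/32" by (simp add: p_def field_simps)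
    with 1 have "cap (3/2 - \<bar>x\<bar>) = cap 0" "cap (8 * p x + 7/2) = cap 0"
      by (intro cap_low; simp)+
    moreover have "p x \<le> 0" using \<open>p x < _\<close> by simp
    moreover have "strands (of_int 0 * pi * lead (p x)) 0 = cap 0" by (simp add: strands_0)
    ultimately show ?thesis by (simp only: if_True if_cancel)
  next
    case 2
    then have "p x = x / 8 - 1/4" by (simp add: p_def field_simps)
    with 2 show ?thesis by simp
  next
    case 3
    then have "-9/32 < p x" "p x < 0" by (auto simp: p_def max_def field_simps)
    with 3 show ?thesis by (simp add: cap_high)
  next
    case 4
    then have px: "p x = x" by (simp add: p_def field_simps)
    show ?thesis unfolding px using 4 by (simp add: cap_high)
  qed
qed (auto split: if_splits dest: strands_bounds cap_bounds)

lemma isotopic_split_tangle: "ambient_isotopic M (lk (tangle (m + j))) (lk (split_tangle m j))"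
  unfolding tangle_eq_bands split_tangle_def
proof (rule isotopic_bands)
  fix x :: real assume "1 \<le> \<bar>x\<bar>"
  then show "of_int (m + j) * pi * ramp x = of_int m * pi * lead x + of_int j * pi * ramp (8 * x + 2)"
    by (auto simp: ramp_def lead_def abs_if algebra_simps split: if_splits)
qed (auto simp: ramp_def lead_def intro!: continuous_intros)

text \<open>For even \<open>m - n\<close> the end angles differ by full turns, so the ends are
  connected in the same way.\<close>

lemma framed_tangle:
  assumes "framed_link M (lk (tangle m))" "even (m - n)"
  shows "framed_link M (lk (tangle n))"
  using assms(1) unfolding tangle_eq_bands
proof (rule framed_bands[rotated 3])
  fix x :: real assume "1 \<le> \<bar>x\<bar>"
  then have "ramp x = 0 \<or> ramp x = 1" by (cases "0 \<le> x") (auto simp: ramp_def)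
  then show "cis (of_int m * pi * ramp x) = cis (of_int n * pi * ramp x)"
    using assms(2) by (auto simp: cis_int_pi)
qed (auto simp: ramp_def intro!: continuous_intros)

text \<open>The exterior of the smaller cube consists of \<open>X\<close> and the part of
  \<open>T\<close> outside this cube.\<close>

lemma link_with_subtangle:
  assumes "framed_link M (lk T)" "T \<inter> g ` ball3 = g ` T0" "g ` ball3 \<subseteq> ball3"
  shows "link_with_tangle M (\<lambda>p. h (g p)) (lk (T - g ` ball3)) T0 (lk T)"
proof -
  have inj: "inj h" using chart by (simp add: open_embedding_alt)
  have eq: "(\<lambda>p. h (g p)) ` S = h ` g ` S" for S by auto
  have X: "X \<inter> h ` g ` ball3 = {}" using exterior(2) assms(3) by blast
  have "lk T \<inter> h ` g ` ball3 = h ` g ` T0"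
    unfolding assms(2)[symmetric] image_Int[OF inj] using X by (auto simp: lk_def)
  moreover have "lk T - h ` g ` ball3 = lk (T - g ` ball3)"
    unfolding lk_def image_set_diff[OF inj] using X by auto
  ultimately show ?thesis
    using assms(1) by (simp add: link_with_tangle_def eq)
qed

end


section \<open>Coordinates around an arc\<close>

text \<open>Coordinates along U-shaped arcs: \<open>corner (2 - \<bar>u\<bar>) \<sigma>\<close> and \<open>\<plusminus>corner \<bar>u\<bar> \<sigma>\<close> are the coordinates
  of a point of the arc \<open>max v \<bar>y\<bar> = \<sigma> + 1/2\<close>. For \<open>\<bar>u\<bar> \<le> 1/2\<close> and for \<open>\<bar>u\<bar> \<ge> 3/2\<close> the coordinate
  along the arc does not depend on \<open>\<sigma>\<close>.\<close>

definition corner :: "real \<Rightarrow> real \<Rightarrow> real" where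
  "corner c \<sigma> = \<sigma> * max 0 (min 1 (2 * c - 1)) + min (1/2) c"

lemma corner_low: "c \<le> 1/2 \<Longrightarrow> corner c \<sigma> = c"
  by (simp add: corner_def)

lemma corner_high: "1 \<le> c \<Longrightarrow> corner c \<sigma> = \<sigma> + 1/2"
  by (simp add: corner_def)

lemma corner_strict_mono:
  assumes "0 < \<sigma>" "c < c'" "c < 1"
  shows "corner c \<sigma> < corner c' \<sigma>"
proof (cases "c < 1/2")
  case True
  have "0 \<le> \<sigma> * max 0 (min 1 (2 * c' - 1))"
    using assms(1) by simp
  moreover have "c < min (1/2) c'"
    using True assms by simp
  ultimately show ?thesis
    using True by (simp add: corner_def)
next
  case c: False
  then have "max 0 (min 1 (2 * c - 1)) < max 0 (min 1 (2 * c' - 1))"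
    using assms by simp
  then have "\<sigma> * max 0 (min 1 (2 * c - 1)) < \<sigma> * max 0 (min 1 (2 * c' - 1))"
    using assms(1) by (rule mult_strict_left_mono)
  then show ?thesis
    using c assms by (simp add: corner_def)
qed

lemma corner_le:
  assumes "0 < \<sigma>"
  shows "corner c \<sigma> \<le> \<sigma> + 1/2"
  using corner_strict_mono[OF assms, of c 1] corner_high[of c \<sigma>] corner_high[of 1 \<sigma>]
  by (cases "c < 1") auto

lemma corner_less_half_iff:
  assumes "0 < \<sigma>"
  shows "corner c \<sigma> < 1/2 \<longleftrightarrow> c < 1/2"
proof -
  have "0 \<le> \<sigma> * max 0 (min 1 (2 * c - 1))" using assms by simp
  then show ?thesis by (cases "c < 1/2") (auto simp: corner_low corner_def)
qed

lemma corner_surj: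
  assumes "0 < \<sigma>" "a \<le> y" "y \<le> \<sigma> + 1/2" "a \<le> 1/2"
  obtains c where "a \<le> c" "c \<le> 1" "corner c \<sigma> = y"
proof -
  have "\<exists>c\<ge>a. c \<le> 1 \<and> corner c \<sigma> = y"
    using assms corner_low[of a \<sigma>] corner_high[of 1 \<sigma>]
    by (intro IVT') (auto simp: corner_def intro!: continuous_intros)
  then show thesis using that by blast
qed

text \<open>The odd extension of \<open>corner\<close>, written as a difference so that continuity
  needs no case distinction.\<close>

definition corner_y :: "real \<Rightarrow> real \<Rightarrow> real" where
  "corner_y u \<sigma> = corner (max u 0) \<sigma> - corner (max (-u) 0) \<sigma>"

lemma corner_y_nonneg: "0 \<le> u \<Longrightarrow> corner_y u \<sigma> = corner u \<sigma>"
  and corner_y_nonpos: "u \<le> 0 \<Longrightarrow> corner_y u \<sigma> = - corner (- u) \<sigma>"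
  by (simp_all add: corner_y_def corner_low)

lemma corner_nonneg: "0 < \<sigma> \<Longrightarrow> 0 \<le> c \<Longrightarrow> 0 \<le> corner c \<sigma>"
  by (simp add: corner_def)

lemma abs_corner_y: "0 < \<sigma> \<Longrightarrow> \<bar>corner_y u \<sigma>\<bar> = corner \<bar>u\<bar> \<sigma>"
  using corner_nonneg[of \<sigma> "\<bar>u\<bar>"] by (cases "0 \<le> u") (auto simp: corner_y_nonneg corner_y_nonpos)

text \<open>One of \<open>\<bar>u\<bar>\<close> and \<open>2 - \<bar>u\<bar>\<close> is at least 1,
  and there \<open>corner\<close> has reached its maximum.\<close>

lemma max_corner:
  assumes "0 < \<sigma>"
  shows "max (corner (2 - \<bar>u\<bar>) \<sigma>) \<bar>corner_y u \<sigma>\<bar> = \<sigma> + 1/2"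
  using corner_le[OF assms, of "2 - \<bar>u\<bar>"] corner_le[OF assms, of "\<bar>u\<bar>"]
    corner_high[of "\<bar>u\<bar>" \<sigma>] corner_high[of "2 - \<bar>u\<bar>" \<sigma>]
  by (cases "1 \<le> \<bar>u\<bar>") (auto simp: abs_corner_y[OF assms])

text \<open>The maximum of the two coordinates determines \<open>\<sigma>\<close>. Then
  \<open>\<bar>u\<bar>\<close> can be read off from a coordinate in the range where
  \<open>corner\<close> is strictly increasing, and the sign of \<open>u\<close> from that of
  \<open>corner_y\<close>.\<close>

lemma corner_inj:
  assumes "0 < \<sigma>" "0 < \<sigma>'" "corner (2 - \<bar>u\<bar>) \<sigma> = corner (2 - \<bar>u'\<bar>) \<sigma>'" "corner_y u \<sigma> = corner_y u' \<sigma>'"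
  shows "\<sigma> = \<sigma>' \<and> u = u'"
proof -
  have \<sigma>: "\<sigma> = \<sigma>'"
    using max_corner[OF assms(1), of u] max_corner[OF assms(2), of u'] assms(3,4) by simp
  have ne: False if "\<bar>v\<bar> < \<bar>v'\<bar>" "corner (2 - \<bar>v\<bar>) \<sigma> = corner (2 - \<bar>v'\<bar>) \<sigma>"
      "corner_y v \<sigma> = corner_y v' \<sigma>" for v v'
  proof -
    have "corner \<bar>v\<bar> \<sigma> = corner \<bar>v'\<bar> \<sigma>"
      using that(3) abs_corner_y[OF assms(1)] by metis
    then have "\<not> \<bar>v\<bar> < 1"
      using corner_strict_mono[OF assms(1) that(1)] by auto
    then show False
      using corner_strict_mono[OF assms(1), of "2 - \<bar>v'\<bar>" "2 - \<bar>v\<bar>"] that(1,2) by auto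
  qed
  have abs: "\<bar>u\<bar> = \<bar>u'\<bar>"
    using ne[of u u'] ne[of u' u] assms(3,4) \<sigma> by fastforce
  have "u = u'"
  proof (rule ccontr)
    assume "u \<noteq> u'"
    then have u': "u' = - u" "u \<noteq> 0" using abs by auto
    then have "corner_y u' \<sigma> = - corner_y u \<sigma>" by (simp add: corner_y_def)
    then have "corner \<bar>u\<bar> \<sigma> = 0" using abs_corner_y[OF assms(1), of u] assms(4) \<sigma> by simp
    moreover have "corner 0 \<sigma> < corner \<bar>u\<bar> \<sigma>" using u' by (intro corner_strict_mono assms) auto
    ultimately show False by (simp add: corner_low)
  qed
  with \<sigma> show ?thesis by simp
qed

text \<open>An increasing map onto the positive reals, equal to \<open>r + 1/2\<close> for \<open>r \<ge> -3/8\<close>; this makes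
  the coordinates around the arc global.\<close>

definition level :: "real \<Rightarrow> real" where
  "level r = 3/8 + max r (-3/8) + exp (min 0 (r + 3/8)) / 8"

lemma level_eq: "-3/8 \<le> r \<Longrightarrow> level r = r + 1/2"
  by (simp add: level_def)

lemma level_pos: "0 < level r"
proof -
  have "0 \<le> 3/8 + max r (-3/8)" by simp
  then show ?thesis unfolding level_def by (simp add: add_nonneg_pos)
qed

lemma level_inj: "level r = level r' \<Longrightarrow> r = r'"
proof -
  have "level x < level y" if "x < y" for x y
  proof (cases "y \<le> -3/8")
    case True
    then show ?thesis using that by (simp add: level_def)
  next
    case False
    have "exp (min 0 (x + 3/8)) \<le> exp (min 0 (y + 3/8))" using that by simp
    moreover have "max x (-3/8) < max y (-3/8)" using that False by simp
    ultimately show ?thesis unfolding level_def by linarith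
  qed
  then show "level r = level r' \<Longrightarrow> r = r'" by (metis linorder_less_linear order_less_irrefl)
qed

text \<open>\<open>Re w\<close> is the offset from the core within the plane: for
  \<open>Re w \<ge> -3/8\<close> the point lies on the arc
  \<open>max v \<bar>y\<bar> = Re w + 1\<close> with \<open>v = 8 * x + 7/2\<close>, matching the
  slices of \<open>finger\<close>.\<close>

definition around :: "real \<Rightarrow> complex \<Rightarrow> real^3" where
  "around u w = pt ((corner (2 - \<bar>u\<bar>) (level (Re w)) - 7/2) / 8) (Complex (corner_y u (level (Re w))) (Im w))"

lemma tube_around: "tube around"
  unfolding tube_def
proof
  show "continuous_on UNIV (\<lambda>p. around (p $ 1) (cross p))"
    unfolding around_def corner_y_def corner_def level_def Complex_eq
    by (intro continuous_intros) auto
  show "inj (\<lambda>p. around (p $ 1) (cross p))"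
  proof (rule injI)
    fix p q assume "around (p $ 1) (cross p) = around (q $ 1) (cross q)"
    then have "corner (2 - \<bar>p $ 1\<bar>) (level (p $ 2)) = corner (2 - \<bar>q $ 1\<bar>) (level (q $ 2))"
      "corner_y (p $ 1) (level (p $ 2)) = corner_y (q $ 1) (level (q $ 2))" "p $ 3 = q $ 3"
      by (simp_all add: around_def)
    moreover from corner_inj[OF level_pos level_pos this(1,2)]
    have "p $ 1 = q $ 1" "p $ 2 = q $ 2"
      by (auto dest: level_inj)
    ultimately show "p = q" by (simp add: vec_eq_iff forall_3)
  qed
qed

lemma around_eq:
  assumes "norm w \<le> 3/8"
  shows "around u w = pt ((corner (2 - \<bar>u\<bar>) (Re w + 1/2) - 7/2) / 8) (Complex (corner_y u (Re w + 1/2)) (Im w))"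
    and "1/8 \<le> Re w + 1/2" "Re w + 1/2 \<le> 7/8"
  using abs_Re_le_cmod[of w] assms by (simp_all add: around_def level_eq)

lemma around_x_neg: "norm w \<le> 3/8 \<Longrightarrow> around u w $ 1 < 0"
  using around_eq(1)[of w u] around_eq(2,3)[of w] corner_le[of "Re w + 1/2" "2 - \<bar>u\<bar>"] by simp

definition right_arc :: "(real^3) set" where
  "right_arc = slices (\<lambda>x. if x \<le> 0 then {} else cap (3/2 - x))"

text \<open>The value \<open>\<bar>u\<bar> = 29/2\<close> corresponds to \<open>x = -2\<close>.\<close>

definition twisted_arc :: "(real \<Rightarrow> real) \<Rightarrow> (real^3) set" where
  "twisted_arc \<beta> = {around u (of_real t * cis (\<beta> u)) | u t. \<bar>u\<bar> \<le> 29/2 \<and> \<bar>t\<bar> \<le> 1/4} \<union> right_arc"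

lemma around_notin_right_arc: "norm w \<le> 3/8 \<Longrightarrow> around u w \<notin> right_arc"
  using around_x_neg[of w u] by (auto simp: right_arc_def slices_def)

lemma around_in_twisted_arc:
  assumes "norm w \<le> 3/8"
  shows "around u w \<in> twisted_arc \<beta> \<longleftrightarrow> \<bar>u\<bar> \<le> 29/2 \<and> (\<exists>t. \<bar>t\<bar> \<le> 1/4 \<and> w = of_real t * cis (\<beta> u))"
  using around_notin_right_arc[OF assms] by (auto simp: twisted_arc_def tube_eq_iff[OF tube_around])

text \<open>On the arms \<open>\<bar>u\<bar> = 13/2\<close> corresponds to \<open>x = -1\<close>.
  The radius 3/8 exceeds the half-width 1/4 of the band and stays in the range where
  \<open>level\<close> is a translation.\<close>

lemma twist_related_arc:
  assumes "continuous_on UNIV \<phi>" "\<And>u. 13/2 \<le> \<bar>u\<bar> \<Longrightarrow> cis (\<phi> u) = 1"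
  shows "twist_related around (13/2) (1/4) (3/8) \<phi> (twisted_arc \<beta>) (twisted_arc (\<lambda>u. \<beta> u + \<phi> u))"
  unfolding twist_related_def
proof (intro conjI allI impI)
  show "around u w \<in> ball3" if uw: "\<bar>u\<bar> \<le> 13/2" "norm w \<le> 3/8" for u w
  proof -
    define \<sigma> where "\<sigma> = Re w + 1/2"
    have \<sigma>: "0 < \<sigma>" "\<sigma> \<le> 7/8" using around_eq(2,3)[OF uw(2)] by (simp_all add: \<sigma>_def)
    have "corner (2 - \<bar>u\<bar>) \<sigma> \<le> 11/8" "\<bar>corner_y u \<sigma>\<bar> \<le> 11/8"
      using max_corner[OF \<sigma>(1), of u] \<sigma>(2) by auto
    moreover have "-9/2 \<le> corner (2 - \<bar>u\<bar>) \<sigma>"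
      using uw(1) \<sigma>(1) by (auto simp: corner_def add_increasing)
    ultimately show ?thesis
      using abs_Im_le_cmod[of w] uw(2) by (simp add: around_eq(1) pt_in_ball3 flip: \<sigma>_def)
  qed
  show "around u w \<in> twisted_arc \<beta> \<longleftrightarrow> around u (cis (\<phi> u) * w) \<in> twisted_arc (\<lambda>u. \<beta> u + \<phi> u)"
    if "norm w \<le> 1/4" for u w
  proof -
    have "cis (\<phi> u) * w = of_real t * cis (\<beta> u + \<phi> u) \<longleftrightarrow> w = of_real t * cis (\<beta> u)" for t
    proof -
      have eq: "of_real t * cis (\<beta> u + \<phi> u) = cis (\<phi> u) * (of_real t * cis (\<beta> u))"
        by (simp add: cis_mult[symmetric])
      show ?thesis unfolding eq by simp
    qed
    then show ?thesis
      using that by (simp add: around_in_twisted_arc norm_mult)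
  qed
  show "around u w \<notin> twisted_arc \<beta>" "around u w \<notin> twisted_arc (\<lambda>u. \<beta> u + \<phi> u)"
    if "1/4 < norm w" "norm w \<le> 3/8" for u w
    using that by (auto simp: around_in_twisted_arc norm_mult)
  show "q \<in> twisted_arc \<beta> \<longleftrightarrow> q \<in> twisted_arc (\<lambda>u. \<beta> u + \<phi> u)"
    if q: "\<forall>u w. \<bar>u\<bar> \<le> 13/2 \<longrightarrow> norm w \<le> 3/8 \<longrightarrow> q \<noteq> around u w" for q
  proof -
    have "cis (\<beta> u + \<phi> u) = cis (\<beta> u)" if "q = around u w" "norm w \<le> 3/8" for u w
    proof -
      have "13/2 \<le> \<bar>u\<bar>" using q that by force
      then show ?thesis by (simp add: cis_add_1 assms(2))
    qed
    moreover have "norm (of_real t * cis a) \<le> 3/8" if "\<bar>t\<bar> \<le> 1/4" for t a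
      using that by (simp add: norm_mult)
    ultimately show ?thesis
      unfolding twisted_arc_def Un_iff mem_Collect_eq by metis
  qed
qed (use assms tube_around in auto)


section \<open>Untwisting the arc\<close>

lemma strands_rotate: "cis c * w \<in> strands (a + c) (b + c) \<longleftrightarrow> w \<in> strands a b"
proof -
  have "cis c * w = of_real s * cis (a + c) + of_real t * cis (b + c) \<longleftrightarrow>
      w = of_real s * cis a + of_real t * cis b" for s t
  proof -
    have eq: "of_real s * cis (a + c) + of_real t * cis (b + c) = cis c * (of_real s * cis a + of_real t * cis b)"
      by (simp add: cis_mult[symmetric] algebra_simps)
    show ?thesis unfolding eq by simp
  qed
  then show ?thesis by (simp only: strands_def mem_Collect_eq)
qed

text \<open>\<open>finger m\<close> after untwisting it around the \<open>x\<close>-axis: each of its two strands has \<open>-m\<close> half-twists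
  of the band.\<close>

definition flat_finger :: "int \<Rightarrow> (real^3) set" where
  "flat_finger m = slices (\<lambda>x. if x < -1/2 then strands 0 (- (of_int m * pi * lead x))
     else if x \<le> 0 then cap (8 * x + 7/2) else cap (3/2 - x))"

text \<open>The angle follows \<open>- lead\<close> times \<open>m\<close> half-turns up to
  \<open>x = -1/2\<close> and stays constant past the end of the tip at -9/32. It returns to 0
  between -1/4 and 0, where \<open>finger m\<close> is empty, so the right arc is not rotated. On
  the tip the rotation is multiplication by 1 or -1, under which \<open>cap\<close> is
  symmetric.\<close>

definition untwist :: "int \<Rightarrow> real \<Rightarrow> real" where
  "untwist m x = - (of_int m * pi * max 0 (min 1 (min (2 * x + 2) (-4 * x))))"

lemma untwist_0: "1 \<le> \<bar>x\<bar> \<Longrightarrow> untwist m x = 0"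
  by (cases "0 \<le> x") (auto simp: untwist_def)

lemma twist_related_finger: "twist_related pt 1 (3/2) 2 (untwist m) (finger m) (flat_finger m)"
  unfolding twist_related_def
proof (intro conjI allI impI)
  show "continuous_on UNIV (untwist m)"
    unfolding untwist_def by (intro continuous_intros)
  show "pt x w \<in> ball3" if "\<bar>x\<bar> \<le> 1" "norm w \<le> 2" for x w
    using that abs_Re_le_cmod[of w] abs_Im_le_cmod[of w] by (simp add: pt_in_ball3)
  show "pt x w \<in> finger m \<longleftrightarrow> pt x (cis (untwist m x) * w) \<in> flat_finger m" for x w
  proof -
    consider "x < -1/2" | "-1/2 \<le> x" "x \<le> -9/32" | "-9/32 < x" "x \<le> 0" | "0 < x" by linarith
    then show ?thesis
    proof cases
      case 1
      then have "untwist m x = - (of_int m * pi * lead x)"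
        by (simp add: untwist_def lead_def)
      then show ?thesis
        using 1 strands_rotate[of "untwist m x" w "of_int m * pi * lead x" 0]
        by (simp add: finger_def flat_finger_def)
    next
      case 2
      then have "untwist m x = of_int (- m) * pi"
        by (simp add: untwist_def)
      then have "cis (untwist m x) = of_real (if even m then 1 else -1)"
        using cis_int_pi[of "- m"] by simp
      then show ?thesis
        using 2 by (auto simp: finger_def flat_finger_def cap_def)
    next
      case 3
      then show ?thesis by (simp add: finger_def flat_finger_def cap_high)
    next
      case 4
      then have "untwist m x = 0" by (simp add: untwist_def)
      then show ?thesis using 4 by (simp add: finger_def flat_finger_def)
    qed
  qed
  have small: "norm w \<le> 5/4" if "pt x w \<in> finger m \<or> pt x w \<in> flat_finger m" for x w
    using that by (auto simp: finger_def flat_finger_def split: if_splits dest: strands_bounds cap_bounds)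
  show "pt x w \<notin> finger m" "pt x w \<notin> flat_finger m" if "3/2 < norm w" for x w
    using that small[of x w] by auto
  show "q \<in> finger m \<longleftrightarrow> q \<in> flat_finger m" if q: "\<forall>x w. \<bar>x\<bar> \<le> 1 \<longrightarrow> norm w \<le> 2 \<longrightarrow> q \<noteq> pt x w" for q
  proof (cases "\<bar>q $ 1\<bar> \<le> 1")
    case True
    then have "2 < norm (cross q)" using q by (metis linorder_not_le pt_cross)
    then show ?thesis using small[of "q $ 1" "cross q"] by auto
  next
    case False
    then have "q $ 1 < -1/2 \<Longrightarrow> lead (q $ 1) = 0" by (simp add: lead_def)
    then show ?thesis by (auto simp: finger_def flat_finger_def slices_def)
  qed
qed (simp_all add: tube_pt)

text \<open>Runs from 0 for \<open>u \<ge> 13/2\<close> over \<open>-m\<close> half-turns at the tip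
  to \<open>-m\<close> full turns for \<open>u \<le> -13/2\<close>. The interval from 5/2 to 13/2 of
  \<open>\<bar>u\<bar>\<close> is the part of an arm with \<open>x\<close> between -1 and
  -1/2.\<close>

definition flat_angle :: "int \<Rightarrow> real \<Rightarrow> real" where
  "flat_angle m u = - (of_int m * pi * (1 - max 0 (min 1 ((u - 5/2) / 4)) + max 0 (min 1 ((- u - 5/2) / 4))))"

lemma continuous_flat_angle: "continuous_on UNIV (flat_angle m)"
  unfolding flat_angle_def by (intro continuous_intros) auto

lemma cis_flat_angle:
  shows "u > 5/2 \<Longrightarrow> cis (flat_angle m u) = cis (- (of_int m * pi * lead ((- 3/2 - \<bar>u\<bar>) / 8)))"
    and "u < -5/2 \<Longrightarrow> cis (flat_angle m u) = cis (of_int m * pi * lead ((- 3/2 - \<bar>u\<bar>) / 8))"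
    and "\<bar>u\<bar> \<le> 5/2 \<Longrightarrow> cis (flat_angle m u) = of_real (if even m then 1 else -1)"
proof -
  have lead: "lead ((- 3/2 - \<bar>u\<bar>) / 8) = 1 - max 0 (min 1 ((\<bar>u\<bar> - 5/2) / 4))"
    by (auto simp: lead_def max_def min_def field_simps)
  show "cis (flat_angle m u) = cis (- (of_int m * pi * lead ((- 3/2 - \<bar>u\<bar>) / 8)))" if "u > 5/2"
  proof -
    have "max 0 (min 1 ((- u - 5/2) / 4)) = 0" using that by simp
    then show ?thesis using that unfolding flat_angle_def lead by simp
  qed
  show "cis (flat_angle m u) = cis (of_int m * pi * lead ((- 3/2 - \<bar>u\<bar>) / 8))" if "u < -5/2"
  proof -
    have "max 0 (min 1 ((u - 5/2) / 4)) = 0" using that by simp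
    then have "of_int m * pi * lead ((- 3/2 - \<bar>u\<bar>) / 8) = flat_angle m u + 2 * pi * of_int m"
      using that unfolding flat_angle_def lead by (simp add: algebra_simps)
    moreover have "cis (2 * pi * of_int m) = 1" by (rule cis_multiple_2pi) simp
    ultimately show ?thesis by (simp only: cis_add_1)
  qed
  show "cis (flat_angle m u) = of_real (if even m then 1 else -1)" if "\<bar>u\<bar> \<le> 5/2"
  proof -
    have "max 0 (min 1 ((u - 5/2) / 4)) = 0" "max 0 (min 1 ((- u - 5/2) / 4)) = 0" using that by auto
    then have "flat_angle m u = of_int (- m) * pi" by (simp add: flat_angle_def)
    then show ?thesis using cis_int_pi[of "- m"] by simp
  qed
qed

lemma around_arm:
  assumes "norm w \<le> 3/8" "3/2 \<le> \<bar>u\<bar>"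
  shows "around u w = pt ((- 3/2 - \<bar>u\<bar>) / 8) (Complex (sgn u * (1 + Re w)) (Im w))"
  using assms(2) unfolding around_eq(1)[OF assms(1)]
  by (cases "0 \<le> u") (auto simp: corner_low corner_high corner_y_nonneg corner_y_nonpos)

lemma norm_band: "\<bar>t\<bar> \<le> 1/4 \<Longrightarrow> norm (of_real t * cis a) \<le> 3/8"
  by (simp add: norm_mult)

lemma twisted_arcI:
  "\<bar>u\<bar> \<le> 29/2 \<Longrightarrow> \<bar>t\<bar> \<le> 1/4 \<Longrightarrow> around u (of_real t * cis (\<beta> u)) \<in> twisted_arc \<beta>"
  unfolding twisted_arc_def by blast

text \<open>On an arm the coordinates of \<open>around\<close> are a translation, with the outward
  direction reversed on the arm \<open>u < 0\<close>. On the planar part the band angle is a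
  multiple of \<open>pi\<close>, so only the offset \<open>r\<close> from the core matters.\<close>

lemma flat_finger_eq: "flat_finger m = twisted_arc (flat_angle m)"
proof
  show "twisted_arc (flat_angle m) \<subseteq> flat_finger m"
  proof
    fix p assume "p \<in> twisted_arc (flat_angle m)"
    then consider "p \<in> right_arc"
      | u t where "p = around u (of_real t * cis (flat_angle m u))" "\<bar>u\<bar> \<le> 29/2" "\<bar>t\<bar> \<le> 1/4"
      unfolding twisted_arc_def by blast
    then show "p \<in> flat_finger m"
    proof cases
      case 1
      then show ?thesis by (auto simp: right_arc_def flat_finger_def slices_def split: if_splits)
    next
      case ut: 2
      define w where "w = of_real t * cis (flat_angle m u)"
      have w: "norm w \<le> 3/8" unfolding w_def using ut(3) by (rule norm_band)
      define x where "x = (- 3/2 - \<bar>u\<bar>) / 8"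
      consider "u > 5/2" | "u < -5/2" | "\<bar>u\<bar> \<le> 5/2" by linarith
      then show ?thesis
      proof cases
        case 1
        then have "x < -1/2" "-2 \<le> x" "p = pt x (Complex (1 + Re w) (Im w))"
          using ut(1,2) around_arm[OF w, of u] by (simp_all add: x_def flip: w_def)
        moreover have "Complex (1 + Re w) (Im w) = of_real 1 * cis 0 + of_real t * cis (- (of_int m * pi * lead x))"
          using cis_flat_angle(1)[OF 1, of m] by (simp add: w_def x_def complex_eq_iff)
        ultimately show ?thesis
          using ut(3) by (auto simp: flat_finger_def strands_def)
      next
        \<comment> \<open>Here \<open>Re w\<close> points in the direction -y. This reverses the
          sense of rotation, which together with a full multiple of \<open>2 * pi\<close> turns
          \<open>flat_angle\<close> into the slice angle; the band parameter becomes
          \<open>- t\<close>.\<close>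
        case 2
        then have x: "x < -1/2" "-2 \<le> x" "p = pt x (Complex (- 1 - Re w) (Im w))"
          using ut(1,2) around_arm[OF w, of u] by (simp_all add: x_def flip: w_def)
        have "Complex (- 1 - Re w) (Im w) = of_real (-1) * cis 0 + of_real (- t) * cis (- (of_int m * pi * lead x))"
          using cis_flat_angle(2)[OF 2, of m] by (simp add: w_def x_def complex_eq_iff)
        then have "Complex (- 1 - Re w) (Im w) \<in> strands 0 (- (of_int m * pi * lead x))"
          unfolding strands_def using ut(3) by (intro CollectI bexI[of _ "-1"] exI[of _ "- t"]) auto
        then show ?thesis
          using x by (simp add: flat_finger_def)
      next
        case 3
        define r where "r = Re w"
        have r: "\<bar>r\<bar> \<le> 1/4" "Im w = 0"
          using ut(3) cis_flat_angle(3)[OF 3, of m] by (auto simp: r_def w_def)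
        have \<sigma>: "0 < r + 1/2" using r(1) by simp
        define v where "v = corner (2 - \<bar>u\<bar>) (r + 1/2)"
        have p: "p = pt ((v - 7/2) / 8) (Complex (corner_y u (r + 1/2)) 0)"
          using ut(1) around_eq(1)[OF w, of u] r by (simp add: v_def r_def flip: w_def)
        have mx: "max v \<bar>corner_y u (r + 1/2)\<bar> = r + 1"
          using max_corner[OF \<sigma>, of u] by (simp add: v_def)
        have "-1/2 \<le> v"
        proof -
          have "min (1/2) (2 - \<bar>u\<bar>) \<le> v" using \<sigma> by (simp add: v_def corner_def)
          then show ?thesis using 3 by linarith
        qed
        moreover have "v \<le> 5/4" using mx r(1) by linarith
        moreover have "8 * ((v - 7/2) / 8) + 7/2 = v" by (simp add: field_simps)
        moreover have "-1/4 \<le> r" "r \<le> 1/4" using r(1) by linarith+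
        ultimately show ?thesis
          using mx by (simp add: p flat_finger_def cap_def del: max_less_iff_conj max.bounded_iff)
      qed
    qed
  qed
  show "flat_finger m \<subseteq> twisted_arc (flat_angle m)"
  proof
    fix p assume p: "p \<in> flat_finger m"
    define x w where "x = p $ 1" and "w = cross p"
    have pxw: "p = pt x w" by (simp add: x_def w_def)
    have x2: "\<bar>x\<bar> \<le> 2" using p by (simp add: pxw flat_finger_def)
    consider "x < -1/2" | "-1/2 \<le> x" "x \<le> 0" | "0 < x" by linarith
    then show "p \<in> twisted_arc (flat_angle m)"
    proof cases
      case 1
      then have "w \<in> strands 0 (- (of_int m * pi * lead x))"
        using p by (simp add: pxw flat_finger_def)
      then obtain s t where st: "s \<in> {1, -1}" "\<bar>t\<bar> \<le> 1/4"
        "w = of_real s * cis 0 + of_real t * cis (- (of_int m * pi * lead x))"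
        unfolding strands_def by blast
      define u where "u = s * (- 3/2 - 8 * x)"
      have u: "sgn u = s" "\<bar>u\<bar> = - 3/2 - 8 * x" "5/2 < \<bar>u\<bar>" "\<bar>u\<bar> \<le> 29/2" "(- 3/2 - \<bar>u\<bar>) / 8 = x"
        using 1 st(1) x2 by (auto simp: u_def sgn_if abs_if)
      define w' where "w' = of_real (s * t) * cis (flat_angle m u)"
      have "\<bar>s * t\<bar> \<le> 1/4" using st(1,2) by auto
      then have nw: "norm w' \<le> 3/8" unfolding w'_def by (rule norm_band)
      have "around u w' = pt x (Complex (s * (1 + Re w')) (Im w'))"
        using around_arm[OF nw, of u] u by simp
      also have "Complex (s * (1 + Re w')) (Im w') = w"
      proof (cases "s = 1")
        case True
        then have "u > 5/2" using u by (simp add: u_def)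
        from cis_flat_angle(1)[OF this, of m] show ?thesis
          using True st(3) u(5) by (simp add: w'_def complex_eq_iff)
      next
        case False
        then have s: "s = -1" using st(1) by simp
        then have "u < -5/2" using 1 by (simp add: u_def)
        from cis_flat_angle(2)[OF this, of m] show ?thesis
          using s st(3) u(5) by (simp add: w'_def complex_eq_iff)
      qed
      finally have "p = around u w'" by (simp add: pxw)
      then show ?thesis
        unfolding twisted_arc_def w'_def using u(4) \<open>\<bar>s * t\<bar> \<le> 1/4\<close> by blast
    next
      case 2
      define v where "v = 8 * x + 7/2"
      have w: "Im w = 0" "3/4 \<le> max v \<bar>Re w\<bar>" "max v \<bar>Re w\<bar> \<le> 5/4"
        using p 2 by (simp_all add: pxw flat_finger_def cap_def v_def)
      define r where "r = max v \<bar>Re w\<bar> - 1"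
      have r: "\<bar>r\<bar> \<le> 1/4" "0 < r + 1/2" using w(2,3) unfolding r_def by linarith+
      define s :: real where "s = (if 0 \<le> Re w then 1 else -1)"
      have s: "\<bar>Re w\<bar> * s = Re w" "s = 1 \<or> s = -1" by (simp_all add: s_def)
      have y_s: "corner_y (s * c) \<sigma> = corner c \<sigma> * s" if "0 \<le> c" for c \<sigma>
        using s(2) that by (auto simp: corner_y_nonneg corner_y_nonpos)
      \<comment> \<open>The larger of \<open>v\<close> and \<open>\<bar>Re w\<bar>\<close> fixes the
        level \<open>r\<close>; the other one is attained by \<open>corner\<close> at some
        \<open>c\<close>. If \<open>v\<close> is larger, then \<open>\<bar>u\<bar> = c\<close>,
        otherwise \<open>\<bar>u\<bar> = 2 - c\<close>, with the sign of \<open>Re w\<close> in both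
        cases.\<close>
      obtain u where u: "\<bar>u\<bar> \<le> 5/2" "corner (2 - \<bar>u\<bar>) (r + 1/2) = v" "corner_y u (r + 1/2) = Re w"
      proof (cases "\<bar>Re w\<bar> \<le> v")
        case True
        then obtain c where c: "0 \<le> c" "c \<le> 1" "corner c (r + 1/2) = \<bar>Re w\<bar>"
          using corner_surj[OF r(2), of 0 "\<bar>Re w\<bar>"] by (auto simp: r_def)
        show thesis
        proof (rule that[of "s * c"])
          have "\<bar>s * c\<bar> = c" using s(2) c(1) by auto
          then show "\<bar>s * c\<bar> \<le> 5/2" "corner (2 - \<bar>s * c\<bar>) (r + 1/2) = v"
            using c(2) True by (simp_all add: corner_high r_def)
          show "corner_y (s * c) (r + 1/2) = Re w"
            using y_s[OF c(1)] c(3) s(1) by simp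
        qed
      next
        case False
        have "-1/2 \<le> v" using 2 by (simp add: v_def)
        then obtain c where c: "-1/2 \<le> c" "c \<le> 1" "corner c (r + 1/2) = v"
          using corner_surj[OF r(2), of "-1/2" v] False by (auto simp: r_def)
        show thesis
        proof (rule that[of "s * (2 - c)"])
          have "\<bar>s * (2 - c)\<bar> = 2 - c" using s(2) c(2) by auto
          then show "\<bar>s * (2 - c)\<bar> \<le> 5/2" "corner (2 - \<bar>s * (2 - c)\<bar>) (r + 1/2) = v"
            using c(1,3) by simp_all
          show "corner_y (s * (2 - c)) (r + 1/2) = Re w"
            using y_s[of "2 - c"] c(2) s(1) False by (simp add: corner_high r_def)
        qed
      qed
      define t where "t = r * (if even m then 1 else -1)"
      have t: "\<bar>t\<bar> \<le> 1/4" "of_real t * cis (flat_angle m u) = of_real r"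
        using r(1) cis_flat_angle(3)[OF u(1), of m] by (auto simp: t_def)
      have "p = around u (of_real r)"
        using r(1) u(2,3) w(1) by (simp add: around_eq(1) pxw v_def complex_eq_iff)
      then have "p = around u (of_real t * cis (flat_angle m u))" by (simp add: t(2))
      then show ?thesis
        using twisted_arcI[of u t "flat_angle m"] u(1) t(1) by simp
    next
      case 3
      then have "p \<in> right_arc"
        using p by (simp add: pxw flat_finger_def right_arc_def)
      then show ?thesis by (simp add: twisted_arc_def)
    qed
  qed
qed


section \<open>The skein relations\<close>

text \<open>An affine map taking the strand of a framing relator to the middle part of the narrow arc,
  which is parallel to the \<open>y\<close>-axis. It preserves the orientation because the strand runs in the
  direction \<open>-y\<close>.\<close>

definition place :: "real^3 \<Rightarrow> real^3" where
  "place p = pt ((p $ 2 - 5/2) / 8) (Complex (- 1/8 - p $ 1 / 16) (p $ 3))"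

lemma pt_in_place_image: "pt x w \<in> place ` S \<longleftrightarrow> pt (- 16 * Re w - 2) (Complex (8 * x + 5/2) (Im w)) \<in> S"
proof
  assume "pt (- 16 * Re w - 2) (Complex (8 * x + 5/2) (Im w)) \<in> S"
  moreover have "pt x w = place (pt (- 16 * Re w - 2) (Complex (8 * x + 5/2) (Im w)))"
    by (simp add: place_def complex_eq_iff field_simps)
  ultimately show "pt x w \<in> place ` S" by blast
next
  assume "pt x w \<in> place ` S"
  then obtain p where p: "p \<in> S" "pt x w = place p" by blast
  then have "pt (- 16 * Re w - 2) (Complex (8 * x + 5/2) (Im w)) = p"
    by (simp add: place_def vec_eq_iff forall_3 field_simps)
  with p(1) show "pt (- 16 * Re w - 2) (Complex (8 * x + 5/2) (Im w)) \<in> S" by simp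
qed

lemma place_affine:
  "place p = pt (-5/16) (Complex (-1/8) 0) + vector [vector [0, 1/8, 0], vector [-1/16, 0, 0], vector [0, 0, 1]] *v p"
  by (simp add: vec_eq_iff forall_3 place_def matrix_vector_mult_def sum_3 field_simps)

lemma in_place_ball3:
  "pt x w \<in> place ` ball3 \<longleftrightarrow> -1/4 \<le> Re w \<and> Re w \<le> 0 \<and> \<bar>8 * x + 5/2\<bar> \<le> 2 \<and> \<bar>Im w\<bar> \<le> 2"
  by (auto simp: pt_in_place_image pt_in_ball3)

lemma place_ball3: "place ` ball3 \<subseteq> ball3"
proof
  fix p assume "p \<in> place ` ball3"
  then have "pt (p $ 1) (cross p) \<in> place ` ball3" by simp
  then have "pt (p $ 1) (cross p) \<in> ball3"
    unfolding in_place_ball3 pt_in_ball3 by (auto simp: abs_le_iff)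
  then show "p \<in> ball3" by simp
qed

lemma shrink_ball3_subset: "shrink ` ball3 \<subseteq> ball3"
proof
  fix p assume "p \<in> shrink ` ball3"
  then have "pt (p $ 1) (cross p) \<in> shrink ` ball3" by simp
  then have "pt (p $ 1) (cross p) \<in> ball3"
    unfolding shrink_ball3 pt_in_ball3 by (auto simp: abs_le_iff)
  then show "p \<in> ball3" by simp
qed

lemma pt_in_strand:
  "pt x w \<in> strand n \<longleftrightarrow> \<bar>x\<bar> \<le> 2 \<and> (\<exists>t. \<bar>t\<bar> \<le> 1/4 \<and> w = of_real t * cis (2 * pi * of_int n * ramp x))"
  by (auto simp: strand_def complex_eq_iff)

lemma around_middle:
  assumes "norm w \<le> 3/8" "\<bar>u\<bar> \<le> 1/2"
  shows "around u w = pt ((Re w - 5/2) / 8) (Complex u (Im w))"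
proof -
  have "corner_y u (Re w + 1/2) = u"
    using assms(2) by (cases "0 \<le> u") (auto simp: corner_low corner_y_nonneg corner_y_nonpos)
  then show ?thesis
    using assms(2) by (simp add: around_eq(1)[OF assms(1)] corner_high algebra_simps)
qed

text \<open>In the box \<open>\<bar>Re w\<bar>\<close> is below 1/2, which excludes the arms and
  corners. What remains is the straight middle part, where \<open>u\<close> is the y-coordinate and
  \<open>place\<close> reads it as \<open>- 16 * u - 2\<close>.\<close>

lemma twisted_arc_inside:
  assumes \<beta>: "\<And>u. -1/4 \<le> u \<Longrightarrow> u \<le> 0 \<Longrightarrow> cis (\<beta> u) = cis (2 * pi * of_int j * ramp (- 16 * u - 2))"
  shows "twisted_arc \<beta> \<inter> place ` ball3 = place ` strand j"
  unfolding set_eq_pt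
proof (intro allI iffI)
  fix x w assume p: "pt x w \<in> twisted_arc \<beta> \<inter> place ` ball3"
  then have box: "-1/4 \<le> Re w" "Re w \<le> 0" "\<bar>8 * x + 5/2\<bar> \<le> 2"
    by (simp_all add: in_place_ball3)
  then have "pt x w \<notin> right_arc" by (auto simp: right_arc_def)
  then obtain u t where ut: "pt x w = around u (of_real t * cis (\<beta> u))" "\<bar>t\<bar> \<le> 1/4"
    using p by (auto simp: twisted_arc_def)
  define v where "v = of_real t * cis (\<beta> u)"
  have v: "norm v \<le> 3/8" unfolding v_def using ut(2) by (rule norm_band)
  have "Re w = corner_y u (Re v + 1/2)"
    using ut(1) by (simp add: around_eq(1)[OF v] flip: v_def)
  moreover have "0 < Re v + 1/2" using around_eq(2)[OF v] by simp
  ultimately have "corner \<bar>u\<bar> (Re v + 1/2) < 1/2" "0 < Re v + 1/2"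
    using box(1,2) abs_corner_y[of "Re v + 1/2" u] by auto
  then have "\<bar>u\<bar> < 1/2" using corner_less_half_iff by simp
  then have "pt x w = pt ((Re v - 5/2) / 8) (Complex u (Im v))"
    using ut(1) around_middle[OF v] by (simp flip: v_def)
  then have xw: "8 * x + 5/2 = Re v" "Re w = u" "Im w = Im v"
    by (simp_all add: field_simps)
  then have "Complex (8 * x + 5/2) (Im w) = of_real t * cis (2 * pi * of_int j * ramp (- 16 * u - 2))"
    using \<beta>[of u] box by (simp add: v_def complex_eq_iff)
  then show "pt x w \<in> place ` strand j"
    using ut(2) xw(2) box by (auto simp: pt_in_place_image pt_in_strand)
next
  fix x w assume "pt x w \<in> place ` strand j"
  then obtain t where t: "\<bar>- 16 * Re w - 2\<bar> \<le> 2" "\<bar>t\<bar> \<le> 1/4"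
    "Complex (8 * x + 5/2) (Im w) = of_real t * cis (2 * pi * of_int j * ramp (- 16 * Re w - 2))"
    by (auto simp: pt_in_place_image pt_in_strand)
  have u: "-1/4 \<le> Re w" "Re w \<le> 0" using t(1) by linarith+
  define v where "v = of_real t * cis (\<beta> (Re w))"
  have v: "norm v \<le> 3/8" unfolding v_def using t(2) by (rule norm_band)
  have "Complex (8 * x + 5/2) (Im w) = v"
    using t(3) \<beta>[OF u] by (simp add: v_def)
  then have xv: "8 * x + 5/2 = Re v" "Im w = Im v" by auto
  then have "pt x w = around (Re w) v"
    using around_middle[OF v, of "Re w"] u by (simp add: complex_eq_iff field_simps)
  then have "pt x w \<in> twisted_arc \<beta>"
    using twisted_arcI[of "Re w" t \<beta>] t(2) u by (simp add: v_def)
  moreover have "pt x w \<in> place ` ball3"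
    using u xv v abs_Re_le_cmod[of v] abs_Im_le_cmod[of v] by (simp add: in_place_ball3)
  ultimately show "pt x w \<in> twisted_arc \<beta> \<inter> place ` ball3" by simp
qed

lemma twisted_arc_outside:
  assumes "\<And>u. u < -1/4 \<or> 0 < u \<Longrightarrow> cis (\<beta> u) = cis (\<beta>' u)"
  shows "twisted_arc \<beta> - place ` ball3 = twisted_arc \<beta>' - place ` ball3"
proof -
  have sub: "twisted_arc \<beta> - place ` ball3 \<subseteq> twisted_arc \<beta>'"
    if eq: "\<And>u. u < -1/4 \<or> 0 < u \<Longrightarrow> cis (\<beta> u) = cis (\<beta>' u)" for \<beta> \<beta>'
  proof
    fix p assume p: "p \<in> twisted_arc \<beta> - place ` ball3"
    then consider "p \<in> right_arc"
      | u t where "p = around u (of_real t * cis (\<beta> u))" "\<bar>u\<bar> \<le> 29/2" "\<bar>t\<bar> \<le> 1/4"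
      unfolding twisted_arc_def by blast
    then show "p \<in> twisted_arc \<beta>'"
    proof cases
      case ut: 2
      have "u < -1/4 \<or> 0 < u"
      proof (rule ccontr)
        assume "\<not> (u < -1/4 \<or> 0 < u)"
        then have u: "-1/4 \<le> u" "u \<le> 0" by auto
        define v where "v = of_real t * cis (\<beta> u)"
        have v: "norm v \<le> 3/8" unfolding v_def using ut(3) by (rule norm_band)
        have "p = pt ((Re v - 5/2) / 8) (Complex u (Im v))"
          using ut(1) around_middle[OF v, of u] u by (simp flip: v_def)
        moreover have "8 * ((Re v - 5/2) / 8) + 5/2 = Re v" by (simp add: field_simps)
        ultimately have "p \<in> place ` ball3"
          using u v abs_Re_le_cmod[of v] abs_Im_le_cmod[of v]
          by (simp only: in_place_ball3 complex.sel) (intro conjI TrueI; linarith)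
        with p show False by simp
      qed
      then show ?thesis using twisted_arcI[of u t \<beta>'] ut eq[of u] by simp
    qed (simp add: twisted_arc_def)
  qed
  have "twisted_arc \<beta> - place ` ball3 \<subseteq> twisted_arc \<beta>'"
    by (rule sub) (rule assms)
  moreover have "twisted_arc \<beta>' - place ` ball3 \<subseteq> twisted_arc \<beta>"
    by (rule sub) (rule assms[symmetric])
  ultimately show ?thesis by blast
qed

text \<open>All \<open>n\<close> turns take place for \<open>u\<close> between 1/16 and 3/16. They
  are next to the cube of \<open>place\<close>, where \<open>u\<close> is between -1/4 and 0 and the
  band is flat because its angle is constantly \<open>n\<close> full turns.\<close>

definition cap_twist :: "int \<Rightarrow> real \<Rightarrow> real" where
  "cap_twist n u = 2 * pi * of_int n * ramp (2 - 16 * u)"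

lemma continuous_ramp [continuous_intros]:
  "continuous_on S f \<Longrightarrow> continuous_on S (\<lambda>x. ramp (f x))"
  unfolding ramp_def by (intro continuous_intros) auto

lemma cis_2pi_int: "cis (2 * pi * of_int n) = 1"
  by (rule cis_multiple_2pi) simp

context link_exterior
begin

lemma isotopic_finger: "ambient_isotopic M (lk (finger m)) (lk (twisted_arc (flat_angle m)))"
  unfolding flat_finger_eq[symmetric]
  by (rule isotopic_twist[OF twist_related_finger]) (rule untwist_0)

lemma isotopic_arc:
  assumes "continuous_on UNIV \<beta>" "continuous_on UNIV \<beta>'" "\<And>u. 13/2 \<le> \<bar>u\<bar> \<Longrightarrow> \<beta> u = \<beta>' u"
  shows "ambient_isotopic M (lk (twisted_arc \<beta>)) (lk (twisted_arc \<beta>'))"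
proof -
  have cont: "continuous_on UNIV (\<lambda>u. \<beta>' u - \<beta> u)"
    using assms(1,2) by (intro continuous_intros)
  have "ambient_isotopic M (lk (twisted_arc \<beta>)) (lk (twisted_arc (\<lambda>u. \<beta> u + (\<beta>' u - \<beta> u))))"
    by (rule isotopic_twist[OF twist_related_arc[OF cont]]) (simp_all add: assms(3))
  then show ?thesis by simp
qed

lemma framed_arc:
  assumes "continuous_on UNIV \<beta>" "continuous_on UNIV \<beta>'" "\<And>u. 13/2 \<le> \<bar>u\<bar> \<Longrightarrow> cis (\<beta> u) = cis (\<beta>' u)"
    and "framed_link M (lk (twisted_arc \<beta>))"
  shows "framed_link M (lk (twisted_arc \<beta>'))"
proof -
  have cont: "continuous_on UNIV (\<lambda>u. \<beta>' u - \<beta> u)"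
    using assms(1,2) by (intro continuous_intros)
  have "framed_link M (lk (twisted_arc (\<lambda>u. \<beta> u + (\<beta>' u - \<beta> u))))"
    by (rule framed_twist[OF twist_related_arc[OF cont] _ assms(4)])
       (simp_all add: assms(3) cis_divide[symmetric])
  then show ?thesis by simp
qed

end

section \<open>Evaluating the framing and cubic relators\<close>

locale skein_exterior = link_exterior M h X for M :: "'a topology" and h X +
  fixes \<omega> :: "'a \<Rightarrow> 'a chain set"
  assumes oriented: "oriented_chart M \<omega> h"
    and framed_inf: "framed_link M (lk tangle_inf)"
begin

lemma oriented_shrink: "oriented_chart M \<omega> (\<lambda>p. h (shrink p))"
  unfolding shrink_affine by (rule oriented_chart_affine[OF oriented]) (simp add: det_3)

lemma oriented_place: "oriented_chart M \<omega> (\<lambda>p. h (place p))"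
  unfolding place_affine by (rule oriented_chart_affine[OF oriented]) (simp add: det_3)

lemma framed_finger_0: "framed_link M (lk (finger 0))"
  by (rule framed_link_ambient_isotopic[OF isotopic_tangle_inf framed_inf])

lemma flat_angle_0: "flat_angle 0 = (\<lambda>_. 0)"
  by (simp add: flat_angle_def fun_eq_iff)

lemma framed_twisted_arc:
  assumes "continuous_on UNIV \<beta>" "\<And>u. 13/2 \<le> \<bar>u\<bar> \<Longrightarrow> cis (\<beta> u) = 1"
  shows "framed_link M (lk (twisted_arc \<beta>))"
proof (rule framed_arc[OF _ assms(1)])
  show "framed_link M (lk (twisted_arc (\<lambda>_. 0)))"
    using framed_link_ambient_isotopic[OF isotopic_finger framed_finger_0] by (simp add: flat_angle_0)
qed (simp_all add: assms(2))

lemma cap_twist_far: "13/2 \<le> \<bar>u\<bar> \<Longrightarrow> cap_twist n u = (if 0 \<le> u then 0 else 2 * pi * of_int n)"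
  by (auto simp: cap_twist_def ramp_def)

lemma cis_cap_twist_far: "13/2 \<le> \<bar>u\<bar> \<Longrightarrow> cis (cap_twist n u) = 1"
  by (simp add: cap_twist_far cis_2pi_int)

lemma continuous_cap_twist: "continuous_on UNIV (cap_twist n)"
  unfolding cap_twist_def by (intro continuous_intros)

lemma framed_cap_twist: "framed_link M (lk (twisted_arc (cap_twist n)))"
  by (rule framed_twisted_arc[OF continuous_cap_twist cis_cap_twist_far])

lemma flat_angle_far: "13/2 \<le> \<bar>u\<bar> \<Longrightarrow> flat_angle m u = cap_twist (- m) u"
  by (cases "0 \<le> u") (auto simp: cap_twist_far flat_angle_def)

text \<open>The two strands of the untwisted finger contribute \<open>-m\<close> half-twists of the band each; both
  are slid along the arc to its middle part, where they make up \<open>-m\<close> full twists.\<close>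

lemma isotopic_split_inf_cap: "ambient_isotopic M (lk (split_inf m)) (lk (twisted_arc (cap_twist (- m))))"
  by (rule ambient_isotopic_trans[OF ambient_isotopic_trans[OF isotopic_split_inf isotopic_finger]
      isotopic_arc[OF continuous_flat_angle continuous_cap_twist flat_angle_far]])

lemma framed_split_inf: "framed_link M (lk (split_inf m))"
  by (rule framed_link_ambient_isotopic[OF ambient_isotopic_sym[OF isotopic_split_inf_cap lk_subset] framed_cap_twist])

lemma link_split_inf: "link M (lk (split_inf m)) = link M (lk (twisted_arc (cap_twist (- m))))"
  by (rule link_ambient_isotopic[OF isotopic_split_inf_cap framed_split_inf])

lemma link_tangle_inf: "link M (lk tangle_inf) = link M (lk (twisted_arc (cap_twist 0)))"
proof -
  have "ambient_isotopic M (lk tangle_inf) (lk (twisted_arc (flat_angle 0)))"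
    by (rule ambient_isotopic_trans[OF isotopic_tangle_inf isotopic_finger])
  moreover have "flat_angle 0 = cap_twist 0"
    by (simp add: flat_angle_def cap_twist_def fun_eq_iff)
  ultimately show ?thesis
    using link_ambient_isotopic[OF _ framed_inf] by metis
qed

lemma framing_step:
  "link M (lk (twisted_arc (cap_twist (n + 1)))) - a_pow 1 \<cdot> link M (lk (twisted_arc (cap_twist n)))
    \<in> skein_submodule M \<omega>"
proof -
  \<comment> \<open>One more turn is added inside the cube of \<open>place\<close>, for
    \<open>u\<close> between -3/16 and -1/16. Since the total angle is that of
    \<open>cap_twist (n + 1)\<close> at both ends, this turn can be slid to the others.\<close>
  define \<beta> where "\<beta> u = cap_twist n u + 2 * pi * ramp (- 16 * u - 2)" for u
  have cont: "continuous_on UNIV \<beta>"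
    unfolding \<beta>_def by (intro continuous_intros continuous_cap_twist)
  have far: "\<beta> u = cap_twist (n + 1) u" if "13/2 \<le> \<bar>u\<bar>" for u
    using that by (auto simp: \<beta>_def cap_twist_far ramp_def algebra_simps)
  have framed: "framed_link M (lk (twisted_arc \<beta>))"
    by (rule framed_twisted_arc[OF cont]) (simp add: far cis_cap_twist_far)
  have link_eq: "link M (lk (twisted_arc (cap_twist (n + 1)))) = link M (lk (twisted_arc \<beta>))"
    by (rule link_ambient_isotopic[OF isotopic_arc[OF cont continuous_cap_twist far] framed, symmetric])
  have without: "link_with_tangle M (\<lambda>p. h (place p)) (lk (twisted_arc (cap_twist n) - place ` ball3))
      (strand 0) (lk (twisted_arc (cap_twist n)))"
  proof (rule link_with_subtangle[OF framed_cap_twist twisted_arc_inside place_ball3])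
    fix u :: real assume "-1/4 \<le> u" "u \<le> 0"
    then show "cis (cap_twist n u) = cis (2 * pi * of_int 0 * ramp (- 16 * u - 2))"
      by (simp add: cap_twist_def ramp_def cis_2pi_int)
  qed
  have twisted: "link_with_tangle M (\<lambda>p. h (place p)) (lk (twisted_arc \<beta> - place ` ball3))
      (strand 1) (lk (twisted_arc \<beta>))"
  proof (rule link_with_subtangle[OF framed twisted_arc_inside place_ball3])
    fix u :: real assume "-1/4 \<le> u" "u \<le> 0"
    then have "cis (cap_twist n u) = 1"
      by (simp add: cap_twist_def ramp_def cis_2pi_int)
    then show "cis (\<beta> u) = cis (2 * pi * of_int 1 * ramp (- 16 * u - 2))"
      by (simp add: \<beta>_def cis_mult[symmetric])
  qed
  have outside: "twisted_arc (cap_twist n) - place ` ball3 = twisted_arc \<beta> - place ` ball3"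
  proof (rule twisted_arc_outside)
    fix u :: real assume "u < -1/4 \<or> 0 < u"
    then have "ramp (- 16 * u - 2) = 0 \<or> ramp (- 16 * u - 2) = 1" by (auto simp: ramp_def)
    then have "cis (2 * pi * ramp (- 16 * u - 2)) = 1" using cis_2pi_int[of 1] by auto
    then show "cis (cap_twist n u) = cis (\<beta> u)" by (simp add: \<beta>_def cis_add_1)
  qed
  have "link M (lk (twisted_arc (cap_twist (n + 1)))) - a_pow 1 \<cdot> link M (lk (twisted_arc (cap_twist n)))
      \<in> framing_relators M \<omega>"
    unfolding framing_relators_def link_eq
    using oriented_place without[unfolded outside] twisted by blast
  then show ?thesis
    unfolding skein_submodule_def by (intro comb.span_base) simp
qed

text \<open>Induction in both directions from 0; a turn is removed by multiplying the framing
  relation with the inverse of \<open>a\<close>.\<close>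

lemma framing_power:
  "link M (lk (twisted_arc (cap_twist n))) - a_pow n \<cdot> link M (lk tangle_inf) \<in> skein_submodule M \<omega>"
proof (induction n rule: int_induct[where k = 0])
  case base
  show ?case
    by (simp add: link_tangle_inf a_pow_0 skein_submodule_def comb.span_zero)
next
  case (step1 n)
  let ?C = "\<lambda>n. link M (lk (twisted_arc (cap_twist n)))" and ?L = "link M (lk tangle_inf)"
  have eq: "?C (n + 1) - a_pow (n + 1) \<cdot> ?L = (?C (n + 1) - a_pow 1 \<cdot> ?C n) + a_pow 1 \<cdot> (?C n - a_pow n \<cdot> ?L)"
    by (simp add: comb.scale_right_diff_distrib a_pow_add mult.commute)
  show ?case
    using framing_step[of n] step1(2) unfolding eq skein_submodule_def
    by (intro comb.span_add comb.span_scale)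
next
  case (step2 n)
  let ?C = "\<lambda>n. link M (lk (twisted_arc (cap_twist n)))" and ?L = "link M (lk tangle_inf)"
  have "a_pow (-1) * a_pow 1 = 1" "a_pow (-1) * a_pow n = a_pow (n - 1)"
    using a_pow_add[of "-1" 1] a_pow_add[of "-1" n] by (simp_all add: a_pow_0)
  then have eq: "?C (n - 1) - a_pow (n - 1) \<cdot> ?L
      = a_pow (-1) \<cdot> (?C n - a_pow n \<cdot> ?L) - a_pow (-1) \<cdot> (?C n - a_pow 1 \<cdot> ?C (n - 1))"
    by (simp add: comb.scale_right_diff_distrib)
  have "?C n - a_pow 1 \<cdot> ?C (n - 1) \<in> skein_submodule M \<omega>"
    using framing_step[of "n - 1"] by simp
  then show ?case
    using step2(2) unfolding eq skein_submodule_def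
    by (intro comb.span_diff[OF comb.span_scale comb.span_scale])
qed

text \<open>The links of \<open>split_tangle m j\<close> for \<open>j\<close> from 0 to 3 and of
  \<open>split_inf m\<close> share their exterior with respect to the small cube, so they form a
  relator there; afterwards each is replaced by an equivalent combination.\<close>

lemma cubic_step:
  assumes framed: "\<And>m. framed_link M (lk (tangle m))"
  shows "b0 \<cdot> link M (lk (tangle m)) + b1 \<cdot> link M (lk (tangle (m + 1))) + b2 \<cdot> link M (lk (tangle (m + 2)))
    + b3 \<cdot> link M (lk (tangle (m + 3))) + (b_inf * a_pow (- m)) \<cdot> link M (lk tangle_inf) \<in> skein_submodule M \<omega>"
proof -
  have fr: "framed_link M (lk (split_tangle m j))" for j
    by (rule framed_link_ambient_isotopic[OF isotopic_split_tangle framed])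
  have eq: "link M (lk (tangle (m + j))) = link M (lk (split_tangle m j))" for j
    by (rule link_ambient_isotopic[OF isotopic_split_tangle framed])
  define Y where "Y = lk (split_inf m - shrink ` ball3)"
  have "link_with_tangle M (\<lambda>p. h (shrink p)) Y (tangle j) (lk (split_tangle m j))" for j
    unfolding Y_def split_outside[of m j, symmetric]
    by (rule link_with_subtangle[OF fr split_tangle_inside shrink_ball3_subset])
  moreover have "link_with_tangle M (\<lambda>p. h (shrink p)) Y tangle_inf (lk (split_inf m))"
    using link_with_subtangle[OF framed_split_inf split_inf_inside shrink_ball3_subset]
    by (simp add: Y_def)
  ultimately have "b0 \<cdot> link M (lk (split_tangle m 0)) + b1 \<cdot> link M (lk (split_tangle m 1))
    + b2 \<cdot> link M (lk (split_tangle m 2)) + b3 \<cdot> link M (lk (split_tangle m 3))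
    + b_inf \<cdot> link M (lk (split_inf m)) \<in> cubic_relators M \<omega>"
    unfolding cubic_relators_def using oriented_shrink by blast
  then have 1: "b0 \<cdot> link M (lk (split_tangle m 0)) + b1 \<cdot> link M (lk (split_tangle m 1))
    + b2 \<cdot> link M (lk (split_tangle m 2)) + b3 \<cdot> link M (lk (split_tangle m 3))
    + b_inf \<cdot> link M (lk (split_inf m)) \<in> skein_submodule M \<omega>" (is "?A + _ \<in> _")
    unfolding skein_submodule_def by (intro comb.span_base) simp
  have 2: "b_inf \<cdot> (link M (lk (split_inf m)) - a_pow (- m) \<cdot> link M (lk tangle_inf)) \<in> skein_submodule M \<omega>"
    using framing_power[of "- m"] unfolding skein_submodule_def link_split_inf by (rule comb.span_scale)
  have eq2: "?A + (b_inf * a_pow (- m)) \<cdot> link M (lk tangle_inf) = (?A + b_inf \<cdot> link M (lk (split_inf m)))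
     - b_inf \<cdot> (link M (lk (split_inf m)) - a_pow (- m) \<cdot> link M (lk tangle_inf))"
    by (simp add: comb.scale_right_diff_distrib)
  have "?A + (b_inf * a_pow (- m)) \<cdot> link M (lk tangle_inf) \<in> skein_submodule M \<omega>"
    unfolding eq2 using 1 2 unfolding skein_submodule_def by (rule comb.span_diff)
  then show ?thesis
    using eq[of 0] eq[of 1] eq[of 2] eq[of 3] by simp
qed

end


section \<open>The recursion\<close>

lemma Pk_rec: "0 < k \<Longrightarrow> Pk k = b2 * Pk (k - 1) + b1 * Pk (k - 2) + b0 * Pk (k - 3)"
  and Pk_0: "Pk 0 = 1" and Pk_neg: "k < 0 \<Longrightarrow> Pk k = 0"
  by (subst Pk.simps; simp)+

text \<open>For \<open>k = 1\<close> the claim is the negative of the relation at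
  \<open>m = n - 3\<close>, since \<open>b3 = -1\<close>. Passing from \<open>k\<close> to
  \<open>k + 1\<close> eliminates \<open>D (n - k)\<close>, whose coefficient is
  \<open>Pk k\<close>.\<close>

lemma cubic_recursion:
  fixes D :: "int \<Rightarrow> 'a link_comb" and n k :: int
  assumes step: "\<And>m. b0 \<cdot> D m + b1 \<cdot> D (m + 1) + b2 \<cdot> D (m + 2) + b3 \<cdot> D (m + 3)
      + (b_inf * a_pow (- m)) \<cdot> Dinf \<in> skein_submodule M \<omega>"
    and "1 \<le> k"
  shows "D n - (Pk k \<cdot> D (n - k)
       + (b1 * Pk (k - 1) + b0 * Pk (k - 2)) \<cdot> D (n - k - 1)
       + (b0 * Pk (k - 1)) \<cdot> D (n - k - 2)
       + ((\<Sum>i = 0..k - 1. a_pow (3 - n + i) * Pk i) * b_inf) \<cdot> Dinf) \<in> skein_submodule M \<omega>"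
  using \<open>1 \<le> k\<close>
proof (induction k rule: int_ge_induct)
  case base
  have P: "Pk 1 = b2" "Pk (- 1) = 0"
    by (simp_all add: Pk_rec[of 1] Pk_0 Pk_neg)
  have eq: "D n - (Pk 1 \<cdot> D (n - 1) + (b1 * Pk (1 - 1) + b0 * Pk (1 - 2)) \<cdot> D (n - 1 - 1)
       + (b0 * Pk (1 - 1)) \<cdot> D (n - 1 - 2)
       + ((\<Sum>i = 0..1 - 1. a_pow (3 - n + i) * Pk i) * b_inf) \<cdot> Dinf)
     = - (b0 \<cdot> D (n - 3) + b1 \<cdot> D (n - 3 + 1) + b2 \<cdot> D (n - 3 + 2) + b3 \<cdot> D (n - 3 + 3)
      + (b_inf * a_pow (- (n - 3))) \<cdot> Dinf)"
    by (simp add: P Pk_0 b3_def mult.commute algebra_simps)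
  show ?case
    unfolding eq using step[of "n - 3"] unfolding skein_submodule_def by (rule comb.span_neg)
next
  case (step k)
  let ?S = "\<lambda>k. \<Sum>i = 0..k - 1. a_pow (3 - n + i) * Pk i"
  let ?R = "\<lambda>k. Pk k \<cdot> D (n - k) + (b1 * Pk (k - 1) + b0 * Pk (k - 2)) \<cdot> D (n - k - 1)
       + (b0 * Pk (k - 1)) \<cdot> D (n - k - 2) + (?S k * b_inf) \<cdot> Dinf"
  let ?m = "n - k - 3"
  \<comment> \<open>The relation whose leading term is \<open>D (n - k)\<close>. Its power of
    \<open>a\<close> has exponent \<open>- (n - k - 3)\<close>, which is the new summand's
    \<open>3 - n + k\<close>.\<close>
  let ?C = "b0 \<cdot> D ?m + b1 \<cdot> D (?m + 1) + b2 \<cdot> D (?m + 2) + b3 \<cdot> D (?m + 3) + (b_inf * a_pow (- ?m)) \<cdot> Dinf"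
  have P: "Pk (k + 1) = b2 * Pk k + b1 * Pk (k - 1) + b0 * Pk (k - 2)"
    using step.hyps Pk_rec[of "k + 1"] by simp
  have "{0..k} = insert k {0..k - 1}" using step.hyps by auto
  then have S: "(\<Sum>i = 0..k. a_pow (3 - n + i) * Pk i) = a_pow (3 - n + k) * Pk k + ?S k"
    by simp
  have eq: "D n - ?R (k + 1) = (D n - ?R k) - Pk k \<cdot> ?C"
  proof -
    have idx: "n - (k + 1) = n - k - 1" "n - k - 1 - 1 = n - k - 2" "n - k - 1 - 2 = ?m"
      "?m + 1 = n - k - 2" "?m + 2 = n - k - 1" "?m + 3 = n - k" "k + 1 - 1 = k" "k + 1 - 2 = k - 1"
      "- ?m = 3 - n + k"
      by simp_all
    define x0 x1 x2 x3 s where "x0 = D (n - k)" "x1 = D (n - k - 1)" "x2 = D (n - k - 2)" "x3 = D ?m" "s = ?S k"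
    show ?thesis
      unfolding idx S P
      unfolding x0_x1_x2_x3_s_def[symmetric]
      by (simp only: b3_def comb.scale_right_distrib comb.scale_left_distrib comb.scale_scale
          comb.scale_right_diff_distrib comb.scale_minus_left comb.scale_minus_right
          ring_distribs mult_minus_right mult_minus_left mult_1_right) (simp add: algebra_simps)
  qed
  show ?case
    unfolding eq using step.IH assms(1)[of ?m] unfolding skein_submodule_def
    by (intro comb.span_diff[OF _ comb.span_scale])
qed

theorem lemma4p1:
  fixes M :: "'a topology" and \<omega> :: "'a \<Rightarrow> 'a chain set"
    and h :: "real^3 \<Rightarrow> 'a" and X :: "'a set"
    and D :: "int \<Rightarrow> 'a set" and D_inf :: "'a set"
    and n k :: int
  assumes "oriented_3_manifold M \<omega>"
    and "k \<ge> 1"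
    and "oriented_chart M \<omega> h"
    and "\<forall>m \<in> {n, n - k, n - k - 1, n - k - 2}. link_with_tangle M h X (tangle m) (D m)"
    and "link_with_tangle M h X tangle_inf D_inf"
  shows "skein_class M \<omega> (link M (D n)) =
    skein_class M \<omega>
      (Pk k \<cdot> link M (D (n - k))
       + (b1 * Pk (k - 1) + b0 * Pk (k - 2)) \<cdot> link M (D (n - k - 1))
       + (b0 * Pk (k - 1)) \<cdot> link M (D (n - k - 2))
       + ((\<Sum>i = 0..k - 1. a_pow (3 - n + i) * Pk i) * b_inf) \<cdot> link M D_inf)"
proof -
  have X: "X \<inter> h ` ball3 = {}" "X \<subseteq> topspace M"
    using assms(5) by (auto simp: link_with_tangle_def framed_link_def)
  interpret link_exterior M h X
    using assms(1,3) X by unfold_locales (auto simp: oriented_3_manifold_def manifold_3_def oriented_chart_def)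
  have lk: "L = lk T" if "link_with_tangle M h X T L" "T \<subseteq> ball3" for T L
    using that by (auto simp: link_with_tangle_def lk_def)
  have tangle: "tangle m \<subseteq> ball3" for m
    unfolding tangle_eq_bands by (rule bands_subset_ball3)
  have "tangle_inf \<subseteq> ball3"
    by (auto simp: tangle_inf_def ball3_def forall_3)
  with assms(5) lk have Dinf: "D_inf = lk tangle_inf" by blast
  have D: "D m = lk (tangle m)" if "m \<in> {n, n - k, n - k - 1, n - k - 2}" for m
    using assms(4) that lk[OF _ tangle] by blast
  have framed_D: "framed_link M (lk (tangle m))" if "m \<in> {n, n - k, n - k - 1, n - k - 2}" for m
    using assms(4) that D[OF that] by (auto simp: link_with_tangle_def)
  \<comment> \<open>The recursion uses all \<open>tangle m\<close> from \<open>n - k - 2\<close> to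
    \<open>n\<close>. The indices \<open>n - k\<close> and \<open>n - k - 1\<close> represent both
    parities.\<close>
  have framed: "framed_link M (lk (tangle m))" for m
  proof (cases "even (n - k - m)")
    case True
    show ?thesis by (rule framed_tangle[OF framed_D[of "n - k"] True]) simp
  next
    case False
    then have "even (n - k - 1 - m)" by simp
    from framed_tangle[OF framed_D[of "n - k - 1"] this] show ?thesis by simp
  qed
  interpret skein_exterior M h X \<omega>
    using assms(3,5) Dinf by unfold_locales (auto simp: link_with_tangle_def)
  have combs: "link M (lk (tangle m)) \<in> link_combs M" "link M (lk tangle_inf) \<in> link_combs M" for m
    using link_in_link_combs framed framed_inf by auto
  have scale: "r \<cdot> f \<in> link_combs M" if "f \<in> link_combs M" for r f
    using that by (fastforce simp: link_combs_def lookup_scale_comb in_keys_iff)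
  have add: "f + g \<in> link_combs M" if "f \<in> link_combs M" "g \<in> link_combs M" for f g
    using that keys_add[of f g] by (fastforce simp: link_combs_def)
  show ?thesis
    using cubic_recursion[where D = "\<lambda>m. link M (lk (tangle m))", OF cubic_step[OF framed] assms(2), of n]
    by (subst skein_class_eq_iff) (auto intro!: add scale combs simp: D Dinf)
qed

end
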